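(* There is an algorithm which, given as input a graph $G$ that is isomorphic to a daisy cube but is given without any embedding into a hypercube (an "unlabeled" graph), computes a proper embedding of $G$ into a hypercube in linear time.
   Context: Let $B=\{0,1\}$ and let $B^h$ be the set of binary words $u=u_1\dots u_h$ of length $h$. The hypercube $Q_h$ has vertex set $B^h$, two words being adjacent iff they differ in exactly one position. For $u,v\in B^h$ write $u\le v$ if $u_i\le v_i$ for all $i$. For $X\subseteq B^h$, the daisy cube $Q_h(X)$ (of order $h$) is the subgraph of $Q_h$ induced by $\{v\in B^h : v\le x \text{ for some } x\in X\}$. A graph is called a daisy cube (of order $h$) if it is isomorphic to some $Q_h(X)$. A map $\alpha:V(G)\to B^h$ is an isometric embedding of $G$ into $Q_h$ if the Hamming distance between $\alpha(u)$ and $\alpha(v)$ equals the graph distance $d_G(u,v)$ for all $u,v\in V(G)$. If $G$ is isomorphic to a daisy cube of order $h$, an isometric embedding $\alpha$ of $G$ into $Q_h$ is called proper if $G$ is isomorphic to $Q_h(\alpha(V(G)))$. "Linear time" means time linear in the number of edges of $G$. *)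

theory Defs
  imports Main "HOL-Library.Extended_Nat"
begin

section \<open>Finite simple graphs\<close>

record 'a graph =
  verts :: "'a set"
  edges :: "'a set set"

definition simple_graph :: "'a graph \<Rightarrow> bool" where
  "simple_graph G \<longleftrightarrow>
     finite (verts G) \<and>
     edges G \<subseteq> {{u, v} | u v. u \<in> verts G \<and> v \<in> verts G \<and> u \<noteq> v}"

definition induced_subgraph :: "'a graph \<Rightarrow> 'a set \<Rightarrow> 'a graph" where
  "induced_subgraph G S =
     \<lparr>verts = verts G \<inter> S, edges = {e \<in> edges G. e \<subseteq> S}\<rparr>"

definition isomorphic :: "'a graph \<Rightarrow> 'b graph \<Rightarrow> bool" where
  "isomorphic G H \<longleftrightarrow>
     (\<exists>f. bij_betw f (verts G) (verts H) \<and>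
          (\<forall>u\<in>verts G. \<forall>v\<in>verts G. {u, v} \<in> edges G \<longleftrightarrow> {f u, f v} \<in> edges H))"

definition walk :: "'a graph \<Rightarrow> 'a list \<Rightarrow> bool" where
  "walk G p \<longleftrightarrow>
     p \<noteq> [] \<and> set p \<subseteq> verts G \<and> successively (\<lambda>u v. {u, v} \<in> edges G) p"

text \<open>The distance is \<open>\<infinity>\<close> between vertices that are not joined by a walk.\<close>

definition graph_dist :: "'a graph \<Rightarrow> 'a \<Rightarrow> 'a \<Rightarrow> enat" where
  "graph_dist G u v =
     (INF p \<in> {p. walk G p \<and> hd p = u \<and> last p = v}. enat (length p - 1))"


section \<open>Hypercubes, daisy cubes and proper embeddings\<close>

definition words :: "nat \<Rightarrow> bool list set" where
  "words h = {w. length w = h}"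

definition hamming :: "bool list \<Rightarrow> bool list \<Rightarrow> nat" where
  "hamming u v = card {i. i < length u \<and> u ! i \<noteq> v ! i}"

definition word_le :: "bool list \<Rightarrow> bool list \<Rightarrow> bool" where
  "word_le = list_all2 (\<le>)"

definition hypercube :: "nat \<Rightarrow> bool list graph" where
  "hypercube h =
     \<lparr>verts = words h,
      edges = {{u, v} | u v. u \<in> words h \<and> v \<in> words h \<and> hamming u v = 1}\<rparr>"

definition daisy_cube :: "nat \<Rightarrow> bool list set \<Rightarrow> bool list graph" where
  "daisy_cube h X = induced_subgraph (hypercube h) {v \<in> words h. \<exists>x\<in>X. word_le v x}"

definition is_daisy_cube_of_order :: "nat \<Rightarrow> 'a graph \<Rightarrow> bool" where
  "is_daisy_cube_of_order h G \<longleftrightarrow> (\<exists>X \<subseteq> words h. isomorphic G (daisy_cube h X))"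

definition is_daisy_cube :: "'a graph \<Rightarrow> bool" where
  "is_daisy_cube G \<longleftrightarrow> (\<exists>h. is_daisy_cube_of_order h G)"

definition isometric_embedding :: "'a graph \<Rightarrow> nat \<Rightarrow> ('a \<Rightarrow> bool list) \<Rightarrow> bool" where
  "isometric_embedding G h \<alpha> \<longleftrightarrow>
     \<alpha> ` verts G \<subseteq> words h \<and>
     (\<forall>u\<in>verts G. \<forall>v\<in>verts G. enat (hamming (\<alpha> u) (\<alpha> v)) = graph_dist G u v)"

definition proper_embedding :: "'a graph \<Rightarrow> nat \<Rightarrow> ('a \<Rightarrow> bool list) \<Rightarrow> bool" where
  "proper_embedding G h \<alpha> \<longleftrightarrow>
     is_daisy_cube_of_order h G \<and>
     isometric_embedding G h \<alpha> \<and>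
     isomorphic G (daisy_cube h (\<alpha> ` verts G))"


section \<open>Random access machine\<close>

text \<open>
  Unit-cost RAM programs in structured form. A machine has registers and, for constant-time
  indirect addressing, arrays; a program mentions only finitely many of either. Every register
  and every array cell holds one machine word.
\<close>

record state =
  regs :: "nat \<Rightarrow> nat"
  arrs :: "nat \<Rightarrow> nat \<Rightarrow> nat"

datatype com =
    Skip
  | Const nat nat
  | Copy nat nat
  | Add nat nat nat
  | Sub nat nat nat
  | Load nat nat nat
  | Store nat nat nat
  | Seq com com
  | IfLess nat nat com com
  | WhileLess nat nat com

abbreviation set_reg :: "nat \<Rightarrow> nat \<Rightarrow> state \<Rightarrow> state" where
  "set_reg x n s \<equiv> s\<lparr>regs := (regs s)(x := n)\<rparr>"

abbreviation set_cell :: "nat \<Rightarrow> nat \<Rightarrow> nat \<Rightarrow> state \<Rightarrow> state" where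
  "set_cell a i n s \<equiv> s\<lparr>arrs := (arrs s)(a := (arrs s a)(i := n))\<rparr>"

text \<open>
  \<open>exec W c s t s'\<close>: started in \<open>s\<close>, the program \<open>c\<close> halts after \<open>t\<close> steps in \<open>s'\<close>, and no
  number exceeding \<open>W\<close> is ever produced on the way (an instruction that would produce one
  blocks). A bound \<open>W\<close> that is polynomial in the input size gives the usual word RAM with
  logarithmic word length, so unit cost cannot be exploited by packing data into huge numbers.
\<close>

inductive exec :: "nat \<Rightarrow> com \<Rightarrow> state \<Rightarrow> nat \<Rightarrow> state \<Rightarrow> bool" for W :: nat where
  Skip: "exec W Skip s 1 s"
| Const: "n \<le> W \<Longrightarrow> exec W (Const x n) s 1 (set_reg x n s)"
| Copy: "exec W (Copy x y) s 1 (set_reg x (regs s y) s)"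
| Add: "regs s y + regs s z \<le> W \<Longrightarrow>
    exec W (Add x y z) s 1 (set_reg x (regs s y + regs s z) s)"
| Sub: "exec W (Sub x y z) s 1 (set_reg x (regs s y - regs s z) s)"
| Load: "exec W (Load x a y) s 1 (set_reg x (arrs s a (regs s y)) s)"
| Store: "exec W (Store a x y) s 1 (set_cell a (regs s x) (regs s y) s)"
| Seq: "exec W c1 s t1 s' \<Longrightarrow> exec W c2 s' t2 s'' \<Longrightarrow> exec W (Seq c1 c2) s (t1 + t2) s''"
| IfTrue: "regs s x < regs s y \<Longrightarrow> exec W c1 s t s' \<Longrightarrow>
    exec W (IfLess x y c1 c2) s (1 + t) s'"
| IfFalse: "\<not> regs s x < regs s y \<Longrightarrow> exec W c2 s t s' \<Longrightarrow>
    exec W (IfLess x y c1 c2) s (1 + t) s'"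
| WhileFalse: "\<not> regs s x < regs s y \<Longrightarrow> exec W (WhileLess x y c) s 1 s"
| WhileTrue: "regs s x < regs s y \<Longrightarrow> exec W c s t1 s' \<Longrightarrow>
    exec W (WhileLess x y c) s' t2 s'' \<Longrightarrow>
    exec W (WhileLess x y c) s (1 + t1 + t2) s''"

text \<open>
  Execution is deterministic, hence an existential statement about \<open>exec\<close> from a given initial
  state is a total correctness statement about the unique run.
\<close>

lemma exec_deterministic:
  assumes "exec W c s t s'" and "exec W c s u s''"
  shows "t = u \<and> s' = s''"
  using assms
proof (induction arbitrary: u s'' rule: exec.induct)
  case (Seq c1 s t1 s' c2 t2 s2)
  from Seq.prems show ?case
    by (cases rule: exec.cases) (use Seq.IH in blast)+
next
  case (IfTrue s x y c1 t s' c2)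
  from IfTrue.prems show ?case
    by (cases rule: exec.cases) (use IfTrue.IH IfTrue.hyps in blast)+
next
  case (IfFalse s x y c2 t s' c1)
  from IfFalse.prems show ?case
    by (cases rule: exec.cases) (use IfFalse.IH IfFalse.hyps in blast)+
next
  case (WhileTrue s x y c t1 s' t2 s2)
  from WhileTrue.prems show ?case
    by (cases rule: exec.cases) (use WhileTrue.IH WhileTrue.hyps in blast)+
qed (auto elim: exec.cases)


section \<open>Input and output\<close>

text \<open>
  Representation of a list of lists by two arrays: \<open>dat\<close> holds the concatenation, and the
  \<open>i\<close>-th list is its segment from \<open>off i\<close> (inclusive) to \<open>off (i + 1)\<close> (exclusive).
\<close>

definition stores_lists :: "(nat \<Rightarrow> nat) \<Rightarrow> (nat \<Rightarrow> nat) \<Rightarrow> nat list list \<Rightarrow> bool" where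
  "stores_lists off dat xss \<longleftrightarrow>
     (\<forall>i \<le> length xss. off i = length (concat (take i xss))) \<and>
     (\<forall>j < length (concat xss). dat j = concat xss ! j)"

text \<open>
  Adjacency lists of a graph whose vertices have been numbered \<open>0, \<dots>, n - 1\<close>. Neither the
  numbering nor the order of the neighbours in a list is assumed to carry any information.
\<close>

definition adjacency_lists :: "nat graph \<Rightarrow> nat list list \<Rightarrow> bool" where
  "adjacency_lists G adj \<longleftrightarrow>
     verts G = {..<length adj} \<and>
     (\<forall>u < length adj. distinct (adj ! u) \<and> set (adj ! u) = {v \<in> verts G. {u, v} \<in> edges G})"

text \<open>
  Register 0 holds the number of vertices, arrays 0 and 1 hold the adjacency lists in the sense
  of \<open>stores_lists\<close>, and everything else is 0.
\<close>

definition input_state :: "nat list list \<Rightarrow> state" where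
  "input_state adj =
     \<lparr>regs = (\<lambda>_. 0)(0 := length adj),
      arrs = (\<lambda>_ _. 0)
        (0 := (\<lambda>i. if i \<le> length adj then length (concat (take i adj)) else 0),
         1 := (\<lambda>j. if j < length (concat adj) then concat adj ! j else 0))\<rparr>"

text \<open>
  A word is written as the list of the positions of its ones, because the words of an embedding
  written out in full have total length \<open>h * n\<close>, which is not linear in the number of edges
  (for instance \<open>h * (h + 1)\<close> bits for the star with \<open>h\<close> edges).
\<close>

definition word_of :: "nat \<Rightarrow> nat list \<Rightarrow> bool list" where
  "word_of h xs = map (\<lambda>i. i \<in> set xs) [0..<h]"

text \<open>
  Register 0 holds the dimension \<open>h\<close>, and arrays 2 and 3 hold, for each vertex, the duplicate-free
  list of the positions of the ones in its word.
\<close>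

definition outputs_embedding :: "state \<Rightarrow> nat graph \<Rightarrow> nat \<Rightarrow> (nat \<Rightarrow> bool list) \<Rightarrow> bool" where
  "outputs_embedding s G h \<alpha> \<longleftrightarrow>
     regs s 0 = h \<and>
     (\<exists>xss. length xss = card (verts G) \<and>
            stores_lists (arrs s 2) (arrs s 3) xss \<and>
            (\<forall>xs \<in> set xss. distinct xs \<and> set xs \<subseteq> {..<h}) \<and>
            (\<forall>v \<in> verts G. \<alpha> v = word_of h (xss ! v)))"

end

theory Submission
  imports Defs
begin

text \<open>
  Identify the vertices with the sets of a finite downset of finite sets, two sets being adjacent iff
  they differ in one element. An embedding that sends a vertex \<open>r\<close> to the zero word is proper iff every
  element of \<open>r\<close> lies in all maximal sets. A vertex \<open>v\<close> of minimum degree lies below exactly one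
  maximal set \<open>x\<close>, and its neighbours determine the cube of all subsets of \<open>x\<close>: grow the cube from
  \<open>v\<close> and its neighbours by adding vertices that have two neighbours in it, which also yields
  coordinates relative to \<open>v\<close>. This cube is gated, with gate \<open>w \<inter> x\<close>, so one breadth-first search
  from it counts for every coordinate the vertices on the side not containing \<open>v\<close>. Since deleting
  an element is an injection, the vertex \<open>r\<close> of the cube that lies on the majority side of every
  coordinate consists of elements of all maximal sets. From such an \<open>r\<close> the same growing
  procedure reaches the whole graph, and the label sizes sum up to the number of edges.
\<close>

section \<open>Weakest preconditions with time credits\<close>

text \<open>Time is the obstacle. A label can be as long as the degree of its vertex, so it cannot
  be copied or compared whenever an edge is scanned. It is stored implicitly, as the coordinate of
  one edge to a parent, and is read off the path to the root. A vertex with two scanned neighbours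
  \<open>u\<close> and \<open>u1\<close> has the label \<open>L u \<union> L u1\<close>: its new
  coordinate is the only one of \<open>u1\<close> that \<open>u\<close> lacks, and marks set for
  \<open>u\<close> reveal it during one walk along the path of \<open>u1\<close>. The new vertex can
  pay for this walk, because deleting the elements of its label one at a time gives that many
  neighbours. Vertices outside the cube get no label in the counting stage; they are counted through
  their gates, which agree with them in every coordinate of the cube. Nor can a vertex be addressed
  by its label: \<open>r\<close> is found as a vertex of largest label among those whose coordinates
  all have a majority, which suffices since every set of coordinates is a label in the cube. Times
  are bounded by potentials: a vertex that still needs work carries credits proportional to its
  degree plus one.\<close>

definition wp :: "nat \<Rightarrow> com \<Rightarrow> (state \<Rightarrow> nat \<Rightarrow> bool) \<Rightarrow> state \<Rightarrow> nat \<Rightarrow> bool" where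
  "wp W c Q s T \<longleftrightarrow> (\<exists>t s'. exec W c s t s' \<and> t \<le> T \<and> Q s' (T - t))"

inductive_cases exec_elims:
  "exec W Skip s t s'" "exec W (Const x n) s t s'" "exec W (Copy x y) s t s'"
  "exec W (Add x y z) s t s'" "exec W (Sub x y z) s t s'" "exec W (Load x a y) s t s'"
  "exec W (Store a x y) s t s'" "exec W (Seq c1 c2) s t s'" "exec W (IfLess x y c1 c2) s t s'"

lemma wp_basic [simp]:
  "wp W Skip Q s T \<longleftrightarrow> 1 \<le> T \<and> Q s (T - 1)"
  "wp W (Const x n) Q s T \<longleftrightarrow> 1 \<le> T \<and> n \<le> W \<and> Q (set_reg x n s) (T - 1)"
  "wp W (Copy x y) Q s T \<longleftrightarrow> 1 \<le> T \<and> Q (set_reg x (regs s y) s) (T - 1)"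
  "wp W (Add x y z) Q s T \<longleftrightarrow>
     1 \<le> T \<and> regs s y + regs s z \<le> W \<and> Q (set_reg x (regs s y + regs s z) s) (T - 1)"
  "wp W (Sub x y z) Q s T \<longleftrightarrow> 1 \<le> T \<and> Q (set_reg x (regs s y - regs s z) s) (T - 1)"
  "wp W (Load x a y) Q s T \<longleftrightarrow> 1 \<le> T \<and> Q (set_reg x (arrs s a (regs s y)) s) (T - 1)"
  "wp W (Store a x y) Q s T \<longleftrightarrow> 1 \<le> T \<and> Q (set_cell a (regs s x) (regs s y) s) (T - 1)"
  unfolding wp_def by (fastforce elim: exec_elims intro: exec.intros)+

lemma wp_Seq [simp]: "wp W (Seq c1 c2) Q s T \<longleftrightarrow> wp W c1 (wp W c2 Q) s T"
proof
  assume "wp W (Seq c1 c2) Q s T"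
  then obtain t1 t2 s1 s2 where "exec W c1 s t1 s1" "exec W c2 s1 t2 s2"
      "t1 + t2 \<le> T" "Q s2 (T - (t1 + t2))"
    unfolding wp_def by (auto elim: exec_elims)
  then show "wp W c1 (wp W c2 Q) s T"
    unfolding wp_def
    by (intro exI[of _ t1] exI[of _ s1] conjI exI[of _ t2] exI[of _ s2]) auto
next
  assume "wp W c1 (wp W c2 Q) s T"
  then obtain t1 t2 s1 s2 where "exec W c1 s t1 s1" "exec W c2 s1 t2 s2"
      "t1 \<le> T" "t2 \<le> T - t1" "Q s2 (T - t1 - t2)"
    unfolding wp_def by auto
  then show "wp W (Seq c1 c2) Q s T"
    unfolding wp_def by (intro exI[of _ "t1 + t2"] exI[of _ s2]) (auto intro: exec.intros)
qed

lemma wp_IfLess [simp]: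
  "wp W (IfLess x y c1 c2) Q s T \<longleftrightarrow>
     1 \<le> T \<and> (if regs s x < regs s y then wp W c1 Q s (T - 1) else wp W c2 Q s (T - 1))"
proof
  assume "wp W (IfLess x y c1 c2) Q s T"
  then show "1 \<le> T \<and> (if regs s x < regs s y then wp W c1 Q s (T - 1) else wp W c2 Q s (T - 1))"
    unfolding wp_def by (fastforce elim: exec_elims)
next
  assume *: "1 \<le> T \<and> (if regs s x < regs s y then wp W c1 Q s (T - 1) else wp W c2 Q s (T - 1))"
  let ?c = "if regs s x < regs s y then c1 else c2"
  obtain t s' where t: "exec W ?c s t s'" "t \<le> T - 1" "Q s' (T - 1 - t)"
    using * unfolding wp_def by (auto split: if_splits)
  have "exec W (IfLess x y c1 c2) s (1 + t) s'"
    using t(1) exec.IfTrue[of s x y] exec.IfFalse[of s x y] by presburger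
  with t * show "wp W (IfLess x y c1 c2) Q s T"
    unfolding wp_def by (intro exI[of _ "1 + t"] exI[of _ s']) auto
qed

section \<open>Frame conditions: the registers and arrays that a program may change\<close>

fun wregs :: "com \<Rightarrow> nat set" where
  "wregs (Const x n) = {x}"
| "wregs (Copy x y) = {x}"
| "wregs (Add x y z) = {x}"
| "wregs (Sub x y z) = {x}"
| "wregs (Load x a y) = {x}"
| "wregs (Seq c1 c2) = wregs c1 \<union> wregs c2"
| "wregs (IfLess x y c1 c2) = wregs c1 \<union> wregs c2"
| "wregs (WhileLess x y c) = wregs c"
| "wregs _ = {}"

fun warrs :: "com \<Rightarrow> nat set" where
  "warrs (Store a x y) = {a}"
| "warrs (Seq c1 c2) = warrs c1 \<union> warrs c2"
| "warrs (IfLess x y c1 c2) = warrs c1 \<union> warrs c2"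
| "warrs (WhileLess x y c) = warrs c"
| "warrs _ = {}"

definition agree :: "com \<Rightarrow> state \<Rightarrow> state \<Rightarrow> bool" where
  "agree c s s' \<longleftrightarrow> (\<forall>x. x \<notin> wregs c \<longrightarrow> regs s' x = regs s x) \<and>
     (\<forall>a. a \<notin> warrs c \<longrightarrow> arrs s' a = arrs s a)"

lemma agree_refl [simp]: "agree c s s"
  by (simp add: agree_def)

lemma agree_trans: "agree c s s' \<Longrightarrow> agree c s' s'' \<Longrightarrow> agree c s s''"
  by (simp add: agree_def)

lemma agreeD:
  "agree c s s' \<Longrightarrow> x \<notin> wregs c \<Longrightarrow> regs s' x = regs s x"
  "agree c s s' \<Longrightarrow> a \<notin> warrs c \<Longrightarrow> arrs s' a = arrs s a"
  by (auto simp: agree_def)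

lemma exec_agree: "exec W c s t s' \<Longrightarrow> agree c s s'"
  by (induction rule: exec.induct) (auto simp: agree_def)

text \<open>\<open>exec_agree\<close> supplies the frame fact for every run, so the loop invariants
  below need not list what their bodies leave alone.\<close>

lemma wp_mono:
  assumes "wp W c P s T" and "\<And>s' T'. agree c s s' \<Longrightarrow> P s' T' \<Longrightarrow> Q s' T'"
  shows "wp W c Q s T"
  using assms exec_agree unfolding wp_def by blast

text \<open>Postconditions are not assumed monotone in the remaining credits. A surplus is therefore
  carried beside the credits \<open>T0\<close> for which \<open>Q\<close> was established instead of
  being absorbed by \<open>Q\<close>.\<close>

lemma wp_credit:
  assumes "wp W c Q s T"
  shows "wp W c (\<lambda>s' T'. \<exists>T0. Q s' T0 \<and> T0 + e \<le> T') s (T + e)"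
proof -
  obtain t s' where "exec W c s t s'" "t \<le> T" "Q s' (T - t)"
    using assms by (auto simp: wp_def)
  then show ?thesis
    unfolding wp_def
    by (intro exI[of _ t] exI[of _ s'] conjI exI[of _ "T - t"]) auto
qed

lemma wp_ge:
  assumes "wp W c Q s T0" and "T0 \<le> T"
  shows "wp W c (\<lambda>s' T'. \<exists>T1. Q s' T1 \<and> T1 + (T - T0) \<le> T') s T"
  using wp_credit[OF assms(1), of "T - T0"] assms(2) by simp

text \<open>Every iteration spends a credit, so the credits also bound the number of iterations.\<close>

lemma wp_WhileLess:
  assumes "I s T"
    and step: "\<And>s' T'. agree c s s' \<Longrightarrow> I s' T' \<Longrightarrow> regs s' x < regs s' y \<Longrightarrow>
      1 \<le> T' \<and> wp W c I s' (T' - 1)"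
    and exit: "\<And>s' T'. agree c s s' \<Longrightarrow> I s' T' \<Longrightarrow> \<not> regs s' x < regs s' y \<Longrightarrow>
      1 \<le> T' \<and> Q s' (T' - 1)"
  shows "wp W (WhileLess x y c) Q s T"
proof -
  have "wp W (WhileLess x y c) Q s' T'" if "agree c s s'" "I s' T'" for s' T'
    using that
  proof (induction T' arbitrary: s' rule: less_induct)
    case (less T')
    show ?case
    proof (cases "regs s' x < regs s' y")
      case False
      then show ?thesis
        using exit[OF less.prems False] exec.WhileFalse[OF False] unfolding wp_def by blast
    next
      case True
      obtain t1 s1 where 1: "exec W c s' t1 s1" "1 \<le> T'" "t1 \<le> T' - 1" "I s1 (T' - 1 - t1)"
        using step[OF less.prems True] unfolding wp_def by blast
      have "wp W (WhileLess x y c) Q s1 (T' - 1 - t1)"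
        using 1 agree_trans[OF less.prems(1) exec_agree[OF 1(1)]] by (intro less.IH) auto
      then obtain t2 s2 where 2: "exec W (WhileLess x y c) s1 t2 s2" "t2 \<le> T' - 1 - t1"
          "Q s2 (T' - 1 - t1 - t2)"
        unfolding wp_def by blast
      show ?thesis
        unfolding wp_def
        using exec.WhileTrue[OF True 1(1) 2(1)] 1 2
        by (intro exI[of _ "1 + t1 + t2"] exI[of _ s2]) auto
    qed
  qed
  then show ?thesis using assms(1) by simp
qed

section \<open>Labellings of downsets\<close>

text \<open>Coordinates are positions in the adjacency list of the root, so the program has to
  invent no names. The last clause keeps the growing procedure inside \<open>S\<close>, since it
  adds a vertex only after seeing two of its neighbours.\<close>

definition labelling :: "nat list list \<Rightarrow> nat \<Rightarrow> nat set \<Rightarrow> (nat \<Rightarrow> nat set) \<Rightarrow> bool" where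
  "labelling adj \<rho> S L \<longleftrightarrow>
     \<rho> \<in> S \<and> S \<subseteq> {..<length adj} \<and> set (adj ! \<rho>) \<subseteq> S \<and> L \<rho> = {} \<and>
     (\<forall>k < length (adj ! \<rho>). L (adj ! \<rho> ! k) = {k}) \<and>
     inj_on L S \<and>
     (\<forall>u\<in>S. L u \<subseteq> {..<length (adj ! \<rho>)}) \<and>
     (\<forall>u\<in>S. \<forall>w\<in>S. w \<in> set (adj ! u) \<longleftrightarrow> (\<exists>i. L w = sym_diff (L u) {i})) \<and>
     (\<forall>u\<in>S. \<forall>i\<in>L u. \<exists>w\<in>S. L w = L u - {i}) \<and>
     (\<forall>w < length adj. w \<notin> S \<longrightarrow>
        (\<forall>u1\<in>S. \<forall>u2\<in>S. w \<in> set (adj ! u1) \<and> w \<in> set (adj ! u2) \<longrightarrow> u1 = u2))"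

text \<open>\<open>lev\<close> plays the distance to \<open>S\<close> and \<open>g\<close> the gate.
  Only what a breadth-first search uses is demanded: an edge one level up keeps the gate, so a
  vertex may inherit it from whichever neighbour finds it first.\<close>

definition gating :: "nat list list \<Rightarrow> nat set \<Rightarrow> (nat \<Rightarrow> nat) \<Rightarrow> (nat \<Rightarrow> nat) \<Rightarrow> bool" where
  "gating adj S g lev \<longleftrightarrow>
     S \<subseteq> {..<length adj} \<and> (\<forall>w<length adj. g w \<in> S \<and> (lev w = 0 \<longrightarrow> w \<in> S)) \<and>
     (\<forall>w\<in>S. lev w = 0 \<and> g w = w) \<and>
     (\<forall>u<length adj. \<forall>w\<in>set (adj ! u). lev w \<le> Suc (lev u) \<and> (lev w = Suc (lev u) \<longrightarrow> g w = g u)) \<and>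
     (\<forall>w<length adj. 0 < lev w \<longrightarrow> (\<exists>u<length adj. w \<in> set (adj ! u) \<and> lev w = Suc (lev u)))"

text \<open>The set family \<phi> exists for the proofs only; the programs see nothing but the
  adjacency lists.\<close>

locale daisy =
  fixes adj :: "nat list list" and \<phi> :: "nat \<Rightarrow> nat set"
  assumes distinct_adj: "u < length adj \<Longrightarrow> distinct (adj ! u)"
    and fin: "u < length adj \<Longrightarrow> finite (\<phi> u)"
    and inj: "inj_on \<phi> {..<length adj}"
    and down: "u < length adj \<Longrightarrow> A \<subseteq> \<phi> u \<Longrightarrow> \<exists>w<length adj. \<phi> w = A"
    and nbrs: "u < length adj \<Longrightarrow>
      set (adj ! u) = {w. w < length adj \<and> (\<exists>i. \<phi> w = sym_diff (\<phi> u) {i})}"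
begin

abbreviation "n \<equiv> length adj"
abbreviation "deg u \<equiv> length (adj ! u)"

section \<open>Directions and labels at a vertex\<close>

definition dirs :: "nat \<Rightarrow> nat set" where
  "dirs \<rho> = {i. \<exists>w<n. \<phi> w = sym_diff (\<phi> \<rho>) {i}}"

definition dir :: "nat \<Rightarrow> nat \<Rightarrow> nat" where
  "dir \<rho> k = (SOME i. \<phi> (adj ! \<rho> ! k) = sym_diff (\<phi> \<rho>) {i})"

text \<open>This is \<phi> translated so that \<rho> becomes the empty set, with elements renamed to
  list positions. It is defined for every vertex: elements that are no directions at \<rho> are
  dropped, which is why a vertex and its gate get the same label.\<close>

definition lab :: "nat \<Rightarrow> nat \<Rightarrow> nat set" where
  "lab \<rho> w = {k. k < deg \<rho> \<and> dir \<rho> k \<in> sym_diff (\<phi> w) (\<phi> \<rho>)}"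

text \<open>For a vertex of minimum degree this will be the cube below its maximal set, for the
  final root the whole graph.\<close>

definition dspan :: "nat \<Rightarrow> nat set" where
  "dspan \<rho> = {w. w < n \<and> sym_diff (\<phi> w) (\<phi> \<rho>) \<subseteq> dirs \<rho>}"

text \<open>In a finite downset this says that \<open>i\<close> lies in all maximal sets. The form
  with \<open>insert\<close> lets such elements be added one by one to any vertex.\<close>

definition common :: "nat \<Rightarrow> bool" where
  "common i \<longleftrightarrow> (\<forall>w<n. \<exists>u<n. \<phi> u = insert i (\<phi> w))"

lemma inj': "u < n \<Longrightarrow> w < n \<Longrightarrow> \<phi> u = \<phi> w \<Longrightarrow> u = w"
  using inj by (auto simp: inj_on_def)

lemma nbr_less: "u < n \<Longrightarrow> w \<in> set (adj ! u) \<Longrightarrow> w < n"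
  using nbrs by auto

lemma dir:
  assumes "\<rho> < n" "k < deg \<rho>"
  shows "\<phi> (adj ! \<rho> ! k) = sym_diff (\<phi> \<rho>) {dir \<rho> k}"
proof -
  have "adj ! \<rho> ! k \<in> set (adj ! \<rho>)"
    using assms by simp
  then have "\<exists>i. \<phi> (adj ! \<rho> ! k) = sym_diff (\<phi> \<rho>) {i}"
    using nbrs assms by auto
  then show ?thesis
    unfolding dir_def by (rule someI_ex)
qed

lemma bij_dir:
  assumes "\<rho> < n"
  shows "bij_betw (dir \<rho>) {..<deg \<rho>} (dirs \<rho>)"
  unfolding bij_betw_def
proof
  show "inj_on (dir \<rho>) {..<deg \<rho>}"
  proof (rule inj_onI)
    fix k l assume kl: "k \<in> {..<deg \<rho>}" "l \<in> {..<deg \<rho>}" "dir \<rho> k = dir \<rho> l"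
    then have "\<phi> (adj ! \<rho> ! k) = \<phi> (adj ! \<rho> ! l)"
      using dir assms by auto
    then have "adj ! \<rho> ! k = adj ! \<rho> ! l"
      using kl assms by (intro inj') (auto intro: nbr_less)
    then show "k = l"
      using kl assms distinct_adj nth_eq_iff_index_eq by auto
  qed
  show "dir \<rho> ` {..<deg \<rho>} = dirs \<rho>"
  proof (intro equalityI subsetI)
    fix i assume "i \<in> dir \<rho> ` {..<deg \<rho>}"
    then obtain k where "k < deg \<rho>" "i = dir \<rho> k" by auto
    then show "i \<in> dirs \<rho>"
      using dir[OF assms, of k] nbr_less[OF assms, of "adj ! \<rho> ! k"] by (auto simp: dirs_def)
  next
    fix i assume "i \<in> dirs \<rho>"
    then obtain w where w: "w < n" "\<phi> w = sym_diff (\<phi> \<rho>) {i}" by (auto simp: dirs_def)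
    then have "w \<in> set (adj ! \<rho>)" using nbrs assms by auto
    then obtain k where k: "k < deg \<rho>" "w = adj ! \<rho> ! k" by (auto simp: in_set_conv_nth)
    then have "sym_diff (\<phi> \<rho>) {i} = sym_diff (\<phi> \<rho>) {dir \<rho> k}" using w dir assms by simp
    then have "i = dir \<rho> k" by blast
    then show "i \<in> dir \<rho> ` {..<deg \<rho>}" using k by blast
  qed
qed

lemma dir_image_lab:
  assumes "\<rho> < n" "w \<in> dspan \<rho>"
  shows "dir \<rho> ` lab \<rho> w = sym_diff (\<phi> w) (\<phi> \<rho>)"
proof -
  have "sym_diff (\<phi> w) (\<phi> \<rho>) \<subseteq> dir \<rho> ` {..<deg \<rho>}"
    using assms bij_dir by (auto simp: dspan_def bij_betw_def)
  then show ?thesis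
    unfolding lab_def by blast
qed

text \<open>All clauses of a labelling except the deletions hold for an arbitrary root.
  \<open>closed\<close> supplies those: toggling a differing element back towards \<rho> must not
  leave the graph.\<close>

lemma labelling_dspan:
  assumes \<rho>: "\<rho> < n"
    and closed: "\<And>w i. w \<in> dspan \<rho> \<Longrightarrow> i \<in> sym_diff (\<phi> w) (\<phi> \<rho>) \<Longrightarrow> \<exists>u<n. \<phi> u = sym_diff (\<phi> w) {i}"
  shows "labelling adj \<rho> (dspan \<rho>) (lab \<rho>)"
proof -
  note bij = bij_dir[OF \<rho>]
  have inj_dir: "inj_on (dir \<rho>) {..<deg \<rho>}" and ran: "dir \<rho> ` {..<deg \<rho>} = dirs \<rho>"
    using bij by (auto simp: bij_betw_def)
  have img: "dir \<rho> ` lab \<rho> w = sym_diff (\<phi> w) (\<phi> \<rho>)" if "w \<in> dspan \<rho>" for w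
    using dir_image_lab[OF \<rho> that] .
  have lab_sub: "lab \<rho> w \<subseteq> {..<deg \<rho>}" for w
    by (auto simp: lab_def)
  have lab_eq: "lab \<rho> w = A" if "w \<in> dspan \<rho>" "A \<subseteq> {..<deg \<rho>}" "dir \<rho> ` A = sym_diff (\<phi> w) (\<phi> \<rho>)" for w A
    using that img[OF that(1)] inj_on_image_eq_iff[OF inj_dir lab_sub that(2)] by simp
  have root: "\<rho> \<in> dspan \<rho>" "lab \<rho> \<rho> = {}"
    using \<rho> by (auto simp: dspan_def lab_def)
  have nb: "adj ! \<rho> ! k \<in> dspan \<rho> \<and> lab \<rho> (adj ! \<rho> ! k) = {k}" if k: "k < deg \<rho>" for k
  proof -
    have eq: "sym_diff (\<phi> (adj ! \<rho> ! k)) (\<phi> \<rho>) = {dir \<rho> k}"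
      using dir[OF \<rho> k] by blast
    have "dir \<rho> k \<in> dirs \<rho>" using ran k by blast
    then have "sym_diff (\<phi> (adj ! \<rho> ! k)) (\<phi> \<rho>) \<subseteq> dirs \<rho>"
      unfolding eq by simp
    then have 1: "adj ! \<rho> ! k \<in> dspan \<rho>"
      unfolding dspan_def using nbr_less[OF \<rho>] k by simp
    moreover have "lab \<rho> (adj ! \<rho> ! k) = {k}"
      using k eq by (intro lab_eq 1) auto
    ultimately show ?thesis by simp
  qed
  have inj_lab: "inj_on (lab \<rho>) (dspan \<rho>)"
  proof (rule inj_onI)
    fix u w assume uw: "u \<in> dspan \<rho>" "w \<in> dspan \<rho>" "lab \<rho> u = lab \<rho> w"
    then have "sym_diff (\<phi> u) (\<phi> \<rho>) = sym_diff (\<phi> w) (\<phi> \<rho>)"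
      using img by metis
    then have "\<phi> u = \<phi> w" by blast
    then show "u = w" using uw inj' by (auto simp: dspan_def)
  qed
  have edge: "w \<in> set (adj ! u) \<longleftrightarrow> (\<exists>i. lab \<rho> w = sym_diff (lab \<rho> u) {i})"
    if uw: "u \<in> dspan \<rho>" "w \<in> dspan \<rho>" for u w
  proof
    assume "w \<in> set (adj ! u)"
    then obtain j where j: "\<phi> w = sym_diff (\<phi> u) {j}"
      using uw nbrs by (auto simp: dspan_def)
    \<comment> \<open>The toggled element separates \<rho> from at least one end of the edge; as
      both ends lie in \<open>dspan \<rho>\<close>, it is a direction.\<close>
    then have "j \<in> sym_diff (\<phi> w) (\<phi> \<rho>) \<or> j \<in> sym_diff (\<phi> u) (\<phi> \<rho>)" by blast
    then have "j \<in> dirs \<rho>" using uw by (auto simp: dspan_def)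
    then obtain i where i: "i < deg \<rho>" "j = dir \<rho> i" using ran by auto
    have "dir \<rho> ` sym_diff (lab \<rho> u) {i} = sym_diff (dir \<rho> ` lab \<rho> u) {j}"
      using i lab_sub[of u] inj_dir by (auto simp: inj_on_def)
    also have "\<dots> = sym_diff (\<phi> w) (\<phi> \<rho>)" using img[OF uw(1)] j by blast
    finally show "\<exists>i. lab \<rho> w = sym_diff (lab \<rho> u) {i}"
      using i lab_sub[of u] by (intro exI[of _ i] lab_eq uw) auto
  next
    assume "\<exists>i. lab \<rho> w = sym_diff (lab \<rho> u) {i}"
    then obtain i where i: "lab \<rho> w = sym_diff (lab \<rho> u) {i}" ..
    then have "i \<in> lab \<rho> w \<or> i \<in> lab \<rho> u" by blast
    then have "i < deg \<rho>" using lab_sub[of u] lab_sub[of w] by blast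
    then have "dir \<rho> ` lab \<rho> w = sym_diff (dir \<rho> ` lab \<rho> u) {dir \<rho> i}"
      unfolding i using lab_sub[of u] inj_dir by (auto simp: inj_on_def)
    then have "sym_diff (\<phi> w) (\<phi> \<rho>) = sym_diff (sym_diff (\<phi> u) (\<phi> \<rho>)) {dir \<rho> i}"
      using img uw by simp
    then have "\<phi> w = sym_diff (\<phi> u) {dir \<rho> i}" by blast
    then show "w \<in> set (adj ! u)"
      using uw nbrs by (auto simp: dspan_def)
  qed
  have pred: "\<exists>u\<in>dspan \<rho>. lab \<rho> u = lab \<rho> w - {i}" if w: "w \<in> dspan \<rho>" "i \<in> lab \<rho> w" for w i
  proof -
    have i: "dir \<rho> i \<in> sym_diff (\<phi> w) (\<phi> \<rho>)" "i < deg \<rho>"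
      using w by (auto simp: lab_def)
    obtain u where u: "u < n" "\<phi> u = sym_diff (\<phi> w) {dir \<rho> i}"
      using closed[OF w(1) i(1)] by blast
    have eq: "sym_diff (\<phi> u) (\<phi> \<rho>) = sym_diff (\<phi> w) (\<phi> \<rho>) - {dir \<rho> i}"
      using u i by blast
    then have us: "u \<in> dspan \<rho>" using w u by (auto simp: dspan_def)
    have "dir \<rho> ` (lab \<rho> w - {i}) = dir \<rho> ` lab \<rho> w - {dir \<rho> i}"
      using lab_sub[of w] inj_dir i(2) by (auto simp: inj_on_def)
    also have "\<dots> = sym_diff (\<phi> u) (\<phi> \<rho>)" using img[OF w(1)] eq by simp
    finally show ?thesis
      using us lab_sub[of w] by (intro bexI[of _ u] lab_eq) auto
  qed
  have out: "u1 = u2" if w: "w < n" "w \<notin> dspan \<rho>" and u: "u1 \<in> dspan \<rho>" "u2 \<in> dspan \<rho>"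
    "w \<in> set (adj ! u1)" "w \<in> set (adj ! u2)" for w u1 u2
  proof -
    \<comment> \<open>\<open>z\<close> witnesses that \<open>w\<close> lies outside. A neighbour
      inside must agree with \<rho> at \<open>z\<close>, so the edge to it toggles \<open>z\<close>,
      which determines the neighbour.\<close>
    obtain z where z: "z \<in> sym_diff (\<phi> w) (\<phi> \<rho>)" "z \<notin> dirs \<rho>"
      using w by (auto simp: dspan_def)
    have *: "\<phi> u = sym_diff (\<phi> w) {z}" if u: "u \<in> dspan \<rho>" "w \<in> set (adj ! u)" for u
    proof -
      obtain i where i: "\<phi> w = sym_diff (\<phi> u) {i}"
        using u nbrs by (auto simp: dspan_def)
      moreover have "z \<notin> sym_diff (\<phi> u) (\<phi> \<rho>)"
        using u z by (auto simp: dspan_def)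
      ultimately have "z = i" using z by blast
      then show ?thesis using i by blast
    qed
    show ?thesis using *[OF u(1,3)] *[OF u(2,4)] u inj' by (auto simp: dspan_def)
  qed
  have "dspan \<rho> \<subseteq> {..<n}" by (auto simp: dspan_def)
  moreover have "set (adj ! \<rho>) \<subseteq> dspan \<rho>" using nb by (auto simp: in_set_conv_nth)
  moreover have "\<forall>k<deg \<rho>. lab \<rho> (adj ! \<rho> ! k) = {k}" using nb by blast
  moreover have "\<forall>u\<in>dspan \<rho>. \<forall>w\<in>dspan \<rho>. w \<in> set (adj ! u) \<longleftrightarrow> (\<exists>i. lab \<rho> w = sym_diff (lab \<rho> u) {i})"
    by (intro ballI edge)
  moreover have "\<forall>u\<in>dspan \<rho>. \<forall>i\<in>lab \<rho> u. \<exists>w\<in>dspan \<rho>. lab \<rho> w = lab \<rho> u - {i}"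
    by (intro ballI pred)
  moreover have "\<forall>w<n. w \<notin> dspan \<rho> \<longrightarrow> (\<forall>u1\<in>dspan \<rho>. \<forall>u2\<in>dspan \<rho>.
      w \<in> set (adj ! u1) \<and> w \<in> set (adj ! u2) \<longrightarrow> u1 = u2)"
    using out by blast
  moreover have "\<forall>u\<in>dspan \<rho>. lab \<rho> u \<subseteq> {..<deg \<rho>}" using lab_sub by blast
  ultimately show ?thesis
    unfolding labelling_def using root inj_lab by (intro conjI) assumption+
qed

section \<open>A vertex of minimum degree, its gated cube, and the majority vertex\<close>

text \<open>A maximal set above \<open>\<phi> v\<close> has only deletions as neighbours, so
  \<open>deg x \<le> card (\<phi> x)\<close>. Every element of \<open>\<phi> x\<close> can be
  toggled at \<open>v\<close> without leaving the downset, so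
  \<open>\<phi> x \<subseteq> dirs v\<close>. As \<open>card (dirs v) = deg v \<le> deg x\<close>,
  equality holds throughout.\<close>

lemma min_degree:
  assumes v: "v < n" and min: "\<And>u. u < n \<Longrightarrow> deg v \<le> deg u"
  obtains x where "x < n" "\<phi> x = dirs v" "\<phi> v \<subseteq> dirs v"
proof -
  have "finite (\<phi> ` {..<n})" by simp
  moreover have "\<phi> v \<in> \<phi> ` {..<n}" using v by simp
  ultimately have "\<exists>X\<in>\<phi> ` {..<n}. \<phi> v \<subseteq> X \<and> (\<forall>Y\<in>\<phi> ` {..<n}. X \<subseteq> Y \<longrightarrow> X = Y)"
    by (rule finite_has_maximal2)
  then obtain X where X: "X \<in> \<phi> ` {..<n}" "\<phi> v \<subseteq> X" "\<forall>Y\<in>\<phi> ` {..<n}. X \<subseteq> Y \<longrightarrow> X = Y"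
    by (elim bexE conjE)
  then obtain x where x: "x < n" "X = \<phi> x" by auto
  have "dirs x \<subseteq> \<phi> x"
  proof
    fix i assume "i \<in> dirs x"
    then obtain w where w: "w < n" "\<phi> w = sym_diff (\<phi> x) {i}" by (auto simp: dirs_def)
    show "i \<in> \<phi> x"
    proof (rule ccontr)
      assume "i \<notin> \<phi> x"
      moreover from this have "X \<subseteq> \<phi> w" using w x by auto
      then have "X = \<phi> w" using X(3) w(1) by simp
      ultimately show False using w x by auto
    qed
  qed
  then have "deg x \<le> card (\<phi> x)"
    using bij_dir[OF x(1)] fin[OF x(1)] by (metis bij_betw_same_card card_lessThan card_mono)
  moreover have sub: "\<phi> x \<subseteq> dirs v"
  proof
    fix i assume "i \<in> \<phi> x"
    then have "sym_diff (\<phi> v) {i} \<subseteq> \<phi> x" using X x by blast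
    then show "i \<in> dirs v" using down[OF x(1)] by (auto simp: dirs_def)
  qed
  moreover have "card (dirs v) = deg v" "finite (dirs v)"
    using bij_betw_same_card[OF bij_dir[OF v]] bij_betw_finite[OF bij_dir[OF v]] by auto
  ultimately have "\<phi> x = dirs v"
    using min[OF x(1)] by (intro card_seteq) auto
  then show ?thesis using that[OF x(1)] X(2) x(2) by simp
qed

text \<open>All parts rest on \<open>dspan v\<close> being the family of all subsets of
  \<open>\<phi> x\<close>, inside which toggling is unrestricted. The gate of \<open>w\<close> is
  \<open>\<phi> w \<inter> dirs v\<close>, and its level is the number of elements cut off.\<close>

lemma dspan_min_degree:
  assumes v: "v < n" and min: "\<And>u. u < n \<Longrightarrow> deg v \<le> deg u"
  shows "labelling adj v (dspan v) (lab v)"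
    and "A \<subseteq> {..<deg v} \<Longrightarrow> \<exists>w\<in>dspan v. lab v w = A"
    and "\<exists>g lev. gating adj (dspan v) g lev \<and> (\<forall>w<n. lab v (g w) = lab v w)"
proof -
  obtain x where x: "x < n" "\<phi> x = dirs v" "\<phi> v \<subseteq> dirs v"
    using min_degree[OF assms] by blast
  have dspan: "dspan v = {w. w < n \<and> \<phi> w \<subseteq> dirs v}"
    using x by (auto simp: dspan_def)
  show "labelling adj v (dspan v) (lab v)"
  proof (rule labelling_dspan[OF v])
    fix w i assume "w \<in> dspan v" "i \<in> sym_diff (\<phi> w) (\<phi> v)"
    then have "sym_diff (\<phi> w) {i} \<subseteq> \<phi> x"
      using dspan x by auto
    then show "\<exists>u<n. \<phi> u = sym_diff (\<phi> w) {i}"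
      using down[OF x(1)] by blast
  qed
  have ran: "dir v ` {..<deg v} = dirs v" and inj_dir: "inj_on (dir v) {..<deg v}"
    using bij_dir[OF v] by (auto simp: bij_betw_def)
  show "\<exists>w\<in>dspan v. lab v w = A" if A: "A \<subseteq> {..<deg v}"
  proof -
    have 1: "dir v ` A \<subseteq> dirs v" using A ran by blast
    then have "sym_diff (\<phi> v) (dir v ` A) \<subseteq> \<phi> x" using x by blast
    then obtain w where w: "w < n" "\<phi> w = sym_diff (\<phi> v) (dir v ` A)"
      using down[OF x(1)] by blast
    have sd: "sym_diff (\<phi> w) (\<phi> v) = dir v ` A" using w by blast
    have "lab v w = A"
      unfolding lab_def sd using A inj_dir by (auto simp: inj_on_def)
    then show ?thesis using w 1 sd by (intro bexI[of _ w]) (auto simp: dspan_def)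
  qed
  show "\<exists>g lev. gating adj (dspan v) g lev \<and> (\<forall>w<n. lab v (g w) = lab v w)"
  proof -
    have "\<forall>w. \<exists>g. w < n \<longrightarrow> g < n \<and> \<phi> g = \<phi> w \<inter> dirs v"
      using down by (metis inf_le1)
    then obtain g where g: "\<And>w. w < n \<Longrightarrow> g w < n \<and> \<phi> (g w) = \<phi> w \<inter> dirs v"
      by metis
    define lev where "lev w = card (\<phi> w - dirs v)" for w
    have gs: "g w \<in> dspan v" if "w < n" for w using g[OF that] dspan by auto
    have eqg: "g u = g w" if "u < n" "w < n" "\<phi> u \<inter> dirs v = \<phi> w \<inter> dirs v" for u w
      using that g inj' by metis
    \<comment> \<open>An edge toggles one element. The level rises only if this element lies outside
      \<open>dirs v\<close>, and then the intersection with \<open>dirs v\<close> is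
      unchanged.\<close>
    have edge: "lev w \<le> Suc (lev u) \<and> (lev w = Suc (lev u) \<longrightarrow> g w = g u)"
      if u: "u < n" "w \<in> set (adj ! u)" for u w
    proof -
      have w: "w < n" using u nbr_less by blast
      obtain i where i: "\<phi> w = sym_diff (\<phi> u) {i}" using u nbrs by auto
      have f: "finite (\<phi> u - dirs v)" using fin u by blast
      have "lev w \<le> card (insert i (\<phi> u - dirs v))"
        unfolding lev_def i using f by (intro card_mono) auto
      then have 1: "lev w \<le> Suc (lev u)"
        using f unfolding lev_def by (simp add: card_insert_if split: if_splits)
      have "g w = g u" if l: "lev w = Suc (lev u)"
      proof -
        have "i \<notin> dirs v"
        proof
          assume "i \<in> dirs v"
          then have "\<phi> w - dirs v = \<phi> u - dirs v" using i by blast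
          then show False using l by (simp add: lev_def)
        qed
        then show ?thesis using i u w by (intro eqg) auto
      qed
      then show ?thesis using 1 by blast
    qed
    have pred: "\<exists>u<n. w \<in> set (adj ! u) \<and> lev w = Suc (lev u)" if w: "w < n" "0 < lev w" for w
    proof -
      obtain i where i: "i \<in> \<phi> w" "i \<notin> dirs v"
        using w(2) unfolding lev_def by (metis DiffE card_gt_0_iff ex_in_conv)
      obtain u where u: "u < n" "\<phi> u = \<phi> w - {i}" using down[OF w(1), of "\<phi> w - {i}"] by auto
      have "\<phi> w = sym_diff (\<phi> u) {i}" using u i by blast
      then have "w \<in> set (adj ! u)" using w(1) nbrs[OF u(1)] by blast
      moreover have "\<phi> w - dirs v = insert i (\<phi> u - dirs v)" using u i by blast
      then have "lev w = Suc (lev u)" using u i fin[OF u(1)] by (simp add: lev_def)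
      ultimately show ?thesis using u(1) by blast
    qed
    have zero: "w \<in> dspan v \<longleftrightarrow> lev w = 0" if "w < n" for w
      using that fin[OF that] by (auto simp: dspan lev_def)
    have "g w = w" if "w \<in> dspan v" for w
      using that g[of w] by (intro inj') (auto simp: dspan)
    then have "\<forall>w\<in>dspan v. lev w = 0 \<and> g w = w"
      using zero by (auto simp: dspan)
    moreover have "\<forall>w<n. g w \<in> dspan v \<and> (lev w = 0 \<longrightarrow> w \<in> dspan v)"
      using gs zero by simp
    moreover have "\<forall>u<n. \<forall>w\<in>set (adj ! u). lev w \<le> Suc (lev u) \<and> (lev w = Suc (lev u) \<longrightarrow> g w = g u)"
      by (intro allI ballI impI edge)
    moreover have "\<forall>w<n. 0 < lev w \<longrightarrow> (\<exists>u<n. w \<in> set (adj ! u) \<and> lev w = Suc (lev u))"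
      by (intro allI impI pred)
    moreover have "dspan v \<subseteq> {..<n}" by (auto simp: dspan)
    ultimately have "gating adj (dspan v) g lev"
      unfolding gating_def by (intro conjI) assumption+
    \<comment> \<open>Coordinates stand for elements of \<open>dirs v\<close>, where
      \<open>w\<close> and its gate agree.\<close>
    moreover have "lab v (g w) = lab v w" if "w < n" for w
      using ran g[OF that] unfolding lab_def by blast
    ultimately show ?thesis by blast
  qed
qed

text \<open>Removing a coordinate maps its far side injectively to its near side, and the map is
  onto iff the coordinate belongs to all maximal words.\<close>

lemma card_contains:
  "2 * card {w. w < n \<and> i \<in> \<phi> w} \<le> n"
  "2 * card {w. w < n \<and> i \<in> \<phi> w} \<ge> n \<Longrightarrow> common i"
proof -
  let ?A = "{w. w < n \<and> i \<in> \<phi> w}" and ?B = "{w. w < n \<and> i \<notin> \<phi> w}"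
  have "\<forall>w. \<exists>u. w < n \<longrightarrow> u < n \<and> \<phi> u = \<phi> w - {i}"
    using down by (metis Diff_subset)
  then obtain f where f: "\<And>w. w < n \<Longrightarrow> f w < n \<and> \<phi> (f w) = \<phi> w - {i}" by metis
  have inj: "inj_on f ?A"
    by (intro inj_onI inj') (metis f insert_Diff mem_Collect_eq)+
  have sub: "f ` ?A \<subseteq> ?B" using f by auto
  have "card ?A \<le> card ?B"
    using card_inj_on_le[OF inj sub] by simp
  moreover have "card ?A + card ?B = n"
    by (subst card_Un_disjoint[symmetric]) (auto intro!: arg_cong[of _ "{..<n}" card, simplified])
  ultimately show "2 * card ?A \<le> n" by simp
  assume "2 * card ?A \<ge> n"
  then have "card ?B \<le> card (f ` ?A)"
    using \<open>card ?A + card ?B = n\<close> card_image[OF inj] by simp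
  then have eq: "f ` ?A = ?B" using sub by (intro card_seteq) auto
  show "common i"
    unfolding common_def
  proof (intro allI impI)
    fix w assume w: "w < n"
    show "\<exists>u<n. \<phi> u = insert i (\<phi> w)"
    proof (cases "i \<in> \<phi> w")
      case True
      then show ?thesis using w by (auto simp: insert_absorb)
    next
      case False
      then obtain u where "u < n" "i \<in> \<phi> u" "w = f u" using w eq by blast
      then show ?thesis using f by (metis insert_Diff)
    qed
  qed
qed

text \<open>The label of \<open>r\<close> expresses the majority as seen from \<open>v\<close>, with
  ties going to the side of \<open>v\<close>. If \<open>i \<in> \<phi> v\<close>, at least half of
  the vertices contain \<open>i\<close> and \<open>card_contains\<close> gives the claim; otherwise
  more than half would contain \<open>i\<close>, which is impossible.\<close>

lemma median:
  assumes v: "v < n" and min: "\<And>u. u < n \<Longrightarrow> deg v \<le> deg u"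
    and r: "r \<in> dspan v" "lab v r = {k. k < deg v \<and> n < 2 * card {w. w < n \<and> k \<in> lab v w}}"
    and i: "i \<in> \<phi> r"
  shows "common i"
proof -
  obtain x where x: "x < n" "\<phi> x = dirs v" "\<phi> v \<subseteq> dirs v"
    using min_degree[OF assms(1,2)] by blast
  have "i \<in> dirs v" using i r x by (auto simp: dspan_def)
  then obtain k where k: "k < deg v" "i = dir v k"
    using bij_dir[OF v] by (auto simp: bij_betw_def)
  have mem: "k \<in> lab v w \<longleftrightarrow> i \<in> sym_diff (\<phi> w) (\<phi> v)" for w
    using k by (simp add: lab_def)
  show ?thesis
  proof (cases "i \<in> \<phi> v")
    case True
    then have "k \<notin> lab v r" using mem i by blast
    then have "2 * card {w. w < n \<and> i \<notin> \<phi> w} \<le> n"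
      using r k mem True by (simp add: not_less)
    moreover have "card {w. w < n \<and> i \<in> \<phi> w} + card {w. w < n \<and> i \<notin> \<phi> w} = n"
      by (subst card_Un_disjoint[symmetric]) (auto intro!: arg_cong[of _ "{..<n}" card, simplified])
    ultimately show ?thesis by (intro card_contains(2)) simp
  next
    case False
    then have "k \<in> lab v r" using mem i by blast
    then have "n < 2 * card {w. w < n \<and> i \<in> \<phi> w}"
      using r k mem False by simp
    then show ?thesis using card_contains(1)[of i] by simp
  qed
qed

text \<open>Elements of \<open>\<phi> r\<close> can be added to every set. Hence
  \<open>{i} \<union> \<phi> r\<close> is present for each element \<open>i\<close> that occurs at
  all, so every such \<open>i\<close> is a direction at \<open>r\<close> and \<open>dspan r\<close>
  is the whole graph.\<close>

lemma labelling_common: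
  assumes r: "r < n" and common: "\<And>i. i \<in> \<phi> r \<Longrightarrow> common i"
  shows "labelling adj r {..<n} (lab r)"
proof -
  have ins: "\<exists>u<n. \<phi> u = A \<union> B" if "B \<subseteq> \<phi> r" "w < n" "\<phi> w = A" for A B w
  proof -
    have "finite B" using that fin r finite_subset by blast
    then show ?thesis using that(1)
    proof (induction B)
      case empty
      then show ?case using that by auto
    next
      case (insert b B)
      then obtain u where "u < n" and u: "\<phi> u = A \<union> B" by auto
      moreover have "common b" using common insert.prems by simp
      ultimately have "\<exists>u'<n. \<phi> u' = insert b (\<phi> u)" unfolding common_def by blast
      then show ?case by (simp add: u)
    qed
  qed
  have dirs: "i \<in> dirs r" if "w < n" "i \<in> \<phi> w" for i w
  proof (cases "i \<in> \<phi> r")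
    case True
    then have "sym_diff (\<phi> r) {i} \<subseteq> \<phi> r" by blast
    then show ?thesis using down[OF r] by (auto simp: dirs_def)
  next
    case False
    obtain u where "u < n" "\<phi> u = {i}" using down[OF \<open>w < n\<close>, of "{i}"] \<open>i \<in> \<phi> w\<close> by auto
    then obtain u' where "u' < n" "\<phi> u' = {i} \<union> \<phi> r" using ins[of "\<phi> r"] by blast
    moreover have "{i} \<union> \<phi> r = sym_diff (\<phi> r) {i}" using False by blast
    ultimately show ?thesis by (auto simp: dirs_def)
  qed
  have dspan: "dspan r = {..<n}"
    using dirs r by (auto simp: dspan_def)
  have "labelling adj r (dspan r) (lab r)"
  proof (rule labelling_dspan[OF r])
    fix w i assume w: "w \<in> dspan r" "i \<in> sym_diff (\<phi> w) (\<phi> r)"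
    then have wn: "w < n" by (simp add: dspan_def)
    show "\<exists>u<n. \<phi> u = sym_diff (\<phi> w) {i}"
    proof (cases "i \<in> \<phi> w")
      case True
      then have "sym_diff (\<phi> w) {i} \<subseteq> \<phi> w" by blast
      then show ?thesis using down[OF wn] by blast
    next
      case False
      then have "sym_diff (\<phi> w) {i} = insert i (\<phi> w)" by blast
      then show ?thesis using common[of i] w False wn unfolding common_def by auto
    qed
  qed
  then show ?thesis by (simp add: dspan)
qed

end

section \<open>Loops\<close>

abbreviation seq_com (infixr ";;" 60) where "c1 ;; c2 \<equiv> Seq c1 c2"

text \<open>In the loops below, register 1 holds 1 and register 2 holds 0.\<close>

definition for_range :: "nat \<Rightarrow> nat \<Rightarrow> com \<Rightarrow> com" where
  "for_range x y c = WhileLess x y (c ;; Add x x 1)"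

text \<open>\<open>J\<close> owns the credits for the bodies, which permits amortised bodies, and
  \<open>e\<close> is reserved for what follows the loop. The loop itself spends two credits per
  round (test, increment) and one on the final test. \<open>stable\<close> lets \<open>J\<close>
  survive the increment of the counter.\<close>

lemma wp_for_range:
  assumes init: "regs s x = k0" "k0 \<le> N" "regs s y = N" "regs s 1 = 1" "N \<le> W"
    and fresh: "x \<notin> wregs c" "y \<notin> wregs c" "1 \<notin> wregs c" "x \<noteq> y" "x \<noteq> 1"
    and J0: "J k0 s T0" and T: "T0 + e + 2 * (N - k0) + 1 \<le> T"
    and stable: "\<And>k m s' T'. J k s' T' \<Longrightarrow> J k (set_reg x m s') T'"
    and body: "\<And>k s' T'. agree (for_range x y c) s s' \<Longrightarrow> k0 \<le> k \<Longrightarrow> k < N \<Longrightarrow> regs s' x = k \<Longrightarrow>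
      J k s' T' \<Longrightarrow> wp W c (J (Suc k)) s' T'"
    and exit: "\<And>s' T' T''. agree (for_range x y c) s s' \<Longrightarrow> J N s' T' \<Longrightarrow> T' + e \<le> T'' \<Longrightarrow> Q s' T''"
  shows "wp W (for_range x y c) Q s T"
  unfolding for_range_def
proof (rule wp_WhileLess[where I = "\<lambda>s' T''. \<exists>k T'. k0 \<le> k \<and> k \<le> N \<and> regs s' x = k \<and> J k s' T' \<and>
    T' + e + 2 * (N - k) + 1 \<le> T''"])
  show "\<exists>k T'. k0 \<le> k \<and> k \<le> N \<and> regs s x = k \<and> J k s T' \<and> T' + e + 2 * (N - k) + 1 \<le> T"
    using init J0 T by auto
next
  fix s' T'' assume *: "agree (c ;; Add x x 1) s s'" and "regs s' x < regs s' y"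
    and "\<exists>k T'. k0 \<le> k \<and> k \<le> N \<and> regs s' x = k \<and> J k s' T' \<and> T' + e + 2 * (N - k) + 1 \<le> T''"
  then obtain k T' where k: "k0 \<le> k" "regs s' x = k" "J k s' T'" "T' + e + 2 * (N - k) + 1 \<le> T''"
      "k < N"
    using fresh init agreeD(1)[OF *, of y] by auto
  have agr: "agree (for_range x y c) s s'" using * by (simp add: agree_def for_range_def)
  have one: "regs s' 1 = 1" using agreeD(1)[OF *, of 1] fresh init by simp
  have "wp W c (\<lambda>s1 T1. \<exists>T2. J (Suc k) s1 T2 \<and> T2 + (T'' - 1 - T') \<le> T1) s' (T'' - 1)"
    using k by (intro wp_ge body[OF agr]) auto
  then have "wp W (c ;; Add x x 1) (\<lambda>s' T''. \<exists>k T'. k0 \<le> k \<and> k \<le> N \<and> regs s' x = k \<and> J k s' T' \<and>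
    T' + e + 2 * (N - k) + 1 \<le> T'') s' (T'' - 1)"
    unfolding wp_Seq
  proof (rule wp_mono)
    fix s1 T1 assume c: "agree c s' s1" and "\<exists>T2. J (Suc k) s1 T2 \<and> T2 + (T'' - 1 - T') \<le> T1"
    then obtain T2 where T2: "J (Suc k) s1 T2" "T2 + (T'' - 1 - T') \<le> T1" by blast
    have "regs s1 1 = 1" "regs s1 x = k" using agreeD(1)[OF c] fresh k one by auto
    then show "wp W (Add x x 1) (\<lambda>s' T''. \<exists>k T'. k0 \<le> k \<and> k \<le> N \<and> regs s' x = k \<and> J k s' T' \<and>
      T' + e + 2 * (N - k) + 1 \<le> T'') s1 T1"
      using k T2 init stable[OF T2(1)] by (auto intro!: exI[of _ T2])
  qed
  then show "1 \<le> T'' \<and> wp W (c ;; Add x x 1) (\<lambda>s' T''. \<exists>k T'. k0 \<le> k \<and> k \<le> N \<and> regs s' x = k \<and> J k s' T' \<and>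
    T' + e + 2 * (N - k) + 1 \<le> T'') s' (T'' - 1)"
    using k by simp
next
  fix s' T'' assume *: "agree (c ;; Add x x 1) s s'" and "\<not> regs s' x < regs s' y"
    and "\<exists>k T'. k0 \<le> k \<and> k \<le> N \<and> regs s' x = k \<and> J k s' T' \<and> T' + e + 2 * (N - k) + 1 \<le> T''"
  then obtain k T' where k: "J k s' T'" "T' + e + 2 * (N - k) + 1 \<le> T''" "k = N"
    using fresh init agreeD(1)[OF *, of y] by auto
  have agr: "agree (for_range x y c) s s'" using * by (simp add: agree_def for_range_def)
  show "1 \<le> T'' \<and> Q s' (T'' - 1)"
    using k exit[OF agr, of T' "T'' - 1"] by simp
qed

text \<open>A label in its stored form, read from the vertex towards the root. The explicit length,
  which is the stored depth, takes the place of an end marker at the root.\<close>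

primrec chain :: "(nat \<Rightarrow> nat) \<Rightarrow> (nat \<Rightarrow> nat) \<Rightarrow> nat \<Rightarrow> nat \<Rightarrow> nat list" where
  "chain par cls 0 v = []"
| "chain par cls (Suc k) v = cls v # chain par cls k (par v)"

lemma length_chain [simp]: "length (chain par cls k v) = k"
  by (induction k arbitrary: v) auto

definition walk_up :: "com \<Rightarrow> com" where
  "walk_up c = WhileLess 2 12 (Load 13 7 11 ;; c ;; Load 11 6 11 ;; Sub 12 12 1)"

text \<open>\<open>J\<close> is indexed by the part of the chain already read. The four credits per
  step are the test, two loads and the decrement.\<close>

lemma wp_walk_up:
  assumes init: "regs s 11 = v" "regs s 12 = k" "arrs s 6 = par" "arrs s 7 = cls"
      "regs s 1 = 1" "regs s 2 = 0"
    and fresh: "1 \<notin> wregs c" "2 \<notin> wregs c" "11 \<notin> wregs c" "12 \<notin> wregs c"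
      "6 \<notin> warrs c" "7 \<notin> warrs c"
    and J0: "J [] s T0" and T: "T0 + e + 4 * k + 1 \<le> T"
    and stable: "\<And>xs x m s' T'. x \<in> {11, 12, 13} \<Longrightarrow> J xs s' T' \<Longrightarrow> J xs (set_reg x m s') T'"
    and body: "\<And>xs i ys s' T'. agree (walk_up c) s s' \<Longrightarrow> chain par cls k v = xs @ i # ys \<Longrightarrow>
      regs s' 13 = i \<Longrightarrow> J xs s' T' \<Longrightarrow> wp W c (J (xs @ [i])) s' T'"
    and exit: "\<And>s' T' T''. agree (walk_up c) s s' \<Longrightarrow> J (chain par cls k v) s' T' \<Longrightarrow> T' + e \<le> T'' \<Longrightarrow> Q s' T''"
  shows "wp W (walk_up c) Q s T"
proof -
  let ?b = "Load 13 7 11 ;; c ;; Load 11 6 11 ;; Sub 12 12 1"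
  define I where "I s' T'' \<longleftrightarrow> (\<exists>xs k' v' T'. chain par cls k v = xs @ chain par cls k' v' \<and>
    regs s' 11 = v' \<and> regs s' 12 = k' \<and> J xs s' T' \<and> T' + e + 4 * k' + 1 \<le> T'')" for s' T''
  have keep: "regs s' 1 = 1" "regs s' 2 = 0" "arrs s' 6 = par" "arrs s' 7 = cls"
    "agree (walk_up c) s s'" if "agree ?b s s'" for s'
    using that fresh init by (auto simp: agree_def walk_up_def)
  show ?thesis
    unfolding walk_up_def
  proof (rule wp_WhileLess[where I = I])
    show "I s T" unfolding I_def using init J0 T by (intro exI[of _ "[]"]) auto
  next
    fix s' T'' assume agr: "agree ?b s s'" and I: "I s' T''" and less: "regs s' 2 < regs s' 12"
    note keep = keep[OF agr]
    obtain xs k' v' T' where J: "chain par cls k v = xs @ chain par cls k' v'"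
        "regs s' 11 = v'" "regs s' 12 = k'" "J xs s' T'" "T' + e + 4 * k' + 1 \<le> T''"
      using I unfolding I_def by blast
    then obtain k'' where k'': "k' = Suc k''" using less keep by (cases k') auto
    let ?s = "set_reg 13 (cls v') s'"
    have "agree ?b s ?s" using agr by (auto simp: agree_def)
    then have "wp W c (J (xs @ [cls v'])) ?s T'"
      using J k'' by (intro body[where ys = "chain par cls k'' (par v')"] stable)
        (auto simp: agree_def walk_up_def)
    then have "wp W c (\<lambda>s1 T1. \<exists>T2. J (xs @ [cls v']) s1 T2 \<and> T2 + (T'' - 2 - T') \<le> T1) ?s (T'' - 2)"
      using J k'' by (intro wp_ge) auto
    then have "wp W c (wp W (Load 11 6 11 ;; Sub 12 12 1) I) ?s (T'' - 2)"
    proof (rule wp_mono)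
      fix s1 T1 assume c: "agree c ?s s1" and "\<exists>T2. J (xs @ [cls v']) s1 T2 \<and> T2 + (T'' - 2 - T') \<le> T1"
      then obtain T2 where T2: "J (xs @ [cls v']) s1 T2" "T2 + (T'' - 2 - T') \<le> T1" by blast
      have k1: "regs s1 1 = 1" "regs s1 11 = v'" "regs s1 12 = k'" "arrs s1 6 = par"
        using c fresh keep J by (auto simp: agree_def)
      have "J (xs @ [cls v']) (set_reg 12 k'' (set_reg 11 (par v') s1)) T2"
        using T2 by (intro stable) auto
      then show "wp W (Load 11 6 11 ;; Sub 12 12 1) I s1 T1"
        using k1 J T2 k'' by (auto simp: I_def intro!: exI[of _ "xs @ [cls v']"] exI[of _ T2])
    qed
    then show "1 \<le> T'' \<and> wp W ?b I s' (T'' - 1)"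
      using J k'' keep by (simp add: numeral_2_eq_2)
  next
    fix s' T'' assume agr: "agree ?b s s'" and I: "I s' T''" and "\<not> regs s' 2 < regs s' 12"
    note keep = keep[OF agr]
    obtain xs T' where J: "chain par cls k v = xs" "J xs s' T'" "T' + e + 1 \<le> T''"
      using I \<open>\<not> regs s' 2 < regs s' 12\<close> keep unfolding I_def by auto
    show "1 \<le> T'' \<and> Q s' (T'' - 1)"
      using J exit[OF keep(5), of T' "T'' - 1"] by simp
  qed
qed

definition for_nbrs :: "com \<Rightarrow> com" where
  "for_nbrs c = Load 7 0 6 ;; Add 8 6 1 ;; Load 8 0 8 ;; WhileLess 7 8 (Load 9 1 7 ;; c ;; Add 7 7 1)"

definition inp :: "nat list list \<Rightarrow> state \<Rightarrow> bool" where
  "inp adj s \<longleftrightarrow> stores_lists (arrs s 0) (arrs s 1) adj \<and>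
     regs s 0 = length adj \<and> regs s 1 = 1 \<and> regs s 2 = 0"

lemma concat_nth_segment:
  assumes "u < length xss" "k < length (xss ! u)"
  shows "concat xss ! (length (concat (take u xss)) + k) = xss ! u ! k"
    and "length (concat (take u xss)) + k < length (concat xss)"
    and "length (concat (take (Suc u) xss)) = length (concat (take u xss)) + length (xss ! u)"
proof -
  have "xss = take u xss @ xss ! u # drop (Suc u) xss"
    using assms(1) by (rule id_take_nth_drop)
  then have *: "concat xss = concat (take u xss) @ xss ! u @ concat (drop (Suc u) xss)"
    by (metis concat.simps(2) concat_append)
  show "concat xss ! (length (concat (take u xss)) + k) = xss ! u ! k"
    unfolding * using assms(2) by (simp add: nth_append)
  show "length (concat (take u xss)) + k < length (concat xss)"
    unfolding * using assms(2) by simp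
  show "length (concat (take (Suc u) xss)) = length (concat (take u xss)) + length (xss ! u)"
    using assms(1) by (simp add: take_Suc_conv_app_nth)
qed

lemma inp_off:
  assumes "inp adj s" "u < length adj"
  shows "arrs s 0 (Suc u) = arrs s 0 u + length (adj ! u)"
    and "k < length (adj ! u) \<Longrightarrow> arrs s 1 (arrs s 0 u + k) = adj ! u ! k"
    and "arrs s 0 (Suc u) \<le> length (concat adj)"
proof -
  have off: "\<And>i. i \<le> length adj \<Longrightarrow> arrs s 0 i = length (concat (take i adj))"
    and dat: "\<And>j. j < length (concat adj) \<Longrightarrow> arrs s 1 j = concat adj ! j"
    using assms by (auto simp: inp_def stores_lists_def)
  show "arrs s 0 (Suc u) = arrs s 0 u + length (adj ! u)"
    using off[of u] off[of "Suc u"] assms by (simp add: take_Suc_conv_app_nth)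
  show "arrs s 1 (arrs s 0 u + k) = adj ! u ! k" if "k < length (adj ! u)"
    using off[of u] concat_nth_segment[OF assms(2) that] assms dat by simp
  have "concat adj = concat (take (Suc u) adj) @ concat (drop (Suc u) adj)"
    by (metis append_take_drop_id concat_append)
  then show "arrs s 0 (Suc u) \<le> length (concat adj)"
    using off[of "Suc u"] assms(2) by simp
qed

text \<open>Three credits per neighbour (test, load, increment); the other four pay for fetching the
  segment bounds and for the final test.\<close>

lemma wp_for_nbrs:
  assumes inp: "inp adj s" and u: "regs s 6 = u" "u < length adj"
    and W: "length adj \<le> W" "length (concat adj) \<le> W"
    and fresh: "1 \<notin> wregs c" "7 \<notin> wregs c" "8 \<notin> wregs c" "0 \<notin> warrs c" "1 \<notin> warrs c"
    and J0: "J [] s T0" and T: "T0 + e + 3 * length (adj ! u) + 4 \<le> T"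
    and stable: "\<And>xs x m s' T'. x \<in> {7, 8, 9} \<Longrightarrow> J xs s' T' \<Longrightarrow> J xs (set_reg x m s') T'"
    and body: "\<And>xs w ys s' T'. agree (for_nbrs c) s s' \<Longrightarrow> adj ! u = xs @ w # ys \<Longrightarrow>
      regs s' 9 = w \<Longrightarrow> J xs s' T' \<Longrightarrow> wp W c (J (xs @ [w])) s' T'"
    and exit: "\<And>s' T' T''. agree (for_nbrs c) s s' \<Longrightarrow> J (adj ! u) s' T' \<Longrightarrow> T' + e \<le> T'' \<Longrightarrow> Q s' T''"
  shows "wp W (for_nbrs c) Q s T"
proof -
  let ?b = "Load 9 1 7 ;; c ;; Add 7 7 1"
  let ?o = "arrs s 0 u" and ?d = "length (adj ! u)"
  define I where "I s' T'' \<longleftrightarrow> (\<exists>k T'. k \<le> ?d \<and> regs s' 7 = ?o + k \<and>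
    J (take k (adj ! u)) s' T' \<and> T' + e + 3 * (?d - k) + 1 \<le> T'')" for s' T''
  let ?s0 = "set_reg 8 (?o + ?d) (set_reg 8 (Suc u) (set_reg 7 ?o s))"
  have one: "regs s 1 = 1" using inp by (simp add: inp_def)
  have keep: "regs s' 1 = 1" "regs s' 8 = ?o + ?d" "arrs s' 1 = arrs s 1" 
    "agree (for_nbrs c) s s'" if "agree ?b ?s0 s'" for s'
    using that fresh one by (auto simp: agree_def for_nbrs_def)
  obtain T3 where T3: "T = Suc (Suc (Suc T3))"
    using T by (intro that[of "T - 3"]) simp
  have "wp W (WhileLess 7 8 ?b) Q ?s0 T3"
  proof (rule wp_WhileLess[where I = I])
    have "J [] ?s0 T0" using J0 by (intro stable) auto
    then show "I ?s0 T3" unfolding I_def using T T3 by (intro exI[of _ 0] exI[of _ T0]) auto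
  next
    fix s' T'' assume agr: "agree ?b ?s0 s'" and I: "I s' T''" and less: "regs s' 7 < regs s' 8"
    note keep = keep[OF agr]
    obtain k T' where J: "k < ?d" "regs s' 7 = ?o + k" "J (take k (adj ! u)) s' T'"
        "T' + e + 3 * (?d - k) + 1 \<le> T''"
      using I less keep unfolding I_def by auto
    let ?s = "set_reg 9 (adj ! u ! k) s'"
    have "wp W c (J (take k (adj ! u) @ [adj ! u ! k])) ?s T'"
      using J keep(4) by (intro body[where ys = "drop (Suc k) (adj ! u)"] stable id_take_nth_drop)
        (auto simp: agree_def for_nbrs_def)
    then have "wp W c (\<lambda>s1 T1. \<exists>T2. J (take (Suc k) (adj ! u)) s1 T2 \<and> T2 + (T'' - 2 - T') \<le> T1) ?s (T'' - 2)"
      using J by (intro wp_ge) (auto simp: take_Suc_conv_app_nth)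
    then have "wp W c (wp W (Add 7 7 1) I) ?s (T'' - 2)"
    proof (rule wp_mono)
      fix s1 T1 assume c: "agree c ?s s1"
        and "\<exists>T2. J (take (Suc k) (adj ! u)) s1 T2 \<and> T2 + (T'' - 2 - T') \<le> T1"
      then obtain T2 where T2: "J (take (Suc k) (adj ! u)) s1 T2" "T2 + (T'' - 2 - T') \<le> T1" by blast
      have k1: "regs s1 1 = 1" "regs s1 7 = ?o + k"
        using c fresh keep J by (auto simp: agree_def)
      have "Suc (?o + k) \<le> W" using inp_off[OF inp u(2)] W J by simp
      moreover have "J (take (Suc k) (adj ! u)) (set_reg 7 (Suc (?o + k)) s1) T2"
        using T2 by (intro stable) auto
      ultimately show "wp W (Add 7 7 1) I s1 T1"
        using k1 J T2 by (auto simp: I_def intro!: exI[of _ "Suc k"] exI[of _ T2])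
    qed
    then show "1 \<le> T'' \<and> wp W ?b I s' (T'' - 1)"
      using J keep inp_off[OF inp u(2)] by (simp add: numeral_2_eq_2)
  next
    fix s' T'' assume agr: "agree ?b ?s0 s'" and I: "I s' T''" and "\<not> regs s' 7 < regs s' 8"
    note keep = keep[OF agr]
    obtain T' where J: "J (adj ! u) s' T'" "T' + e + 1 \<le> T''"
      using I \<open>\<not> regs s' 7 < regs s' 8\<close> keep unfolding I_def by auto
    show "1 \<le> T'' \<and> Q s' (T'' - 1)"
      using J exit[OF keep(4), of T' "T'' - 1"] by simp
  qed
  then show ?thesis
    unfolding for_nbrs_def using T3 u W one inp_off(1,3)[OF inp u(2)] by simp
qed

section \<open>Growing a cube from its root\<close>

text \<open>A vertex stores one coordinate only, yet its label can be enumerated in time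
  proportional to its size. The root is recognised by its empty label and needs no parent.\<close>

definition tree :: "(nat \<Rightarrow> nat set) \<Rightarrow> nat set \<Rightarrow> (nat \<Rightarrow> nat) \<Rightarrow> (nat \<Rightarrow> nat) \<Rightarrow> (nat \<Rightarrow> nat) \<Rightarrow> bool" where
  "tree L A par cls dep \<longleftrightarrow> (\<forall>w\<in>A. finite (L w) \<and> dep w = card (L w) \<and>
     (L w \<noteq> {} \<longrightarrow> par w \<in> A \<and> cls w \<notin> L (par w) \<and> L w = insert (cls w) (L (par w))))"

lemma tree_chain:
  assumes "tree L A par cls dep" "w \<in> A"
  shows "distinct (chain par cls (dep w) w) \<and> set (chain par cls (dep w) w) = L w"
  using assms(2)
proof (induction "dep w" arbitrary: w)
  case 0
  then have "L w = {}" using assms(1) by (simp add: tree_def)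
  then show ?case using 0 by simp
next
  case (Suc d)
  then have L: "finite (L w)" "card (L w) = Suc d" using assms(1) by (auto simp: tree_def)
  then have "L w \<noteq> {}" by auto
  then have p: "par w \<in> A" "cls w \<notin> L (par w)" "L w = insert (cls w) (L (par w))"
    using Suc.prems assms(1) unfolding tree_def by blast+
  then have "d = dep (par w)"
    using L assms(1) unfolding tree_def by (metis card_insert_disjoint finite_insert nat.inject)
  with Suc.hyps(1)[OF this p(1)] Suc.hyps(2) p show ?case by (simp flip: Suc.hyps(2))
qed

text \<open>
  Registers: 0 number of vertices, 3 root, 4 queue length, 5 loop counter or queue head, 6 current
  vertex, 9 neighbour, 11 and 12 position in a chain and its remaining length, 13 coordinate,
  18 size of the cube.
  Arrays: 4 queue, 5 state of a vertex (0 unseen, 1 seen once, 2 queued), 6 parent or first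
  neighbour seen, 7 coordinate of the edge to the parent, 8 depth, 9 marks (queue index of the
  last scanned vertex whose label has the coordinate), 10 gate plus 1 (0 if not reached), 11 number
  of vertices with a given gate (indexed by gate plus 1), 12 number of vertices on the far side
  of a coordinate.
\<close>

definition discover :: com where
  "discover =
     Add 10 1 1 ;; Store 5 9 10 ;; Load 11 6 9 ;; Load 12 8 11 ;;
     walk_up (Load 14 9 13 ;; IfLess 14 5 (Copy 16 13) Skip) ;;
     Store 7 9 16 ;; Store 6 9 6 ;; Load 14 8 6 ;; Add 14 14 1 ;; Store 8 9 14 ;;
     Store 4 4 9 ;; Add 4 4 1"

definition visit :: com where
  "visit = Load 10 5 9 ;;
     IfLess 2 10 (IfLess 1 10 Skip discover) (Store 5 9 1 ;; Store 6 9 6)"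

text \<open>The neighbours of the root have only the root below them, so the rule of two scanned
  neighbours cannot start with them. They are labelled directly; the coordinate is the queue length
  minus one, because the root already occupies a cell.\<close>

definition first_level :: com where
  "first_level =
     Copy 6 3 ;; Store 4 2 3 ;; Add 10 1 1 ;; Store 5 3 10 ;; Store 8 3 2 ;; Copy 4 1 ;;
     for_nbrs (Store 4 4 9 ;; Store 5 9 10 ;; Store 8 9 1 ;; Store 6 9 3 ;;
       Sub 13 4 1 ;; Store 7 9 13 ;; Add 4 4 1)"

text \<open>Arrays 5 and 9 are cleared because this program runs twice. Scanning starts at queue
  index 1: the root is done, and the mark 0 is older than every scanned index.\<close>

definition label_com :: com where
  "label_com =
     Const 5 0 ;; for_range 5 0 (Store 5 5 2 ;; Store 9 5 2) ;;
     first_level ;;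
     Copy 5 1 ;;
     WhileLess 5 4 (
       Load 6 4 5 ;; Copy 11 6 ;; Load 12 8 6 ;; walk_up (Store 9 13 5) ;;
       for_nbrs visit ;; Add 5 5 1)"

text \<open>The doubled counts in \<open>choose_com\<close> reach up to
  \<open>2 * length adj\<close>; offsets into the adjacency lists are covered by the second bound on
  \<open>W\<close>.\<close>

locale adj_graph =
  fixes adj :: "nat list list" and W :: nat
  assumes distinct_adj: "u < length adj \<Longrightarrow> distinct (adj ! u)"
    and nbr_less: "u < length adj \<Longrightarrow> w \<in> set (adj ! u) \<Longrightarrow> w < length adj"
    and nbr_sym: "u < length adj \<Longrightarrow> w \<in> set (adj ! u) \<Longrightarrow> u \<in> set (adj ! w)"
    and W: "2 * length adj + 2 \<le> W" "length (concat adj) \<le> W"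
begin

abbreviation "n \<equiv> length adj"
abbreviation "deg u \<equiv> length (adj ! u)"

lemma deg_le: "u < n \<Longrightarrow> deg u \<le> n"
  using distinct_card[OF distinct_adj, of u] card_mono[of "{..<n}" "set (adj ! u)"] nbr_less
  by fastforce

end

locale label = adj_graph +
  fixes \<rho> :: nat and S :: "nat set" and L :: "nat \<Rightarrow> nat set"
  assumes lab: "labelling adj \<rho> S L"
begin

lemma root: "\<rho> \<in> S" "L \<rho> = {}" "\<rho> < n"
  and S_less: "w \<in> S \<Longrightarrow> w < n"
  and root_nbrs: "set (adj ! \<rho>) \<subseteq> S" "k < deg \<rho> \<Longrightarrow> L (adj ! \<rho> ! k) = {k}"
  and L_inj: "u \<in> S \<Longrightarrow> w \<in> S \<Longrightarrow> L u = L w \<Longrightarrow> u = w"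
  and L_sub: "w \<in> S \<Longrightarrow> L w \<subseteq> {..<deg \<rho>}"
  and L_edge: "u \<in> S \<Longrightarrow> w \<in> S \<Longrightarrow> w \<in> set (adj ! u) \<longleftrightarrow> (\<exists>i. L w = sym_diff (L u) {i})"
  and L_pred: "u \<in> S \<Longrightarrow> i \<in> L u \<Longrightarrow> \<exists>w\<in>S. L w = L u - {i}"
  and S_closed: "w < n \<Longrightarrow> u1 \<in> S \<Longrightarrow> u2 \<in> S \<Longrightarrow> w \<in> set (adj ! u1) \<Longrightarrow> w \<in> set (adj ! u2) \<Longrightarrow>
    u1 \<noteq> u2 \<Longrightarrow> w \<in> S"
  using lab unfolding labelling_def by (auto dest: inj_onD)

lemma L_fin: "w \<in> S \<Longrightarrow> finite (L w)"
  using L_sub finite_subset by blast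

text \<open>Deleting different elements of the label leads to different neighbours. This is what
  makes the time linear: handling the label of \<open>w\<close> is charged to the edges at
  \<open>w\<close>.\<close>

lemma L_deg:
  assumes "w \<in> S"
  shows "card (L w) \<le> deg w"
proof -
  obtain f where f: "\<And>i. i \<in> L w \<Longrightarrow> f i \<in> S \<and> L (f i) = L w - {i}"
    using L_pred[OF assms] by metis
  have "inj_on f (L w)"
    by (intro inj_onI) (metis Diff_iff f insertCI insertE empty_iff)
  moreover have "f ` L w \<subseteq> set (adj ! w)"
  proof clarify
    fix i assume "i \<in> L w"
    then have "L (f i) = sym_diff (L w) {i}" using f by blast
    then show "f i \<in> set (adj ! w)" using L_edge[OF assms] f \<open>i \<in> L w\<close> by blast
  qed
  ultimately have "card (L w) \<le> card (set (adj ! w))"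
    by (intro card_inj_on_le) auto
  also have "\<dots> \<le> deg w" by (rule card_length)
  finally show ?thesis .
qed

lemma L_small: "w \<in> S \<Longrightarrow> card (L w) \<le> 1 \<Longrightarrow> w = \<rho> \<or> w \<in> set (adj ! \<rho>)"
proof -
  assume w: "w \<in> S" "card (L w) \<le> 1"
  show ?thesis
  proof (cases "L w = {}")
    case True
    then show ?thesis using L_inj root w by simp
  next
    case False
    then have "card (L w) = 1" using w L_fin[of w] by (simp add: le_Suc_eq)
    then obtain k where k: "L w = {k}" by (auto simp: card_1_singleton_iff)
    then have "k < deg \<rho>" using L_sub w by auto
    then have "adj ! \<rho> ! k \<in> set (adj ! \<rho>)" by simp
    moreover have "w = adj ! \<rho> ! k"
      using calculation k \<open>k < deg \<rho>\<close> root_nbrs by (intro L_inj w(1)) auto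
    ultimately show ?thesis by simp
  qed
qed

section \<open>The queue of labelled vertices, ordered by label size\<close>

text \<open>A breadth-first invariant in which the level is the label size and \<open>h\<close> is
  the head. Its last clause expresses that a second scanned neighbour puts a vertex into the queue
  at once.\<close>

definition queue :: "nat \<Rightarrow> nat list \<Rightarrow> bool" where
  "queue h Q \<longleftrightarrow> distinct Q \<and> set Q \<subseteq> S \<and> \<rho> \<in> set Q \<and> set (adj ! \<rho>) \<subseteq> set Q \<and>
     sorted (map (\<lambda>v. card (L v)) Q) \<and> h \<le> length Q \<and>
     (h < length Q \<longrightarrow> (\<forall>q\<in>set Q. card (L q) \<le> Suc (card (L (Q ! h))))) \<and>
     (\<forall>w<n. w \<notin> set Q \<longrightarrow> (\<forall>u1\<in>set (take h Q). \<forall>u2\<in>set (take h Q).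
        w \<in> set (adj ! u1) \<and> w \<in> set (adj ! u2) \<longrightarrow> u1 = u2))"

lemma queue_scanned:
  assumes "queue h Q"
  shows "w < n \<Longrightarrow> w \<notin> set Q \<Longrightarrow> u1 \<in> set (take h Q) \<Longrightarrow> u2 \<in> set (take h Q) \<Longrightarrow>
    w \<in> set (adj ! u1) \<Longrightarrow> w \<in> set (adj ! u2) \<Longrightarrow> u1 = u2"
  using assms unfolding queue_def by (elim conjE) simp

text \<open>A label with two elements \<open>i\<close> and \<open>j\<close> has two different
  neighbours below it, obtained by deleting either. By induction both are queued, by hypothesis both
  are scanned, and the last clause of \<open>queue\<close> then forces \<open>w\<close> in. Smaller
  labels belong to the root and its neighbours.\<close>

lemma in_queue:
  assumes "queue h Q" "w \<in> S" "\<And>v. v \<in> set Q \<Longrightarrow> card (L v) < card (L w) \<Longrightarrow> v \<in> set (take h Q)"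
  shows "w \<in> set Q"
  using assms(2,3)
proof (induction "card (L w)" arbitrary: w rule: less_induct)
  case less
  show ?case
  proof (cases "card (L w) \<le> 1")
    case True
    then show ?thesis using L_small less.prems assms(1) unfolding queue_def by blast
  next
    case False
    have "\<exists>i\<in>L w. \<exists>j\<in>L w. i \<noteq> j"
    proof (rule ccontr)
      assume "\<not> ?thesis"
      then have "card (L w) \<le> 1" using L_fin less.prems(1) by (simp add: card_le_Suc0_iff_eq)
      then show False using False by simp
    qed
    then obtain i j where ij: "i \<in> L w" "j \<in> L w" "i \<noteq> j" by blast
    have *: "\<exists>v\<in>set (take h Q). w \<in> set (adj ! v) \<and> L v = L w - {i}" if "i \<in> L w" for i
    proof -
      obtain v where v: "v \<in> S" "L v = L w - {i}" using L_pred less.prems(1) that by blast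
      have lt: "card (L v) < card (L w)"
        using v that L_fin less.prems(1) by (metis card_Diff1_less)
      then have "v \<in> set Q" using less.hyps[OF lt v(1)] less.prems(2) by force
      then have "v \<in> set (take h Q)" using less.prems(2) lt by blast
      moreover have "L w = sym_diff (L v) {i}" using v that by blast
      ultimately show ?thesis using v L_edge[OF v(1) less.prems(1)] by blast
    qed
    obtain v1 v2 where v: "v1 \<in> set (take h Q)" "v2 \<in> set (take h Q)" "w \<in> set (adj ! v1)" "w \<in> set (adj ! v2)"
        "L v1 = L w - {i}" "L v2 = L w - {j}"
      using *[OF ij(1)] *[OF ij(2)] by blast
    then have "v1 \<noteq> v2" using ij by auto
    then show ?thesis
      using queue_scanned[OF assms(1) S_less[OF less.prems(1)] _ v(1-4)] by blast
  qed
qed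

lemma queue_end:
  assumes "queue (length Q) Q"
  shows "set Q = S"
proof
  show "set Q \<subseteq> S" using assms by (simp add: queue_def)
  show "S \<subseteq> set Q" by (intro subsetI in_queue[OF assms]) simp_all
qed

text \<open>By sortedness all smaller levels precede the head, so \<open>in_queue\<close> applies.
  In \<open>second_nbr\<close> this shows that an unqueued vertex of \<open>S\<close> lies strictly
  above the head.\<close>

lemma queue_level:
  assumes Q: "queue h Q" "h < length Q" and w: "w \<in> S" "card (L w) \<le> card (L (Q ! h))"
  shows "w \<in> set Q"
proof (rule in_queue[OF Q(1) w(1)])
  fix v assume v: "v \<in> set Q" "card (L v) < card (L w)"
  then obtain i where i: "i < length Q" "v = Q ! i" by (auto simp: in_set_conv_nth)
  have "i < h"
  proof (rule ccontr)
    assume "\<not> i < h"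
    then have "card (L (Q ! h)) \<le> card (L (Q ! i))"
      using Q i sorted_nth_mono[of "map (\<lambda>v. card (L v)) Q" h i] unfolding queue_def by auto
    then show False using v w i by simp
  qed
  then show "v \<in> set (take h Q)" using i Q(2) by (auto simp: in_set_conv_nth)
qed

text \<open>A vertex outside the queue lies above all its scanned neighbours, so any two of them
  determine its label.\<close>

lemma second_nbr:
  assumes Q: "queue h Q" "h < length Q" and u: "u = Q ! h" and w: "w \<in> set (adj ! u)" "w \<notin> set Q"
    and u1: "u1 \<in> set (take h Q)" "w \<in> set (adj ! u1)"
  obtains c where "w \<in> S" "L u1 - L u = {c}" "c \<notin> L u" "L w = insert c (L u)" "card (L u1) = card (L u)"
proof -
  have uS: "u \<in> S" "u1 \<in> S" "u \<in> set Q" "u1 \<in> set Q"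
    using Q u u1 unfolding queue_def by (auto dest: in_set_takeD nth_mem)
  have "u1 \<noteq> u"
  proof
    assume "u1 = u"
    then have "u \<in> set (take h Q)" using u1 by simp
    then obtain i where "i < h" "Q ! i = u" using Q(2) by (auto simp: in_set_conv_nth)
    then show False using u Q unfolding queue_def by (simp add: nth_eq_iff_index_eq)
  qed
  then have wS: "w \<in> S" using S_closed w u1 uS nbr_less S_less by blast
  have big: "card (L u) < card (L w)"
    using queue_level[OF Q wS] w u by (metis not_le)
  obtain k where "k < h" "Q ! k = u1" using u1(1) Q(2) by (auto simp: in_set_conv_nth)
  then have le: "card (L u1) \<le> card (L u)"
    using Q u sorted_nth_mono[of "map (\<lambda>v. card (L v)) Q" k h] unfolding queue_def by auto
  have up: "\<exists>i. i \<notin> L v \<and> L w = insert i (L v)"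
    if v: "v \<in> S" "w \<in> set (adj ! v)" "card (L v) < card (L w)" for v
  proof -
    obtain i where i: "L w = sym_diff (L v) {i}" using L_edge[OF v(1) wS] v(2) by blast
    have "i \<notin> L v"
    proof
      assume "i \<in> L v"
      then have "L w \<subseteq> L v" using i by blast
      then show False using v L_fin card_mono by (metis not_le)
    qed
    then show ?thesis using i by blast
  qed
  obtain c where c: "c \<notin> L u" "L w = insert c (L u)" using up[OF uS(1) w(1) big] by blast
  obtain d where d: "d \<notin> L u1" "L w = insert d (L u1)"
    using up[OF uS(2) u1(2)] le big by auto
  have "c \<noteq> d" using c d \<open>u1 \<noteq> u\<close> L_inj uS by (metis insert_ident)
  then have "L u1 - L u = {c}" using c d by blast
  moreover have "card (L u1) = card (L u)"
    using c d L_fin uS by (metis card_insert_disjoint nat.inject)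
  ultimately show ?thesis using that wS c by blast
qed

lemma queue_snoc:
  assumes Q: "queue h Q" "h < length Q" and w: "w \<in> S" "w \<notin> set Q" "card (L w) = Suc (card (L (Q ! h)))"
  shows "queue h (Q @ [w])"
  using assms unfolding queue_def by (auto simp: sorted_append nth_append)

lemma queue_Suc:
  assumes Q: "queue h Q" "h < length Q"
    and "\<And>w u1 u2. w < n \<Longrightarrow> w \<notin> set Q \<Longrightarrow> u1 \<in> set (take (Suc h) Q) \<Longrightarrow> u2 \<in> set (take (Suc h) Q) \<Longrightarrow>
      w \<in> set (adj ! u1) \<Longrightarrow> w \<in> set (adj ! u2) \<Longrightarrow> u1 = u2"
  shows "queue (Suc h) Q"
proof -
  have "card (L q) \<le> Suc (card (L (Q ! Suc h)))" if "Suc h < length Q" "q \<in> set Q" for q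
  proof -
    have "card (L (Q ! h)) \<le> card (L (Q ! Suc h))"
      using Q that sorted_nth_mono[of "map (\<lambda>v. card (L v)) Q" h "Suc h"] unfolding queue_def by auto
    then show ?thesis using Q that unfolding queue_def by fastforce
  qed
  then show ?thesis using assms unfolding queue_def by auto
qed

end

text \<open>Keeps the register number 1 in programs from being rewritten to \<open>Suc 0\<close>.\<close>

declare One_nat_def [simp del]

context label
begin

section \<open>Correctness and time of the growing program\<close>

definition stored :: "nat list \<Rightarrow> state \<Rightarrow> bool" where
  "stored Q s \<longleftrightarrow> regs s 4 = length Q \<and> (\<forall>i<length Q. arrs s 4 i = Q ! i) \<and>
     tree L (set Q) (arrs s 6) (arrs s 7) (arrs s 8)"

lemma stored_cong:
  assumes "stored Q s" "regs s' 4 = regs s 4" "arrs s' 4 = arrs s 4"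
    "\<And>w. w \<in> set Q \<Longrightarrow> arrs s' 6 w = arrs s 6 w" "arrs s' 7 = arrs s 7" "arrs s' 8 = arrs s 8"
  shows "stored Q s'"
  using assms unfolding stored_def tree_def by simp

text \<open>With the label of \<open>u\<close> marked by \<open>h\<close>, the chain of the first
  neighbour contains exactly one unmarked coordinate, the one of the edge from \<open>u\<close> to
  \<open>w\<close>. A step of the walk costs 7 credits, and there are fewer than
  \<open>deg w\<close> steps.\<close>

lemma wp_discover:
  assumes Q: "queue h Q" "h < length Q" and u: "u = Q ! h" and w: "w \<in> set (adj ! u)" "w \<notin> set Q"
    and first: "arrs s 6 w \<in> set (take h Q)" "w \<in> set (adj ! arrs s 6 w)"
    and s: "stored Q s" "regs s 1 = 1" "regs s 2 = 0" "regs s 5 = h" "regs s 6 = u" "regs s 9 = w"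
      "regs s 10 = 1"
    and mark: "\<And>i. i < deg \<rho> \<Longrightarrow> arrs s 9 i < h \<longleftrightarrow> i \<notin> L u"
    and T: "7 * deg w + 12 + e \<le> T"
    and exit: "\<And>s' T'. agree discover s s' \<Longrightarrow> queue h (Q @ [w]) \<Longrightarrow> stored (Q @ [w]) s' \<Longrightarrow>
      arrs s' 5 = (arrs s 5)(w := 2) \<Longrightarrow> arrs s' 6 = (arrs s 6)(w := u) \<Longrightarrow> e \<le> T' \<Longrightarrow> P s' T'"
  shows "wp W discover P s T"
proof -
  let ?u1 = "arrs s 6 w" and ?dep = "arrs s 8 (arrs s 6 w)"
  let ?chain = "chain (arrs s 6) (arrs s 7) ?dep ?u1"
  obtain c where c: "w \<in> S" "L ?u1 - L u = {c}" "c \<notin> L u" "L w = insert c (L u)" "card (L ?u1) = card (L u)"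
    using second_nbr[OF Q u w first] by blast
  have QS: "set Q \<subseteq> S" "distinct Q" using Q by (auto simp: queue_def)
  have inQ: "u \<in> set Q" "?u1 \<in> set Q" using u Q first by (auto dest: in_set_takeD)
  have tree: "tree L (set Q) (arrs s 6) (arrs s 7) (arrs s 8)" using s by (simp add: stored_def)
  have ch: "set ?chain = L ?u1" using tree_chain[OF tree inQ(2)] by simp
  have dep: "?dep = card (L ?u1)" "arrs s 8 u = card (L u)" using tree inQ by (auto simp: tree_def)
  have cardw: "card (L w) = Suc (card (L u))" using c L_fin inQ QS by (auto simp: card_insert_if)
  have wn: "w < n" using c S_less by blast
  have dle: "Suc ?dep \<le> deg w" using L_deg[OF c(1)] cardw dep c by simp
  have snoc: "queue h (Q @ [w])" using queue_snoc[OF Q c(1) w(2)] cardw u by simp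
  have "length Q \<le> n" using QS S_less distinct_card[of Q] card_mono[of "{..<n}" "set Q"] by fastforce
  note Wb = this W deg_le[OF wn]
  let ?body = "Load 14 9 13 ;; IfLess 14 5 (Copy 16 13) Skip"
  let ?rest = "Store 7 9 16 ;; Store 6 9 6 ;; Load 14 8 6 ;; Add 14 14 1 ;; Store 8 9 14 ;;
     Store 4 4 9 ;; Add 4 4 1"
  have post: "wp W ?rest P s2 T2" if "agree discover s s2" and s2: "regs s2 16 = c" "arrs s2 5 = (arrs s 5)(w := 2)"
      "arrs s2 4 = arrs s 4" "arrs s2 6 = arrs s 6" "arrs s2 7 = arrs s 7" "arrs s2 8 = arrs s 8" "regs s2 4 = regs s 4"
    and T2: "7 + e \<le> T2" for s2 T2
  proof -
    have k: "regs s2 1 = 1" "regs s2 9 = w" "regs s2 6 = u"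
      using that(1) s by (auto simp: agree_def discover_def walk_up_def)
    let ?s3 = "s2\<lparr>arrs := (arrs s2)(7 := (arrs s2 7)(w := c), 6 := (arrs s2 6)(w := u),
         8 := (arrs s2 8)(w := card (L u) + 1), 4 := (arrs s2 4)(length Q := w)),
       regs := (regs s2)(14 := card (L u) + 1, 4 := length Q + 1)\<rparr>"
    have "tree L (set (Q @ [w])) (arrs ?s3 6) (arrs ?s3 7) (arrs ?s3 8)"
      using tree w c inQ cardw L_fin s2 by (auto simp: tree_def)
    then have "stored (Q @ [w]) ?s3"
      using s s2 by (simp add: stored_def nth_append)
    moreover have "agree discover s ?s3"
      using that(1) by (auto simp: agree_def discover_def walk_up_def)
    ultimately have "P ?s3 T3" if "e \<le> T3" for T3
      using that snoc s2 by (intro exit) auto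
    then show ?thesis
      using k s s2 T2 dep Wb cardw dle c by (auto simp: stored_def fun_upd_twist)
  qed
  have walk: "wp W (walk_up ?body) (wp W ?rest P) s1 T1" if "agree discover s s1"
    and s1: "arrs s1 5 = (arrs s 5)(w := 2)" "arrs s1 4 = arrs s 4"
      "arrs s1 6 = arrs s 6" "arrs s1 7 = arrs s 7" "arrs s1 8 = arrs s 8" "regs s1 11 = ?u1" "regs s1 12 = ?dep"
      "regs s1 4 = regs s 4"
    and T1: "7 * ?dep + 8 + e \<le> T1" for s1 T1
  proof (rule wp_walk_up[where v = ?u1 and k = ?dep and par = "arrs s 6" and cls = "arrs s 7" and
        J = "\<lambda>xs s' T'. (c \<in> set xs \<longrightarrow> regs s' 16 = c) \<and> 3 * (?dep - length xs) \<le> T'" and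
        ?T0.0 = "3 * ?dep" and e = "7 + e"])
    show "regs s1 1 = 1" "regs s1 2 = 0"
      using that(1) s by (auto simp: agree_def discover_def walk_up_def)
    fix xs i ys s' T'
    assume agr: "agree (walk_up ?body) s1 s'" and split: "?chain = xs @ i # ys" and i: "regs s' 13 = i"
      and J: "(c \<in> set xs \<longrightarrow> regs s' 16 = c) \<and> 3 * (?dep - length xs) \<le> T'"
    have il: "i \<in> L ?u1" using ch split by auto
    then have "i < deg \<rho>" using L_sub inQ QS by blast
    moreover have "arrs s' 9 = arrs s 9" "regs s' 5 = h"
      using agr that(1) s by (auto simp: agree_def discover_def walk_up_def)
    \<comment> \<open>Only \<open>c\<close> is unmarked on this chain, so no other coordinate can
      overwrite register 16.\<close>
    ultimately have "arrs s' 9 i < regs s' 5 \<longleftrightarrow> i = c"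
      using mark[of i] il c by auto
    moreover have "Suc (length xs) \<le> ?dep"
      using arg_cong[OF split, of length] by simp
    ultimately show "wp W ?body (\<lambda>s' T'. (c \<in> set (xs @ [i]) \<longrightarrow> regs s' 16 = c) \<and>
        3 * (?dep - length (xs @ [i])) \<le> T') s' T'"
      using i J by auto
  next
    fix s' T' T''
    assume agr: "agree (walk_up ?body) s1 s'"
      and J: "(c \<in> set ?chain \<longrightarrow> regs s' 16 = c) \<and> 3 * (?dep - length ?chain) \<le> T'"
      and T'': "T' + (7 + e) \<le> T''"
    have "c \<in> set ?chain" using ch c by blast
    then show "wp W ?rest P s' T''"
      using J T'' agr that by (intro post) (auto simp: agree_def discover_def walk_up_def)
  qed (use s1 T1 in auto)
  show ?thesis
    unfolding discover_def using s W T dle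
    by (simp, intro conjI walk) (auto simp: agree_def discover_def walk_up_def)
qed

text \<open>\<open>R w\<close> is the set of scanned neighbours of \<open>w\<close>. As a parameter
  it also describes the moments in the middle of scanning one vertex.\<close>

definition counted :: "(nat \<Rightarrow> nat set) \<Rightarrow> nat list \<Rightarrow> state \<Rightarrow> bool" where
  "counted R Q s \<longleftrightarrow> (\<forall>w<n. if w \<in> set Q then arrs s 5 w = 2
     else R w = {} \<and> arrs s 5 w = 0 \<or> R w = {arrs s 6 w} \<and> arrs s 5 w = 1)"

lemma stored_set_reg [simp]: "x \<noteq> 4 \<Longrightarrow> stored Q (set_reg x m s) \<longleftrightarrow> stored Q s"
  by (simp add: stored_def)

lemma counted_set_reg [simp]: "counted R Q (set_reg x m s) \<longleftrightarrow> counted R Q s"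
  by (simp add: counted_def)

definition scanned :: "nat \<Rightarrow> nat list \<Rightarrow> nat \<Rightarrow> nat set" where
  "scanned h Q w = {v \<in> set (take h Q). w \<in> set (adj ! v)}"

text \<open>A potential. Applied to the queue it pays for the discovery of vertices outside it,
  applied to a processed prefix it pays for the processing of all others. The factor 20 is a common
  upper bound: for instance, marking and scanning a vertex cost at most 5 and 8 credits per list
  entry, apart from a constant.\<close>

definition cost :: "nat list \<Rightarrow> nat" where
  "cost Q = (\<Sum>v\<in>{..<n} - set Q. 20 * (deg v + 1))"

lemma cost_snoc:
  assumes "w < n" "w \<notin> set Q"
  shows "cost Q = cost (Q @ [w]) + 20 * (deg w + 1)"
proof -
  have "{..<n} - set Q = insert w ({..<n} - set (Q @ [w]))" using assms by auto
  then have "cost Q = (\<Sum>v\<in>insert w ({..<n} - set (Q @ [w])). 20 * (deg v + 1))"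
    unfolding cost_def by (rule arg_cong)
  also have "\<dots> = 20 * (deg w + 1) + cost (Q @ [w])"
    unfolding cost_def by (rule sum.insert) auto
  finally show ?thesis by simp
qed

text \<open>After the neighbours \<open>xs\<close> of \<open>u\<close>, exactly these count
  \<open>u\<close> among their scanned neighbours, which is \<open>R xs\<close>. A visit without
  discovery is covered by 5 credits; a discovery is paid from \<open>cost\<close>.\<close>

lemma wp_scan:
  assumes Q: "queue h Q" "h < length Q" and u: "u = Q ! h"
    and s: "inp adj s" "stored Q s" "regs s 5 = h" "regs s 6 = u"
    and mark: "\<And>i. i < deg \<rho> \<Longrightarrow> arrs s 9 i < h \<longleftrightarrow> i \<notin> L u"
    and count: "counted (scanned h Q) Q s"
    and T: "cost Q + 8 * deg u + 4 + e \<le> T"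
    and exit: "\<And>s' T' zs. agree (for_nbrs visit) s s' \<Longrightarrow> queue (Suc h) (Q @ zs) \<Longrightarrow> stored (Q @ zs) s' \<Longrightarrow>
      counted (scanned (Suc h) (Q @ zs)) (Q @ zs) s' \<Longrightarrow> cost (Q @ zs) + e \<le> T' \<Longrightarrow> P s' T'"
  shows "wp W (for_nbrs visit) P s T"
proof -
  define R where "R xs w = scanned h Q w \<union> (if w \<in> set xs then {u} else {})" for xs w
  define J where "J xs s' T' \<longleftrightarrow> (\<exists>zs. queue h (Q @ zs) \<and> stored (Q @ zs) s' \<and>
    counted (R xs) (Q @ zs) s' \<and> cost (Q @ zs) + 5 * (deg u - length xs) \<le> T')" for xs s' T'
  have "u \<in> set Q" "set Q \<subseteq> S" using Q u by (auto simp: queue_def)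
  then have un: "u < n" using S_less by blast
  show ?thesis
  proof (rule wp_for_nbrs[where J = J and ?T0.0 = "cost Q + 5 * deg u" and e = e])
    show "inp adj s" "regs s 6 = u" "u < n" "n \<le> W" "length (concat adj) \<le> W"
      using s un W by auto
    have "R [] = scanned h Q" by (auto simp: R_def)
    then show "J [] s (cost Q + 5 * deg u)"
      unfolding J_def using Q s count by (intro exI[of _ "[]"]) auto
    show "J xs (set_reg x m s') T'" if "x \<in> {7, 8, 9}" "J xs s' T'" for xs x m s' T'
      using that unfolding J_def by auto
  next
    fix xs w ys s' T'
    assume agr: "agree (for_nbrs visit) s s'" and split: "adj ! u = xs @ w # ys" and r9: "regs s' 9 = w"
      and "J xs s' T'"
    then obtain zs where J: "queue h (Q @ zs)" "stored (Q @ zs) s'" "counted (R xs) (Q @ zs) s'"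
        "cost (Q @ zs) + 5 * (deg u - length xs) \<le> T'"
      unfolding J_def by blast
    have w: "w \<in> set (adj ! u)" "w < n" "w \<notin> set xs"
      using split distinct_adj[OF un] nbr_less[OF un] by auto
    have k: "regs s' 1 = 1" "regs s' 2 = 0" "regs s' 5 = h" "regs s' 6 = u" "arrs s' 9 = arrs s 9"
      using agr s by (auto simp: agree_def for_nbrs_def visit_def discover_def walk_up_def inp_def)
    have len: "deg u - length xs = Suc (deg u - Suc (length xs))" using split by simp
    have Rw: "R (xs @ [w]) w = insert u (R xs w)" "R xs w = scanned h Q w"
      "\<And>v. v \<noteq> w \<Longrightarrow> R (xs @ [w]) v = R xs v"
      using w by (auto simp: R_def)
    consider (old) "w \<in> set (Q @ zs)" "arrs s' 5 w = 2"
      | (new) "w \<notin> set (Q @ zs)" "R xs w = {}" "arrs s' 5 w = 0"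
      | (second) "w \<notin> set (Q @ zs)" "R xs w = {arrs s' 6 w}" "arrs s' 5 w = 1"
      using J(3) w(2) unfolding counted_def by metis
    then show "wp W visit (J (xs @ [w])) s' T'"
    proof cases
      case old
      have "counted (R (xs @ [w])) (Q @ zs) s'"
        using J(3) old Rw unfolding counted_def by metis
      then have "J (xs @ [w]) (set_reg 10 2 s') T1" if "T' \<le> T1 + 5" for T1
        unfolding J_def using J that len by (intro exI[of _ zs]) (auto simp: stored_def counted_def)
      moreover have "5 \<le> T'" using J(4) len by simp
      ultimately show ?thesis
        unfolding visit_def using old k r9 by auto
    next
      case new
      let ?s = "set_reg 10 0 s'\<lparr>arrs := (arrs s')(5 := (arrs s' 5)(w := 1), 6 := (arrs s' 6)(w := u))\<rparr>"
      have "counted (R (xs @ [w])) (Q @ zs) ?s"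
        using J(3) new Rw unfolding counted_def by simp
      moreover have "stored (Q @ zs) ?s"
        using new(1) by (intro stored_cong[OF J(2)]) auto
      ultimately have "J (xs @ [w]) ?s T1" if "T' \<le> T1 + 5" for T1
        unfolding J_def using J that len by (intro exI[of _ zs]) auto
      moreover have "5 \<le> T'" using J(4) len by simp
      ultimately show ?thesis
        unfolding visit_def using new k r9 by (auto simp: fun_upd_twist)
    next
      case second
      let ?s = "set_reg 10 1 s'"
      have first: "arrs s' 6 w \<in> set (take h (Q @ zs))" "w \<in> set (adj ! arrs s' 6 w)"
        using second Rw Q(2) by (auto simp: scanned_def)
      have nth: "h < length (Q @ zs)" "u = (Q @ zs) ! h" using Q u by (auto simp: nth_append)
      have cw: "cost (Q @ zs) = cost (Q @ zs @ [w]) + 20 * (deg w + 1)"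
        using cost_snoc[OF w(2) second(1)] by simp
      \<comment> \<open>The three credits are spent on one load and two tests.\<close>
      have "wp W discover (J (xs @ [w])) ?s T1" if T1: "T' \<le> T1 + 3" for T1
      proof (rule wp_discover[OF J(1) nth w(1) second(1)])
        show "7 * deg w + 12 + (cost (Q @ zs @ [w]) + 5 * (deg u - Suc (length xs))) \<le> T1"
          using T1 J(4) cw len by simp
        show "arrs ?s 9 i < h \<longleftrightarrow> i \<notin> L u" if "i < deg \<rho>" for i
          using mark[OF that] k by simp
        show "stored (Q @ zs) ?s" using J(2) by (simp add: stored_def)
      next
        fix s2 T2
        assume d: "queue h ((Q @ zs) @ [w])" "stored ((Q @ zs) @ [w]) s2" "arrs s2 5 = (arrs ?s 5)(w := 2)"
          "arrs s2 6 = (arrs ?s 6)(w := u)" "cost (Q @ zs @ [w]) + 5 * (deg u - Suc (length xs)) \<le> T2"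
        have "counted (R (xs @ [w])) (Q @ zs @ [w]) s2"
          using J(3) Rw d(3,4) unfolding counted_def by simp
        then show "J (xs @ [w]) s2 T2"
          unfolding J_def using d by (intro exI[of _ "zs @ [w]"]) auto
      qed (use k r9 first in auto)
      moreover have "5 \<le> T'" using J(4) len by simp
      ultimately show ?thesis
        unfolding visit_def using second k r9 by auto
    qed
  next
    fix s' T' T'' assume agr: "agree (for_nbrs visit) s s'" and "J (adj ! u) s' T'" and T'': "T' + e \<le> T''"
    then obtain zs where J: "queue h (Q @ zs)" "stored (Q @ zs) s'" "counted (R (adj ! u)) (Q @ zs) s'"
        "cost (Q @ zs) \<le> T'"
      unfolding J_def by auto
    have take: "take (Suc h) (Q @ zs) = take h Q @ [u]"
      using Q(2) u by (simp add: take_Suc_conv_app_nth)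
    have R: "R (adj ! u) = scanned (Suc h) (Q @ zs)"
      unfolding fun_eq_iff scanned_def R_def take by auto
    have "queue (Suc h) (Q @ zs)"
    proof (rule queue_Suc[OF J(1)])
      fix w u1 u2 assume w: "w < n" "w \<notin> set (Q @ zs)"
        and "u1 \<in> set (take (Suc h) (Q @ zs))" "u2 \<in> set (take (Suc h) (Q @ zs))"
          "w \<in> set (adj ! u1)" "w \<in> set (adj ! u2)"
      then have "u1 \<in> R (adj ! u) w" "u2 \<in> R (adj ! u) w" unfolding R by (auto simp: scanned_def)
      then show "u1 = u2" using J(3) w unfolding counted_def by (metis empty_iff singletonD)
    qed (use Q in simp)
    then show "P s' T''"
      using J R T'' by (intro exit[OF agr]) auto
  qed (use T in \<open>auto simp: visit_def discover_def walk_up_def\<close>)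
qed

lemma cost_Nil: "cost [] = 20 * (n + length (concat adj))"
proof -
  have "length (concat adj) = (\<Sum>v<n. deg v)"
    by (simp add: length_concat sum_list_sum_nth atLeast0LessThan)
  then show ?thesis by (simp add: cost_def sum.distrib flip: sum_distrib_left)
qed

lemma queue_first: "queue 1 (\<rho> # adj ! \<rho>)"
proof -
  have c: "card (L v) = 1" if "v \<in> set (adj ! \<rho>)" for v
    using that root_nbrs by (auto simp: in_set_conv_nth)
  then have nr: "\<rho> \<notin> set (adj ! \<rho>)" using root c[of \<rho>] by auto
  have "map (\<lambda>v. card (L v)) (adj ! \<rho>) = map (\<lambda>v. 1) (adj ! \<rho>)"
    using c by simp
  then have "sorted (map (\<lambda>v. card (L v)) (adj ! \<rho>))"
    by (simp add: map_replicate_const)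
  then show ?thesis
    unfolding queue_def using root root_nbrs distinct_adj nr c by (auto simp: take_Cons')
qed

lemma wp_first_level:
  assumes s: "inp adj s" "regs s 3 = \<rho>" and cnt: "\<And>w. w < n \<Longrightarrow> arrs s 5 w = 0"
    and T: "10 * deg \<rho> + 10 + e \<le> T"
    and exit: "\<And>s' T'. agree first_level s s' \<Longrightarrow> stored (\<rho> # adj ! \<rho>) s' \<Longrightarrow>
      counted (scanned 1 (\<rho> # adj ! \<rho>)) (\<rho> # adj ! \<rho>) s' \<Longrightarrow> e \<le> T' \<Longrightarrow> P s' T'"
  shows "wp W first_level P s T"
proof -
  let ?c = "Store 4 4 9 ;; Store 5 9 10 ;; Store 8 9 1 ;; Store 6 9 3 ;;
       Sub 13 4 1 ;; Store 7 9 13 ;; Add 4 4 1"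
  define J where "J xs s' T' \<longleftrightarrow> stored (\<rho> # xs) s' \<and>
    (\<forall>w<n. arrs s' 5 w = (if w \<in> set (\<rho> # xs) then 2 else 0)) \<and> 7 * (deg \<rho> - length xs) \<le> T'" for xs s' T'
  have nr: "\<rho> \<notin> set (adj ! \<rho>)" using queue_first by (simp add: queue_def)
  have loop: "wp W (for_nbrs ?c) P s1 T1"
    if agr1: "agree first_level s s1" and s1: "regs s1 6 = \<rho>" "regs s1 10 = 2" "J [] s1 (7 * deg \<rho>)"
      and T1: "10 * deg \<rho> + 4 + e \<le> T1" for s1 T1
  proof (rule wp_for_nbrs[where J = J and ?T0.0 = "7 * deg \<rho>" and e = e])
    show "inp adj s1" using s agr1 by (simp add: inp_def agree_def first_level_def for_nbrs_def)
    show "J xs (set_reg x m s') T'" if "x \<in> {7, 8, 9}" "J xs s' T'" for xs x m s' T'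
      using that by (auto simp: J_def stored_def)
  next
    fix xs w ys s' T'
    assume agr: "agree (for_nbrs ?c) s1 s'" and split: "adj ! \<rho> = xs @ w # ys" and r9: "regs s' 9 = w"
      and J: "J xs s' T'"
    have k: "regs s' 1 = 1" "regs s' 10 = 2" "regs s' 3 = \<rho>"
      using agr agr1 s s1 by (auto simp: agree_def first_level_def for_nbrs_def inp_def)
    have w: "w \<noteq> \<rho>" "w \<notin> set xs" "w < n"
      using split nr distinct_adj[OF root(3)] nbr_less[OF root(3)] by auto
    have Lw: "L w = {length xs}"
      using root_nbrs(2)[of "length xs"] split by simp
    have len: "deg \<rho> - length xs = Suc (deg \<rho> - Suc (length xs))" "length xs < n"
      using split deg_le[OF root(3)] by auto
    let ?s = "s'\<lparr>arrs := (arrs s')(4 := (arrs s' 4)(Suc (length xs) := w), 5 := (arrs s' 5)(w := 2),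
        8 := (arrs s' 8)(w := 1), 6 := (arrs s' 6)(w := \<rho>), 7 := (arrs s' 7)(w := length xs)),
      regs := (regs s')(13 := length xs, 4 := Suc (length xs) + 1)\<rparr>"
    have tree: "tree L (set (\<rho> # xs)) (arrs s' 6) (arrs s' 7) (arrs s' 8)"
      using J by (simp add: J_def stored_def)
    have "tree L (set (\<rho> # xs @ [w])) (arrs ?s 6) (arrs ?s 7) (arrs ?s 8)"
      using tree w Lw root unfolding tree_def by auto
    then have "stored (\<rho> # xs @ [w]) ?s"
      using J by (auto simp: J_def stored_def nth_append nth_Cons split: nat.split)
    then have "J (xs @ [w]) ?s T1" if "T' \<le> T1 + 7" for T1
      unfolding J_def using J that w len by (auto simp: J_def)
    moreover have "7 \<le> T'" "regs s' 4 = Suc (length xs)" using J len by (auto simp: J_def stored_def)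
    ultimately show "wp W ?c (J (xs @ [w])) s' T'"
      using k r9 len(2) W by (auto simp: fun_upd_twist)
  next
    fix s' T' T'' assume agr: "agree (for_nbrs ?c) s1 s'" and J: "J (adj ! \<rho>) s' T'" and T'': "T' + e \<le> T''"
    have "counted (scanned 1 (\<rho> # adj ! \<rho>)) (\<rho> # adj ! \<rho>) s'"
      using J by (auto simp: J_def counted_def scanned_def take_Cons')
    then show "P s' T''"
      using J T'' agr agr1 by (intro exit) (auto simp: J_def agree_def first_level_def for_nbrs_def)
  qed (use s1 T1 W root in auto)
  let ?s = "s\<lparr>arrs := (arrs s)(4 := (arrs s 4)(0 := \<rho>), 5 := (arrs s 5)(\<rho> := 2), 8 := (arrs s 8)(\<rho> := 0)),
    regs := (regs s)(6 := \<rho>, 10 := 2, 4 := 1)\<rparr>"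
  have "J [] ?s (7 * deg \<rho>)"
    using root cnt by (auto simp: J_def stored_def tree_def)
  moreover have "agree first_level s ?s"
    by (auto simp: agree_def first_level_def for_nbrs_def)
  ultimately have "wp W (for_nbrs ?c) P ?s T1" if "10 * deg \<rho> + 4 + e \<le> T1" for T1
    using that by (intro loop) auto
  then show ?thesis
    unfolding first_level_def using s W T by (auto simp: inp_def fun_upd_twist)
qed

lemma wp_label:
  assumes s: "inp adj s" "regs s 3 = \<rho>" and T: "60 * (n + length (concat adj) + 1) + e \<le> T"
    and exit: "\<And>s' T' Q. agree label_com s s' \<Longrightarrow> distinct Q \<Longrightarrow> set Q = S \<Longrightarrow> stored Q s' \<Longrightarrow> e \<le> T' \<Longrightarrow> P s' T'"
  shows "wp W label_com P s T"
proof -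
  let ?mark = "walk_up (Store 9 13 5)"
  let ?body = "Load 6 4 5 ;; Copy 11 6 ;; Load 12 8 6 ;; ?mark ;; for_nbrs visit ;; Add 5 5 1"
  let ?loop = "WhileLess 5 4 ?body"
  \<comment> \<open>\<open>cost Q\<close> pays for discoveries still to come and
    \<open>cost (take h Q)\<close> for the vertices still to be scanned. All marks are older than
    \<open>h\<close>, so none is mistaken for a mark of the next head.\<close>
  define I where "I s' T' \<longleftrightarrow> (\<exists>Q h. queue h Q \<and> regs s' 5 = h \<and> stored Q s' \<and>
    (\<forall>i<deg \<rho>. arrs s' 9 i < h) \<and> counted (scanned h Q) Q s' \<and>
    cost Q + cost (take h Q) + 1 + e \<le> T')" for s' T'
  note unf = agree_def label_com_def first_level_def for_nbrs_def for_range_def visit_def discover_def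
    walk_up_def
  have loop: "wp W ?loop P s1 T1" if agr1: "agree label_com s s1" and I1: "I s1 T1" for s1 T1
  proof (rule wp_WhileLess[where I = I, OF I1])
    fix s' T' assume agr: "agree ?body s1 s'" and I: "I s' T'" and less: "regs s' 5 < regs s' 4"
    obtain Q h where Q: "queue h Q" "regs s' 5 = h" "stored Q s'" "\<And>i. i < deg \<rho> \<Longrightarrow> arrs s' 9 i < h"
        "counted (scanned h Q) Q s'" "cost Q + cost (take h Q) + 1 + e \<le> T'"
      using I unfolding I_def by blast
    have h: "h < length Q" "arrs s' 4 h = Q ! h" using less Q by (auto simp: stored_def)
    let ?u = "Q ! h"
    have QS: "distinct Q" "set Q \<subseteq> S" using Q by (auto simp: queue_def)
    have "?u \<in> set Q" using h by simp
    then have u: "?u \<in> set Q" "?u \<in> S" "?u < n" using QS S_less by auto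
    have tree: "tree L (set Q) (arrs s' 6) (arrs s' 7) (arrs s' 8)" using Q by (simp add: stored_def)
    have dep: "arrs s' 8 ?u = card (L ?u)" using tree u by (simp add: tree_def)
    let ?chain = "chain (arrs s' 6) (arrs s' 7) (card (L ?u)) ?u"
    have ch: "set ?chain = L ?u" using tree_chain[OF tree u(1)] dep by simp
    have dle: "card (L ?u) \<le> deg ?u" using L_deg[OF u(2)] .
    have inp: "inp adj s'" using agr agr1 s by (simp add: unf inp_def)
    have "take (Suc h) Q = take h Q @ [?u]" using h by (simp add: take_Suc_conv_app_nth)
    moreover have "?u \<notin> set (take h Q)"
      using calculation distinct_take[OF QS(1), of "Suc h"] by simp
    ultimately have ch_cost: "cost (take h Q) = cost (take (Suc h) Q) + 20 * (deg ?u + 1)"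
      using cost_snoc[OF u(3)] by simp
    have "length Q \<le> n" using QS S_less distinct_card[of Q] card_mono[of "{..<n}" "set Q"] by fastforce
    let ?s2 = "set_reg 12 (card (L ?u)) (set_reg 11 ?u (set_reg 6 ?u s'))"
    have scan: "wp W (for_nbrs visit ;; Add 5 5 1) I s3 T3"
      if agr3: "agree ?mark ?s2 s3" and m3: "arrs s3 9 = (\<lambda>i. if i \<in> L ?u then h else arrs s' 9 i)"
        and T3: "cost Q + cost (take (Suc h) Q) + 2 + e + 8 * deg ?u + 4 \<le> T3" for s3 T3
      unfolding wp_Seq
    proof (rule wp_scan[OF Q(1) h(1) refl, where e = "cost (take (Suc h) Q) + 2 + e"])
      show "inp adj s3" "regs s3 6 = ?u" "regs s3 5 = h"
        using agr3 inp Q(2) by (auto simp: unf inp_def)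
      show "stored Q s3" "counted (scanned h Q) Q s3"
        using agr3 Q(3,5) by (auto simp: unf stored_def counted_def)
      show "arrs s3 9 i < h \<longleftrightarrow> i \<notin> L ?u" if "i < deg \<rho>" for i
        using Q(4)[OF that] m3 by simp
      show "cost Q + 8 * deg ?u + 4 + (cost (take (Suc h) Q) + 2 + e) \<le> T3" using T3 by simp
    next
      fix s4 T4 zs
      assume agr4: "agree (for_nbrs visit) s3 s4" and Q4: "queue (Suc h) (Q @ zs)" "stored (Q @ zs) s4"
        "counted (scanned (Suc h) (Q @ zs)) (Q @ zs) s4" "cost (Q @ zs) + (cost (take (Suc h) Q) + 2 + e) \<le> T4"
      have k: "regs s4 5 = h" "regs s4 1 = 1" "arrs s4 9 = arrs s3 9"
        using agr4 agr3 inp Q(2) by (auto simp: unf inp_def)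
      \<comment> \<open>Marks set in this round equal \<open>h\<close> and become stale when the
        head advances; nothing is ever erased.\<close>
      have "arrs s4 9 i < Suc h" if "i < deg \<rho>" for i
        using Q(4)[OF that] m3 k by simp
      moreover have "take (Suc h) (Q @ zs) = take (Suc h) Q" using h by simp
      ultimately have "I (set_reg 5 (h + 1) s4) T5" if "T4 \<le> T5 + 1" for T5
        unfolding I_def using Q4 that
        by (intro exI[of _ "Q @ zs"] exI[of _ "Suc h"]) (auto simp: stored_def counted_def)
      then show "wp W (Add 5 5 1) I s4 T4"
        using k Q4(4) \<open>length Q \<le> n\<close> h W by simp
    qed
    have "wp W ?mark (wp W (for_nbrs visit ;; Add 5 5 1) I) ?s2 T2" if "T' \<le> T2 + 4" for T2
    proof (rule wp_walk_up[where v = ?u and k = "card (L ?u)" and par = "arrs s' 6" and cls = "arrs s' 7" and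
          J = "\<lambda>xs s3 T3. arrs s3 9 = (\<lambda>i. if i \<in> set xs then h else arrs s' 9 i) \<and> card (L ?u) - length xs \<le> T3" and
          ?T0.0 = "card (L ?u)" and e = "cost Q + cost (take (Suc h) Q) + 2 + e + 8 * deg ?u + 4"])
      fix xs i ys s3 T3
      assume agr3: "agree ?mark ?s2 s3" and split: "?chain = xs @ i # ys" and i: "regs s3 13 = i"
        and J: "arrs s3 9 = (\<lambda>i. if i \<in> set xs then h else arrs s' 9 i) \<and> card (L ?u) - length xs \<le> T3"
      have "regs s3 5 = h" using agr3 Q(2) by (simp add: unf)
      moreover have "Suc (length xs) \<le> card (L ?u)" using arg_cong[OF split, of length] by simp
      ultimately show "wp W (Store 9 13 5) (\<lambda>s3 T3. arrs s3 9 = (\<lambda>j. if j \<in> set (xs @ [i]) then h else arrs s' 9 j) \<and>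
          card (L ?u) - length (xs @ [i]) \<le> T3) s3 T3"
        using i J by (auto simp: fun_eq_iff)
    next
      show "card (L ?u) + (cost Q + cost (take (Suc h) Q) + 2 + e + 8 * deg ?u + 4) + 4 * card (L ?u) + 1 \<le> T2"
        using that Q(6) ch_cost dle by simp
      fix s3 T3 T4 assume "agree ?mark ?s2 s3" "arrs s3 9 = (\<lambda>i. if i \<in> set ?chain then h else arrs s' 9 i) \<and>
          card (L ?u) - length ?chain \<le> T3" "T3 + (cost Q + cost (take (Suc h) Q) + 2 + e + 8 * deg ?u + 4) \<le> T4"
      then show "wp W (for_nbrs visit ;; Add 5 5 1) I s3 T4"
        using ch by (intro scan) auto
    qed (use inp in \<open>auto simp: inp_def\<close>)
    then show "1 \<le> T' \<and> wp W ?body I s' (T' - 1)"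
      using Q(2,6) h dep ch_cost by (auto simp: fun_upd_twist)
  next
    fix s' T' assume agr: "agree ?body s1 s'" and I: "I s' T'" and "\<not> regs s' 5 < regs s' 4"
    then obtain Q where Q: "queue (length Q) Q" "stored Q s'" "1 + e \<le> T'"
      unfolding I_def by (auto simp: stored_def queue_def)
    then show "1 \<le> T' \<and> P s' (T' - 1)"
      using queue_end[OF Q(1)] agr agr1
      by (auto intro!: exit[of _ Q] simp: queue_def unf)
  qed
  \<comment> \<open>Both potentials start at no more than \<open>cost []\<close>, together 40
    credits per vertex and list entry. Clearing the arrays and the first level fit into the
    remaining 20 of the 60 in \<open>T\<close>.\<close>
  let ?e = "2 * cost [] + 2 + e"
  have first: "wp W (first_level ;; Copy 5 1 ;; ?loop) P s1 T1"
    if agr1: "agree label_com s s1" and z: "\<And>w. w < n \<Longrightarrow> arrs s1 5 w = 0" "\<And>w. w < n \<Longrightarrow> arrs s1 9 w = 0"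
      and T1: "10 * deg \<rho> + 10 + ?e \<le> T1" for s1 T1
    unfolding wp_Seq[of _ first_level]
  proof (rule wp_first_level[where e = ?e])
    show "inp adj s1" "regs s1 3 = \<rho>" using agr1 s by (auto simp: unf inp_def)
    fix s2 T2 assume agr2: "agree first_level s1 s2" and 2: "stored (\<rho> # adj ! \<rho>) s2"
      "counted (scanned 1 (\<rho> # adj ! \<rho>)) (\<rho> # adj ! \<rho>) s2" "?e \<le> T2"
    have "cost xs \<le> cost []" for xs unfolding cost_def by (rule sum_mono2) auto
    from this[of "\<rho> # adj ! \<rho>"] this[of "take 1 (\<rho> # adj ! \<rho>)"]
    have c: "cost (\<rho> # adj ! \<rho>) + cost (take 1 (\<rho> # adj ! \<rho>)) + 1 + e \<le> T3" if "T2 \<le> T3 + 1" for T3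
      using 2 that by linarith
    have "arrs s2 9 i < 1" if "i < deg \<rho>" for i
      using that agr2 z(2)[of i] deg_le[OF root(3)] by (simp add: unf)
    then have "I (set_reg 5 1 s2) T3" if "T2 \<le> T3 + 1" for T3
      unfolding I_def using queue_first 2 c[OF that]
      by (intro exI[of _ "\<rho> # adj ! \<rho>"] exI[of _ 1]) (auto simp: stored_def counted_def)
    moreover have "agree label_com s (set_reg 5 1 s2)" using agr1 agr2 by (auto simp: unf)
    moreover have "regs s2 1 = 1" using agr1 agr2 s by (simp add: unf inp_def)
    ultimately show "wp W (Copy 5 1 ;; ?loop) P s2 T2"
      using 2(3) loop by simp
  qed (use z T1 in auto)
  have "wp W (for_range 5 0 (Store 5 5 2 ;; Store 9 5 2)) (wp W (first_level ;; Copy 5 1 ;; ?loop) P)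
    (set_reg 5 0 s) T1" if T1: "T \<le> T1 + 1" for T1
  proof (rule wp_for_range[where J = "\<lambda>k s' T'. (\<forall>w<k. arrs s' 5 w = 0 \<and> arrs s' 9 w = 0) \<and> 2 * (n - k) \<le> T'" and
        ?k0.0 = 0 and N = n and ?T0.0 = "2 * n" and e = "10 * deg \<rho> + 10 + ?e"])
    show "2 * n + (10 * deg \<rho> + 10 + ?e) + 2 * (n - 0) + 1 \<le> T1"
      using T T1 cost_Nil deg_le[OF root(3)] by simp
  next
    fix k s' T' assume agr: "agree (for_range 5 0 (Store 5 5 2 ;; Store 9 5 2)) (set_reg 5 0 s) s'"
      and k: "k < n" "regs s' 5 = k" and J: "(\<forall>w<k. arrs s' 5 w = 0 \<and> arrs s' 9 w = 0) \<and> 2 * (n - k) \<le> T'"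
    have "regs s' 2 = 0" using agr s by (simp add: unf inp_def)
    then show "wp W (Store 5 5 2 ;; Store 9 5 2)
      (\<lambda>s' T'. (\<forall>w<Suc k. arrs s' 5 w = 0 \<and> arrs s' 9 w = 0) \<and> 2 * (n - Suc k) \<le> T') s' T'"
      using k J by (auto simp: less_Suc_eq)
  next
    fix s' T' T''
    assume "agree (for_range 5 0 (Store 5 5 2 ;; Store 9 5 2)) (set_reg 5 0 s) s'"
      "(\<forall>w<n. arrs s' 5 w = 0 \<and> arrs s' 9 w = 0) \<and> 2 * (n - n) \<le> T'" "T' + (10 * deg \<rho> + 10 + ?e) \<le> T''"
    then show "wp W (first_level ;; Copy 5 1 ;; ?loop) P s' T''"
      by (intro first) (auto simp: unf)
  qed (use s W in \<open>auto simp: inp_def\<close>)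
  then show ?thesis
    unfolding label_com_def using T by simp
qed

end

section \<open>Finding a minimal vertex\<close>

text \<open>The initial value \<open>n + 1\<close> of register 17 exceeds every degree, so vertex 0
  always replaces it.\<close>

definition min_degree_com :: com where
  "min_degree_com = Add 17 0 1 ;; Const 3 0 ;; Const 5 0 ;;
     for_range 5 0 (Load 7 0 5 ;; Add 8 5 1 ;; Load 8 0 8 ;; Sub 8 8 7 ;;
       IfLess 8 17 (Copy 17 8 ;; Copy 3 5) Skip)"

text \<open>Register 18 preserves the size of the cube: the search appends to the same queue, and
  later stages find the cube in its first cells.\<close>

definition init_gates_com :: com where
  "init_gates_com = Copy 18 4 ;; Const 5 0 ;;
     for_range 5 18 (Load 9 4 5 ;; Add 14 9 1 ;; Store 10 9 14)"

definition gate_visit :: com where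
  "gate_visit = Load 14 10 9 ;;
     IfLess 2 14 Skip (Store 10 9 15 ;; Store 4 4 9 ;; Add 4 4 1)"

definition gates_com :: com where
  "gates_com = Const 5 0 ;;
     WhileLess 5 4 (
       Load 6 4 5 ;; Load 15 10 6 ;; Load 14 11 15 ;; Add 14 14 1 ;; Store 11 15 14 ;;
       for_nbrs gate_visit ;; Add 5 5 1)"

text \<open>All vertices with the same gate contribute to the same coordinates, so each cube vertex
  adds the size of its whole fibre at once.\<close>

definition count_com :: com where
  "count_com = Const 5 0 ;;
     for_range 5 18 (
       Load 11 4 5 ;; Add 14 11 1 ;; Load 15 11 14 ;; Load 12 8 11 ;;
       walk_up (Load 14 12 13 ;; Add 14 14 15 ;; Store 12 13 14))"

text \<open>Register 16 flags a coordinate without a strict majority on its far side, register 17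
  holds the largest admissible label size so far.\<close>

definition choose_com :: com where
  "choose_com = Const 17 0 ;; Const 5 0 ;;
     for_range 5 18 (
       Load 6 4 5 ;; Copy 11 6 ;; Load 12 8 6 ;; Const 16 0 ;;
       walk_up (Load 14 12 13 ;; Add 14 14 14 ;; IfLess 0 14 Skip (Copy 16 1)) ;;
       IfLess 2 16 Skip (Load 14 8 6 ;; IfLess 14 17 Skip (Copy 17 14 ;; Copy 3 6)))"

text \<open>Register 0 serves as loop bound and as index of the last offset before it is overwritten
  by the dimension, the degree of the root.\<close>

definition output_com :: com where
  "output_com = Const 4 0 ;; Const 5 0 ;;
     for_range 5 0 (
       Store 2 5 4 ;; Copy 11 5 ;; Load 12 8 5 ;; walk_up (Store 3 4 13 ;; Add 4 4 1)) ;;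
     Store 2 0 4 ;; Load 7 0 3 ;; Add 8 3 1 ;; Load 8 0 8 ;; Sub 0 8 7"

lemmas com_defs = agree_def label_com_def first_level_def for_nbrs_def for_range_def visit_def
  discover_def walk_up_def min_degree_com_def init_gates_com_def gate_visit_def gates_com_def
  count_com_def choose_com_def output_com_def

lemma (in adj_graph) wp_min_degree:
  assumes s: "inp adj s" and n: "0 < n" and T: "9 * n + 4 + e \<le> T"
    and exit: "\<And>s' T' v. agree min_degree_com s s' \<Longrightarrow> regs s' 3 = v \<Longrightarrow> v < n \<Longrightarrow>
      (\<And>u. u < n \<Longrightarrow> deg v \<le> deg u) \<Longrightarrow> e \<le> T' \<Longrightarrow> P s' T'"
  shows "wp W min_degree_com P s T"
proof -
  let ?c = "Load 7 0 5 ;; Add 8 5 1 ;; Load 8 0 8 ;; Sub 8 8 7 ;;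
       IfLess 8 17 (Copy 17 8 ;; Copy 3 5) Skip"
  define J where "J k s' T' \<longleftrightarrow> (\<forall>u<k. regs s' 17 \<le> deg u) \<and>
    (if k = 0 then regs s' 17 = n + 1 else regs s' 3 < k \<and> regs s' 17 = deg (regs s' 3)) \<and> 7 * (n - k) \<le> T'"
    for k and s' :: state and T'
  let ?s = "s\<lparr>regs := (regs s)(17 := n + 1, 3 := 0, 5 := 0)\<rparr>"
  have "wp W (for_range 5 0 ?c) P ?s T1" if T1: "9 * n + 1 + e \<le> T1" for T1
  proof (rule wp_for_range[where J = J and ?k0.0 = 0 and N = n and ?T0.0 = "7 * n" and e = e])
    show "J 0 ?s (7 * n)" by (simp add: J_def)
  next
    fix k s' T' assume agr: "agree (for_range 5 0 ?c) ?s s'" and k: "k < n" "regs s' 5 = k" and J: "J k s' T'"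
    have inp: "inp adj s'" using agr s by (simp add: inp_def com_defs)
    then have r: "regs s' 1 = 1" by (simp add: inp_def)
    have off: "arrs s' 0 (k + 1) - arrs s' 0 k = deg k" using inp_off(1)[OF inp k(1), unfolded Suc_eq_plus1] by simp
    have T': "7 \<le> T'" "7 * (n - Suc k) \<le> T' - 7" using J k by (auto simp: J_def)
    have "deg k < n + 1" using deg_le[OF k(1)] by simp
    have 1: "J (Suc k) (s'\<lparr>regs := (regs s')(7 := x, 8 := y, 17 := deg k, 3 := k)\<rparr>) T1"
      if "T' \<le> T1 + 7" "deg k < regs s' 17" for x y T1
      using J that T' \<open>deg k < n + 1\<close> unfolding J_def
      by (auto simp: less_Suc_eq split: if_splits intro: less_imp_le order.strict_trans2)
    have 2: "J (Suc k) (s'\<lparr>regs := (regs s')(7 := x, 8 := y)\<rparr>) T1"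
      if "T' \<le> T1 + 7" "\<not> deg k < regs s' 17" for x y T1
      using J that T' \<open>deg k < n + 1\<close> unfolding J_def
      by (auto simp: less_Suc_eq split: if_splits)
    show "wp W ?c (J (Suc k)) s' T'"
      using k r off T' W 1 2 by (auto simp: fun_upd_twist)
  next
    fix s' T' T'' assume "agree (for_range 5 0 ?c) ?s s'" "J n s' T'" "T' + e \<le> T''"
    then show "P s' T''"
      using n by (intro exit[of s' "regs s' 3"]) (auto simp: J_def com_defs)
  next
    show "J k (set_reg 5 m s') T'" if "J k s' T'" for k m s' T'
      using that by (auto simp: J_def split: if_splits)
  qed (use s W T1 in \<open>auto simp: inp_def\<close>)
  then show ?thesis
    unfolding min_degree_com_def using s W T by (auto simp: inp_def fun_upd_twist)
qed

context label
begin

lemma length_queue: "distinct Q \<Longrightarrow> set Q \<subseteq> {..<n} \<Longrightarrow> length Q \<le> n"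
  using distinct_card[of Q] card_mono[of "{..<n}" "set Q"] by simp

section \<open>The search for the gates\<close>

text \<open>The counterpart of \<open>queue\<close> for an ordinary breadth-first search from all of
  \<open>S\<close>: here one scanned neighbour suffices.\<close>

definition gate_queue :: "(nat \<Rightarrow> nat) \<Rightarrow> nat \<Rightarrow> nat list \<Rightarrow> bool" where
  "gate_queue lev h Q \<longleftrightarrow> distinct Q \<and> set Q \<subseteq> {..<n} \<and> S \<subseteq> set Q \<and> sorted (map lev Q) \<and> h \<le> length Q \<and>
     (h < length Q \<longrightarrow> (\<forall>q\<in>set Q. lev q \<le> Suc (lev (Q ! h)))) \<and>
     (\<forall>v\<in>set (take h Q). set (adj ! v) \<subseteq> set Q)"

text \<open>A positive level has a neighbour one level lower. It is queued by induction and scanned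
  by hypothesis, hence all its neighbours are queued.\<close>

lemma in_gate_queue:
  assumes g: "gating adj S g lev" and Q: "gate_queue lev h Q" and w: "w < n"
    "\<And>v. v \<in> set Q \<Longrightarrow> lev v < lev w \<Longrightarrow> v \<in> set (take h Q)"
  shows "w \<in> set Q"
  using w
proof (induction "lev w" arbitrary: w rule: less_induct)
  case less
  show ?case
  proof (cases "lev w = 0")
    case True
    then have "w \<in> S" using g less.prems(1) unfolding gating_def by simp
    then show ?thesis using Q unfolding gate_queue_def by blast
  next
    case False
    then obtain u where u: "u < n" "w \<in> set (adj ! u)" "lev w = Suc (lev u)"
      using g less.prems(1) unfolding gating_def by blast
    then have "u \<in> set Q" using less.hyps[of u] less.prems(2) by simp
    then have "u \<in> set (take h Q)" using less.prems(2) u by simp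
    then have "set (adj ! u) \<subseteq> set Q" using Q by (simp add: gate_queue_def)
    then show ?thesis using u(2) by blast
  qed
qed

lemma gate_queue_level:
  assumes g: "gating adj S g lev" and Q: "gate_queue lev h Q" "h < length Q" and w: "w < n" "lev w \<le> lev (Q ! h)"
  shows "w \<in> set Q"
proof (rule in_gate_queue[OF g Q(1) w(1)])
  fix v assume v: "v \<in> set Q" "lev v < lev w"
  then obtain i where i: "i < length Q" "v = Q ! i" by (auto simp: in_set_conv_nth)
  have "i < h"
  proof (rule ccontr)
    assume "\<not> i < h"
    then have "lev (Q ! h) \<le> lev (Q ! i)"
      using Q i sorted_nth_mono[of "map lev Q" h i] unfolding gate_queue_def by auto
    then show False using v w i by simp
  qed
  then show "v \<in> set (take h Q)" using i Q(2) by (auto simp: in_set_conv_nth)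
qed

definition gated :: "(nat \<Rightarrow> nat) \<Rightarrow> nat list \<Rightarrow> state \<Rightarrow> bool" where
  "gated g Q s \<longleftrightarrow> regs s 4 = length Q \<and> (\<forall>i<length Q. arrs s 4 i = Q ! i) \<and>
     (\<forall>w<n. arrs s 10 w = (if w \<in> set Q then g w + 1 else 0))"

lemma gated_set_reg [simp]: "x \<noteq> 4 \<Longrightarrow> gated g Q (set_reg x m s) \<longleftrightarrow> gated g Q s"
  by (simp add: gated_def)

lemma wp_gate_visits:
  assumes g: "gating adj S g lev" and Q: "gate_queue lev h Q" "h < length Q" and u: "u = Q ! h"
    and s: "inp adj s" "gated g Q s" "regs s 6 = u" "regs s 15 = g u + 1"
    and T: "8 * deg u + 4 + e \<le> T"
    and exit: "\<And>s' T' zs. agree (for_nbrs gate_visit) s s' \<Longrightarrow> gate_queue lev (Suc h) (Q @ zs) \<Longrightarrow>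
      gated g (Q @ zs) s' \<Longrightarrow> e \<le> T' \<Longrightarrow> P s' T'"
  shows "wp W (for_nbrs gate_visit) P s T"
proof -
  define J where "J xs s' T' \<longleftrightarrow> (\<exists>zs. gate_queue lev h (Q @ zs) \<and> gated g (Q @ zs) s' \<and>
    set xs \<subseteq> set (Q @ zs) \<and> 5 * (deg u - length xs) \<le> T')" for xs s' T'
  have "u \<in> set Q" "set Q \<subseteq> {..<n}" using Q u by (auto simp: gate_queue_def)
  then have un: "u < n" "u \<in> set Q" by auto
  show ?thesis
  proof (rule wp_for_nbrs[where J = J and ?T0.0 = "5 * deg u" and e = e])
    show "inp adj s" "regs s 6 = u" "u < n" using s un by auto
    show "J [] s (5 * deg u)"
      unfolding J_def using Q s by (intro exI[of _ "[]"]) auto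
    show "J xs (set_reg x m s') T'" if "x \<in> {7, 8, 9}" "J xs s' T'" for xs x m s' T'
      using that by (auto simp: J_def gated_def)
  next
    fix xs w ys s' T'
    assume agr: "agree (for_nbrs gate_visit) s s'" and split: "adj ! u = xs @ w # ys" and r9: "regs s' 9 = w"
      and "J xs s' T'"
    then obtain zs where J: "gate_queue lev h (Q @ zs)" "gated g (Q @ zs) s'" "set xs \<subseteq> set (Q @ zs)"
        "5 * (deg u - length xs) \<le> T'"
      unfolding J_def by blast
    have w: "w \<in> set (adj ! u)" "w < n"
      using split nbr_less[OF un(1)] by auto
    have k: "regs s' 1 = 1" "regs s' 2 = 0" "regs s' 15 = g u + 1"
      using agr s by (auto simp: com_defs inp_def)
    have len: "deg u - length xs = Suc (deg u - Suc (length xs))" using split by simp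
    have T': "5 \<le> T'" "5 * (deg u - Suc (length xs)) \<le> T' - 5" using J(4) len by auto
    have nth: "h < length (Q @ zs)" "(Q @ zs) ! h = u" using Q u by (auto simp: nth_append)
    have g10: "arrs s' 10 w = (if w \<in> set (Q @ zs) then g w + 1 else 0)"
      using J(2) w by (simp add: gated_def)
    show "wp W gate_visit (J (xs @ [w])) s' T'"
    proof (cases "w \<in> set (Q @ zs)")
      case True
      then have "J (xs @ [w]) (set_reg 14 x s') T1" if "T' \<le> T1 + 5" for x T1
        unfolding J_def using J T' that by (intro exI[of _ zs]) auto
      moreover have "0 < arrs s' 10 w" using g10 True by simp
      ultimately show ?thesis
        unfolding gate_visit_def using k r9 T'(1) by auto
    next
      case False
      \<comment> \<open>Everything up to the level of the head is queued already. So an unseen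
        neighbour is exactly one level higher and shares the gate of \<open>u\<close>.\<close>
      have "\<not> lev w \<le> lev u"
        using gate_queue_level[OF g J(1) nth(1) w(2)] nth(2) False by auto
      then have lev: "lev w = Suc (lev u)" and gw: "g w = g u"
        using g un w unfolding gating_def by (metis le_Suc_eq)+
      have gq: "gate_queue lev h (Q @ zs @ [w])"
        using J(1) False w lev nth unfolding gate_queue_def by (auto simp: sorted_append nth_append)
      then have len_Q: "length (Q @ zs @ [w]) \<le> n"
        by (intro length_queue) (auto simp: gate_queue_def)
      let ?s = "s'\<lparr>arrs := (arrs s')(10 := (arrs s' 10)(w := g u + 1), 4 := (arrs s' 4)(length (Q @ zs) := w)),
        regs := (regs s')(14 := 0, 4 := length (Q @ zs) + 1)\<rparr>"
      have "gated g (Q @ zs @ [w]) ?s"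
        using J(2) gw by (auto simp: gated_def nth_append)
      then have "J (xs @ [w]) ?s T1" if "T' \<le> T1 + 5" for T1
        unfolding J_def using J gq T' that by (intro exI[of _ "zs @ [w]"]) auto
      moreover have "arrs s' 10 w = 0" "regs s' 4 = length (Q @ zs)" using g10 False J(2) by (auto simp: gated_def)
      ultimately show ?thesis
        unfolding gate_visit_def using k r9 T'(1) len_Q W by (auto simp: fun_upd_twist)
    qed
  next
    fix s' T' T'' assume agr: "agree (for_nbrs gate_visit) s s'" and "J (adj ! u) s' T'" and T'': "T' + e \<le> T''"
    then obtain zs where J: "gate_queue lev h (Q @ zs)" "gated g (Q @ zs) s'" "set (adj ! u) \<subseteq> set (Q @ zs)"
      unfolding J_def by auto
    have take: "take (Suc h) (Q @ zs) = take h (Q @ zs) @ [u]"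
      using Q(2) u by (simp add: take_Suc_conv_app_nth nth_append)
    have h: "h < length (Q @ zs)" using Q by simp
    have "lev q \<le> Suc (lev ((Q @ zs) ! Suc h))" if "Suc h < length (Q @ zs)" "q \<in> set (Q @ zs)" for q
    proof -
      have "lev ((Q @ zs) ! h) \<le> lev ((Q @ zs) ! Suc h)"
        using J(1) that(1) sorted_nth_mono[of "map lev (Q @ zs)" h "Suc h"] unfolding gate_queue_def
        by (auto simp del: map_append)
      moreover have "lev q \<le> Suc (lev ((Q @ zs) ! h))" using J(1) h that(2) unfolding gate_queue_def by blast
      ultimately show ?thesis by simp
    qed
    moreover have "\<forall>v\<in>set (take (Suc h) (Q @ zs)). set (adj ! v) \<subseteq> set (Q @ zs)"
      unfolding take using J by (auto simp: gate_queue_def simp del: take_append)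
    ultimately have "gate_queue lev (Suc h) (Q @ zs)"
      using J(1) h unfolding gate_queue_def by (blast intro: Suc_leI)
    then show "P s' T''"
      using J T'' by (intro exit[OF agr]) auto
  qed (use T W in \<open>auto simp: gate_visit_def\<close>)
qed

lemma wp_init_gates:
  assumes s: "inp adj s" and Q: "distinct Q" "set Q \<subseteq> {..<n}" "regs s 4 = length Q" "\<forall>i<length Q. arrs s 4 i = Q ! i"
    and z: "\<And>w. arrs s 10 w = 0" and T: "5 * n + 3 + e \<le> T"
    and exit: "\<And>s' T'. agree init_gates_com s s' \<Longrightarrow> regs s' 18 = length Q \<Longrightarrow>
      (\<And>w. arrs s' 10 w = (if w \<in> set Q then w + 1 else 0)) \<Longrightarrow> e \<le> T' \<Longrightarrow> P s' T'"
  shows "wp W init_gates_com P s T"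
proof -
  let ?c = "Load 9 4 5 ;; Add 14 9 1 ;; Store 10 9 14"
  define J where "J k s' T' \<longleftrightarrow> (\<forall>w. arrs s' 10 w = (if w \<in> set (take k Q) then w + 1 else 0)) \<and>
    3 * (length Q - k) \<le> T'" for k and s' :: state and T'
  let ?s = "s\<lparr>regs := (regs s)(18 := length Q, 5 := 0)\<rparr>"
  have len: "length Q \<le> n" using length_queue Q by blast
  have "wp W (for_range 5 18 ?c) P ?s T1" if T1: "5 * n + 1 + e \<le> T1" for T1
  proof (rule wp_for_range[where J = J and ?k0.0 = 0 and N = "length Q" and ?T0.0 = "3 * length Q" and e = e])
    show "J 0 ?s (3 * length Q)" using z by (simp add: J_def)
  next
    fix k s' T' assume agr: "agree (for_range 5 18 ?c) ?s s'" and k: "k < length Q" "regs s' 5 = k" and J: "J k s' T'"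
    have r: "regs s' 1 = 1" "arrs s' 4 k = Q ! k" using agr s Q k by (auto simp: inp_def com_defs)
    have T': "3 \<le> T'" "3 * (length Q - Suc k) \<le> T' - 3" using J k by (auto simp: J_def)
    have "Q ! k < n" using Q k by (metis lessThan_iff nth_mem subset_iff)
    let ?s1 = "s'\<lparr>regs := (regs s')(9 := Q ! k, 14 := Q ! k + 1), arrs := (arrs s')(10 := (arrs s' 10)(Q ! k := Q ! k + 1))\<rparr>"
    have "J (Suc k) ?s1 T1" if "T' \<le> T1 + 3" for T1
      using J that T' k unfolding J_def by (auto simp: take_Suc_conv_app_nth)
    then show "wp W ?c (J (Suc k)) s' T'"
      using k r T'(1) W \<open>Q ! k < n\<close> by (auto simp: fun_upd_twist)
  next
    fix s' T' T'' assume "agree (for_range 5 18 ?c) ?s s'" "J (length Q) s' T'" "T' + e \<le> T''"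
    then show "P s' T''"
      by (intro exit) (auto simp: J_def com_defs)
  next
    show "J k (set_reg 5 m s') T'" if "J k s' T'" for k m s' T'
      using that by (simp add: J_def)
  qed (use s W T1 len in \<open>auto simp: inp_def\<close>)
  then show ?thesis
    unfolding init_gates_com_def using s Q(3) W T by (auto simp: inp_def fun_upd_twist)
qed

lemma wp_gates:
  assumes g: "gating adj S g lev" and s: "inp adj s"
    and Q: "distinct Q" "set Q = S" "regs s 4 = length Q" "\<forall>i<length Q. arrs s 4 i = Q ! i"
    and z: "\<And>w. arrs s 10 w = (if w \<in> set Q then w + 1 else 0)" "\<And>x. arrs s 11 x = 0"
    and T: "20 * (n + length (concat adj)) + 2 + e \<le> T"
    and exit: "\<And>s' T'. agree gates_com s s' \<Longrightarrow> (\<forall>i<length Q. arrs s' 4 i = Q ! i) \<Longrightarrow>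
      (\<And>x. arrs s' 11 (x + 1) = card {w. w < n \<and> g w = x}) \<Longrightarrow> e \<le> T' \<Longrightarrow> P s' T'"
  shows "wp W gates_com P s T"
proof -
  let ?body = "Load 6 4 5 ;; Load 15 10 6 ;; Load 14 11 15 ;; Add 14 14 1 ;; Store 11 15 14 ;;
       for_nbrs gate_visit ;; Add 5 5 1"
  \<comment> \<open>Vertices are counted when they reach the head, so the scanned prefix is what
    array 11 has counted.\<close>
  define I where "I s' T' \<longleftrightarrow> (\<exists>zs h. gate_queue lev h (Q @ zs) \<and> gated g (Q @ zs) s' \<and> regs s' 5 = h \<and>
    (\<forall>x. arrs s' 11 (x + 1) = card {v \<in> set (take h (Q @ zs)). g v = x}) \<and>
    cost (take h (Q @ zs)) + 1 + e \<le> T')" for s' T'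
  let ?s = "set_reg 5 0 s"
  have lev0: "lev w = 0" "g w = w" if "w \<in> S" for w using g that by (auto simp: gating_def)
  have "map lev Q = map (\<lambda>w. 0) Q" using Q lev0 by simp
  then have "sorted (map lev Q)" by (simp add: map_replicate_const)
  then have "gate_queue lev 0 Q"
    using Q lev0 S_less by (auto simp: gate_queue_def)
  moreover have "gated g Q ?s" using Q z lev0 by (simp add: gated_def)
  ultimately have I0: "I ?s T1" if "T \<le> T1 + 1" for T1
    unfolding I_def using that T cost_Nil z by (intro exI[of _ "[]"] exI[of _ 0]) auto
  have "wp W (WhileLess 5 4 ?body) P ?s T1" if T1: "T \<le> T1 + 1" for T1
  proof (rule wp_WhileLess[where I = I, OF I0[OF T1]])
    fix s' T' assume agr: "agree ?body ?s s'" and I: "I s' T'" and less: "regs s' 5 < regs s' 4"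
    obtain zs h where J: "gate_queue lev h (Q @ zs)" "gated g (Q @ zs) s'" "regs s' 5 = h"
        "\<And>x. arrs s' 11 (x + 1) = card {v \<in> set (take h (Q @ zs)). g v = x}"
        "cost (take h (Q @ zs)) + 1 + e \<le> T'"
      using I unfolding I_def by blast
    let ?Q = "Q @ zs"
    let ?u = "?Q ! h"
    have h: "h < length ?Q" "arrs s' 4 h = ?u" using less J by (auto simp: gated_def)
    have dQ: "distinct ?Q" "set ?Q \<subseteq> {..<n}" using J(1) unfolding gate_queue_def by blast+
    then have u: "?u \<in> set ?Q" "?u < n" using h(1) by (meson lessThan_iff nth_mem subset_iff)+
    have take: "take (Suc h) ?Q = take h ?Q @ [?u]" using h(1) by (rule take_Suc_conv_app_nth)
    have unt: "?u \<notin> set (take h ?Q)"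
      using take distinct_take[OF dQ(1), of "Suc h"] by simp
    have cst: "cost (take h ?Q) = cost (take (Suc h) ?Q) + 20 * (deg ?u + 1)"
      using cost_snoc[OF u(2) unt] take by simp
    have g10: "arrs s' 10 ?u = g ?u + 1" using J(2) u by (simp add: gated_def)
    have fin: "finite {v \<in> set (take h ?Q). g v = x}" for x by simp
    have "card {v \<in> set (take h ?Q). g v = g ?u} \<le> card {..<n}"
      using dQ(2) by (intro card_mono) (auto dest: in_set_takeD)
    then have cardn: "card {v \<in> set (take h ?Q). g v = g ?u} \<le> n" by simp
    have inp: "inp adj s'" using agr s by (simp add: inp_def com_defs)
    have len: "length ?Q \<le> n" using length_queue dQ by blast
    let ?s2 = "s'\<lparr>regs := (regs s')(6 := ?u, 15 := g ?u + 1, 14 := card {v \<in> set (take h ?Q). g v = g ?u} + 1),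
      arrs := (arrs s')(11 := (arrs s' 11)(g ?u + 1 := card {v \<in> set (take h ?Q). g v = g ?u} + 1))\<rparr>"
    have card_Suc: "arrs ?s2 11 (x + 1) = card {v \<in> set (take (Suc h) ?Q). g v = x}" for x
    proof -
      have "{v \<in> set (take (Suc h) ?Q). g v = x} =
          (if g ?u = x then insert ?u {v \<in> set (take h ?Q). g v = x} else {v \<in> set (take h ?Q). g v = x})"
        unfolding take by auto
      then show ?thesis using J(4) unt by (simp add: card_insert_if)
    qed
    have "wp W (for_nbrs gate_visit ;; Add 5 5 1) I ?s2 T2" if T2: "T' \<le> T2 + 6" for T2
      unfolding wp_Seq
    proof (rule wp_gate_visits[OF g J(1) h(1) refl, where e = "cost (take (Suc h) ?Q) + 2 + e"])
      show "inp adj ?s2" using inp by (simp add: inp_def)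
      show "gated g ?Q ?s2" using J(2) by (simp add: gated_def)
      show "8 * deg ?u + 4 + (cost (take (Suc h) ?Q) + 2 + e) \<le> T2"
        using T2 J(5) cst by simp
    next
      fix s3 T3 ys assume agr3: "agree (for_nbrs gate_visit) ?s2 s3"
        and Q3: "gate_queue lev (Suc h) (?Q @ ys)" "gated g (?Q @ ys) s3" "cost (take (Suc h) ?Q) + 2 + e \<le> T3"
      have k: "regs s3 5 = h" "regs s3 1 = 1" "arrs s3 11 = arrs ?s2 11"
        using agr3 inp J(3) by (auto simp: com_defs inp_def)
      have "take (Suc h) (?Q @ ys) = take (Suc h) ?Q" using h(1) by simp
      then have "I (set_reg 5 (h + 1) s3) T4" if "T3 \<le> T4 + 1" for T4
        unfolding I_def using Q3 that card_Suc k
        by (intro exI[of _ "zs @ ys"] exI[of _ "Suc h"]) auto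
      then show "wp W (Add 5 5 1) I s3 T3"
        using k Q3(3) len h W by auto
    qed auto
    then show "1 \<le> T' \<and> wp W ?body I s' (T' - 1)"
      using J(3,5) J(4)[of "g ?u"] h g10 inp cst cardn W by (auto simp: inp_def fun_upd_twist)
  next
    fix s' T' assume agr: "agree ?body ?s s'" and I: "I s' T'" and "\<not> regs s' 5 < regs s' 4"
    then obtain zs where J: "gate_queue lev (length (Q @ zs)) (Q @ zs)" "gated g (Q @ zs) s'"
        "\<And>x. arrs s' 11 (x + 1) = card {v \<in> set (Q @ zs). g v = x}" "1 + e \<le> T'"
      unfolding I_def by (auto simp: gated_def gate_queue_def)
    have "w \<in> set (Q @ zs)" if "w < n" for w
      by (rule in_gate_queue[OF g J(1) that]) simp
    moreover have "set (Q @ zs) \<subseteq> {..<n}" using J(1) unfolding gate_queue_def by blast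
    ultimately have "set (Q @ zs) = {..<n}" by blast
    then have "arrs s' 11 (x + 1) = card {w. w < n \<and> g w = x}" for x
      using J(3) by simp
    moreover have "arrs s' 4 i = Q ! i" if "i < length Q" for i
      using J(2) that by (simp add: gated_def nth_append)
    ultimately show "1 \<le> T' \<and> P s' (T' - 1)"
      using agr J(4) by (auto intro!: exit simp: com_defs)
  qed
  then show ?thesis
    unfolding gates_com_def using T W by auto
qed

section \<open>Counting the sides of coordinates and choosing the root\<close>

lemma cost_take:
  assumes "distinct Q" "k < length Q" "Q ! k < n"
  shows "cost (take k Q) = cost (take (Suc k) Q) + 20 * (deg (Q ! k) + 1)"
proof -
  have take: "take (Suc k) Q = take k Q @ [Q ! k]" using assms(2) by (rule take_Suc_conv_app_nth)
  then have "Q ! k \<notin> set (take k Q)"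
    using distinct_take[OF assms(1), of "Suc k"] by simp
  then show ?thesis using cost_snoc[OF assms(3)] take by simp
qed

lemma S_queue:
  assumes "distinct Q" "set Q = S" "k < length Q"
  shows "Q ! k \<in> S" "Q ! k < n" "cost (take k Q) = cost (take (Suc k) Q) + 20 * (deg (Q ! k) + 1)"
    "length Q \<le> n"
proof -
  show S: "Q ! k \<in> S" using assms by auto
  then show "Q ! k < n" by (rule S_less)
  with assms show "cost (take k Q) = cost (take (Suc k) Q) + 20 * (deg (Q ! k) + 1)"
    by (intro cost_take)
  show "length Q \<le> n" using assms S_less by (intro length_queue) auto
qed

lemma tree_chain_S:
  assumes "tree L S par cls dep" "w \<in> S"
  shows "set (chain par cls (card (L w)) w) = L w" "distinct (chain par cls (card (L w)) w)" "dep w = card (L w)"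
  using tree_chain[OF assms] assms by (auto simp: tree_def)

lemma wp_count:
  assumes s: "inp adj s" "tree L S (arrs s 6) (arrs s 7) (arrs s 8)" "regs s 18 = length Q"
    and Q: "distinct Q" "set Q = S" "\<forall>i<length Q. arrs s 4 i = Q ! i"
    and g: "\<And>w. w < n \<Longrightarrow> g w \<in> S" "\<And>x. arrs s 11 (x + 1) = card {w. w < n \<and> g w = x}"
    and z: "\<And>i. arrs s 12 i = 0"
    and T: "20 * (n + length (concat adj)) + 2 * n + 2 + e \<le> T"
    and exit: "\<And>s' T'. agree count_com s s' \<Longrightarrow>
      (\<And>i. arrs s' 12 i = card {w. w < n \<and> i \<in> L (g w)}) \<Longrightarrow> e \<le> T' \<Longrightarrow> P s' T'"
  shows "wp W count_com P s T"
proof -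
  let ?w = "walk_up (Load 14 12 13 ;; Add 14 14 15 ;; Store 12 13 14)"
  let ?c = "Load 11 4 5 ;; Add 14 11 1 ;; Load 15 11 14 ;; Load 12 8 11 ;; ?w"
  \<comment> \<open>The partial count after the cube vertices in \<open>A\<close>. It never exceeds
    \<open>n\<close>, which keeps every intermediate sum within the word bound.\<close>
  define C where "C A i = card {w. w < n \<and> g w \<in> A \<and> i \<in> L (g w)}" for A i
  have C_le: "C A i \<le> n" for A i
    using card_mono[of "{..<n}" "{w. w < n \<and> g w \<in> A \<and> i \<in> L (g w)}"] by (auto simp: C_def)
  have C_insert: "C (insert x A) i = C A i + (if i \<in> L x then card {w. w < n \<and> g w = x} else 0)"
    if "x \<notin> A" for x A i
  proof (cases "i \<in> L x")
    case True
    then have "{w. w < n \<and> g w \<in> insert x A \<and> i \<in> L (g w)} =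
        {w. w < n \<and> g w \<in> A \<and> i \<in> L (g w)} \<union> {w. w < n \<and> g w = x}" by auto
    moreover have "{w. w < n \<and> g w \<in> A \<and> i \<in> L (g w)} \<inter> {w. w < n \<and> g w = x} = {}"
      using that by auto
    ultimately show ?thesis using True by (simp add: C_def card_Un_disjoint)
  next
    case False
    then have "{w. w < n \<and> g w \<in> insert x A \<and> i \<in> L (g w)} = {w. w < n \<and> g w \<in> A \<and> i \<in> L (g w)}"
      by auto
    then show ?thesis using False by (simp add: C_def)
  qed
  define J where "J k s' T' \<longleftrightarrow> (\<forall>i. arrs s' 12 i = C (set (take k Q)) i) \<and> cost (take k Q) \<le> T'"
    for k and s' :: state and T'
  let ?s = "set_reg 5 0 s"
  have "wp W (for_range 5 18 ?c) P ?s T1" if T1: "T \<le> T1 + 1" for T1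
  proof (rule wp_for_range[where J = J and ?k0.0 = 0 and N = "length Q" and ?T0.0 = "cost []" and e = e])
    show "J 0 ?s (cost [])" using z by (simp add: J_def C_def)
  next
    fix k s' T' assume agr: "agree (for_range 5 18 ?c) ?s s'" and k: "k < length Q" "regs s' 5 = k" and J: "J k s' T'"
    note Qk = S_queue[OF Q(1,2) k(1)]
    let ?v = "Q ! k"
    let ?nu = "card {w. w < n \<and> g w = ?v}"
    have same: "arrs s' 4 = arrs s 4" "arrs s' 6 = arrs s 6" "arrs s' 7 = arrs s 7" "arrs s' 8 = arrs s 8"
      "arrs s' 11 = arrs s 11"
      using agr by (auto simp: com_defs)
    have tr: "tree L S (arrs s' 6) (arrs s' 7) (arrs s' 8)" using s(2) same by simp
    note ch = tree_chain_S[OF tr Qk(1)]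
    let ?chain = "chain (arrs s' 6) (arrs s' 7) (card (L ?v)) ?v"
    have inp: "inp adj s'" using agr s by (simp add: inp_def com_defs)
    have r: "regs s' 1 = 1" "regs s' 2 = 0" "arrs s' 4 k = ?v" "arrs s' 11 (?v + 1) = ?nu"
      using inp same Q(3) g(2) k by (auto simp: inp_def)
    have take: "take (Suc k) Q = take k Q @ [?v]" using k(1) by (rule take_Suc_conv_app_nth)
    have vt: "?v \<notin> set (take k Q)" using take distinct_take[OF Q(1), of "Suc k"] by simp
    have CS: "C (set (take (Suc k) Q)) i = C (set (take k Q)) i + (if i \<in> L ?v then ?nu else 0)" for i
      unfolding take using C_insert[OF vt] by simp
    have dle: "card (L ?v) \<le> deg ?v" using L_deg[OF Qk(1)] .
    let ?s1 = "set_reg 12 (card (L ?v)) (set_reg 15 ?nu (set_reg 14 (?v + 1) (set_reg 11 ?v s')))"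
    define K where "K xs s2 T2 \<longleftrightarrow> regs s2 15 = ?nu \<and>
      (\<forall>i. arrs s2 12 i = C (set (take k Q)) i + (if i \<in> set xs then ?nu else 0)) \<and>
      3 * (card (L ?v) - length xs) \<le> T2" for xs :: "nat list" and s2 :: state and T2
    have "wp W ?w (J (Suc k)) ?s1 T1" if T1: "T' \<le> T1 + 4" for T1
    proof (rule wp_walk_up[where v = ?v and k = "card (L ?v)" and par = "arrs s' 6" and cls = "arrs s' 7" and
          J = K and ?T0.0 = "3 * card (L ?v)" and e = "cost (take (Suc k) Q)"])
      show "K [] ?s1 (3 * card (L ?v))" using J by (simp add: K_def J_def)
      have "20 * (deg ?v + 1) + cost (take (Suc k) Q) \<le> T'" using J Qk(3) by (simp add: J_def)
      then show "3 * card (L ?v) + cost (take (Suc k) Q) + 4 * card (L ?v) + 1 \<le> T1"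
        using T1 dle by simp
    next
      fix xs i ys s2 T2 assume agr2: "agree ?w ?s1 s2" and split: "?chain = xs @ i # ys" and i: "regs s2 13 = i"
        and K: "K xs s2 T2"
      have i': "i \<notin> set xs" "i \<in> L ?v" using ch split by auto
      have "Suc (length xs) \<le> card (L ?v)" using arg_cong[OF split, of length] by simp
      then have T2: "3 \<le> T2" "3 * (card (L ?v) - Suc (length xs)) \<le> T2 - 3" using K by (auto simp: K_def)
      have old: "arrs s2 12 i = C (set (take k Q)) i" "regs s2 15 = ?nu" using K i' by (auto simp: K_def)
      have "C (set (take k Q)) i + ?nu \<le> W" using CS[of i] C_le[of "set (take (Suc k) Q)" i] i' W by simp
      moreover have "K (xs @ [i]) (set_cell 12 i (C (set (take k Q)) i + ?nu)
          (set_reg 14 (C (set (take k Q)) i + ?nu) s2)) T3" if "T2 \<le> T3 + 3" for T3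
        using K T2 that i' by (auto simp: K_def)
      ultimately show "wp W (Load 14 12 13 ;; Add 14 14 15 ;; Store 12 13 14) (K (xs @ [i])) s2 T2"
        using i old T2(1) by auto
    next
      show "K xs (set_reg x m s2) T2" if "x \<in> {11, 12, 13}" "K xs s2 T2" for xs x m s2 T2
        using that by (auto simp: K_def)
    next
      fix s2 T2 T3 assume "K ?chain s2 T2" "T2 + cost (take (Suc k) Q) \<le> T3"
      then show "J (Suc k) s2 T3" using CS ch(1) by (auto simp: K_def J_def)
    qed (use r in auto)
    moreover have "20 * (deg ?v + 1) \<le> T'" using J Qk(3) by (simp add: J_def)
    ultimately show "wp W ?c (J (Suc k)) s' T'"
      using k r ch(3) Qk(2) W by (auto simp: fun_upd_twist)
  next
    fix s' T' T'' assume agr: "agree (for_range 5 18 ?c) ?s s'" and "J (length Q) s' T'" "T' + e \<le> T''"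
    moreover have "{w. w < n \<and> g w \<in> S \<and> i \<in> L (g w)} = {w. w < n \<and> i \<in> L (g w)}" for i
      using g(1) by blast
    ultimately show "P s' T''"
      using Q(2) by (intro exit) (auto simp: J_def C_def com_defs)
  next
    have "length Q \<le> n" using Q S_less by (intro length_queue) auto
    then show "cost [] + e + 2 * (length Q - 0) + 1 \<le> T1" using cost_Nil T T1 by simp
    show "length Q \<le> W" using \<open>length Q \<le> n\<close> W by simp
    show "J k (set_reg 5 m s') T'" if "J k s' T'" for k m s' T'
      using that by (simp add: J_def)
  qed (use s in \<open>auto simp: inp_def walk_up_def\<close>)
  then show ?thesis
    unfolding count_com_def using T by auto
qed

lemma wp_choose:
  assumes s: "inp adj s" "tree L S (arrs s 6) (arrs s 7) (arrs s 8)" "regs s 18 = length Q" "regs s 3 = \<rho>"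
    and Q: "distinct Q" "set Q = S" "\<forall>i<length Q. arrs s 4 i = Q ! i"
    and N: "\<And>i. arrs s 12 i \<le> n"
    and T: "20 * (n + length (concat adj)) + 2 * n + 3 + e \<le> T"
    and exit: "\<And>s' T' r. agree choose_com s s' \<Longrightarrow> regs s' 3 = r \<Longrightarrow> r \<in> S \<Longrightarrow>
      L r \<subseteq> {i. n < 2 * arrs s 12 i} \<Longrightarrow>
      (\<And>w. w \<in> S \<Longrightarrow> L w \<subseteq> {i. n < 2 * arrs s 12 i} \<Longrightarrow> card (L w) \<le> card (L r)) \<Longrightarrow> e \<le> T' \<Longrightarrow> P s' T'"
  shows "wp W choose_com P s T"
proof -
  let ?b = "Load 14 12 13 ;; Add 14 14 14 ;; IfLess 0 14 Skip (Copy 16 1)"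
  let ?w = "walk_up ?b"
  let ?upd = "IfLess 2 16 Skip (Load 14 8 6 ;; IfLess 14 17 Skip (Copy 17 14 ;; Copy 3 6))"
  let ?c = "Load 6 4 5 ;; Copy 11 6 ;; Load 12 8 6 ;; Const 16 0 ;; ?w ;; ?upd"
  define M where "M = {i. n < 2 * arrs s 12 i}"
  \<comment> \<open>Register 3 still holds the root of the cube, whose empty label makes it an
    admissible first candidate of size 0.\<close>
  define J where "J k s' T' \<longleftrightarrow> (\<exists>r\<in>S. regs s' 3 = r \<and> L r \<subseteq> M \<and> regs s' 17 = card (L r) \<and>
    (\<forall>w\<in>set (take k Q). L w \<subseteq> M \<longrightarrow> card (L w) \<le> card (L r))) \<and> cost (take k Q) \<le> T'"
    for k and s' :: state and T'
  let ?s = "set_reg 5 0 (set_reg 17 0 s)"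
  have "wp W (for_range 5 18 ?c) P ?s T1" if T1: "T \<le> T1 + 2" for T1
  proof (rule wp_for_range[where J = J and ?k0.0 = 0 and N = "length Q" and ?T0.0 = "cost []" and e = e])
    show "J 0 ?s (cost [])" using root s by (simp add: J_def)
  next
    fix k s' T' assume agr: "agree (for_range 5 18 ?c) ?s s'" and k: "k < length Q" "regs s' 5 = k" and J: "J k s' T'"
    note Qk = S_queue[OF Q(1,2) k(1)]
    let ?v = "Q ! k"
    have same: "arrs s' = arrs s" using agr by (auto simp: com_defs fun_eq_iff)
    have tr: "tree L S (arrs s' 6) (arrs s' 7) (arrs s' 8)" using s(2) same by simp
    note ch = tree_chain_S[OF tr Qk(1)]
    let ?chain = "chain (arrs s' 6) (arrs s' 7) (card (L ?v)) ?v"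
    have inp: "inp adj s'" using agr s by (simp add: inp_def com_defs)
    have r: "regs s' 1 = 1" "regs s' 2 = 0" "regs s' 0 = n" "arrs s' 4 k = ?v"
      using inp same Q(3) k by (auto simp: inp_def)
    have take: "take (Suc k) Q = take k Q @ [?v]" using k(1) by (rule take_Suc_conv_app_nth)
    have dle: "card (L ?v) \<le> deg ?v" using L_deg[OF Qk(1)] .
    have T': "20 * (deg ?v + 1) + cost (take (Suc k) Q) \<le> T'" using J Qk(3) by (simp add: J_def)
    obtain r0 where r0: "r0 \<in> S" "regs s' 3 = r0" "L r0 \<subseteq> M" "regs s' 17 = card (L r0)"
        "\<forall>w\<in>set (take k Q). L w \<subseteq> M \<longrightarrow> card (L w) \<le> card (L r0)"
      using J by (auto simp: J_def)
    let ?s1 = "set_reg 16 0 (set_reg 12 (card (L ?v)) (set_reg 11 ?v (set_reg 6 ?v s')))"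
    define K where "K xs s2 T2 \<longleftrightarrow> regs s2 16 = (if set xs \<subseteq> M then 0 else 1) \<and>
      4 * (card (L ?v) - length xs) \<le> T2" for xs :: "nat list" and s2 :: state and T2
    have "wp W ?w (wp W ?upd (J (Suc k))) ?s1 T1" if T1: "T' \<le> T1 + 4" for T1
    proof (rule wp_walk_up[where v = ?v and k = "card (L ?v)" and par = "arrs s' 6" and cls = "arrs s' 7" and
          J = K and ?T0.0 = "4 * card (L ?v)" and e = "cost (take (Suc k) Q) + 5"])
      show "4 * card (L ?v) + (cost (take (Suc k) Q) + 5) + 4 * card (L ?v) + 1 \<le> T1"
        using T1 dle T' by simp
    next
      fix xs i ys s2 T2 assume agr2: "agree ?w ?s1 s2" and split: "?chain = xs @ i # ys" and i: "regs s2 13 = i"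
        and K: "K xs s2 T2"
      have "Suc (length xs) \<le> card (L ?v)" using arg_cong[OF split, of length] by simp
      then have T2: "4 \<le> T2" "4 * (card (L ?v) - Suc (length xs)) \<le> T2 - 4" using K by (auto simp: K_def)
      have r2: "regs s2 0 = n" "regs s2 1 = 1" "arrs s2 12 = arrs s 12"
        using agr2 r same by (auto simp: com_defs)
      have in_M: "i \<in> M \<longleftrightarrow> n < arrs s 12 i + arrs s 12 i" by (simp add: M_def mult_2)
      have "K (xs @ [i]) (set_reg 14 x s2) T3" if "T2 \<le> T3 + 4" "i \<in> M" for x T3
        using K T2 that by (auto simp: K_def)
      moreover have "K (xs @ [i]) (s2\<lparr>regs := (regs s2)(14 := x, 16 := 1)\<rparr>) T3" if "T2 \<le> T3 + 4" "i \<notin> M" for x T3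
        using K T2 that by (auto simp: K_def)
      ultimately show "wp W ?b (K (xs @ [i])) s2 T2"
        using i r2 T2(1) N[of i] W in_M by auto
    next
      show "K xs (set_reg x m s2) T2" if "x \<in> {11, 12, 13}" "K xs s2 T2" for xs x m s2 T2
        using that by (auto simp: K_def)
    next
      fix s2 T2 T3 assume agr2: "agree ?w ?s1 s2" and K: "K ?chain s2 T2" and T3: "T2 + (cost (take (Suc k) Q) + 5) \<le> T3"
      have r2: "regs s2 2 = 0" "regs s2 6 = ?v" "regs s2 3 = r0" "regs s2 17 = card (L r0)" "arrs s2 8 ?v = card (L ?v)"
        using agr2 r r0 ch(3) by (auto simp: com_defs)
      have T3': "5 \<le> T3" "cost (take (Suc k) Q) \<le> T3 - 5" using T3 by auto
      show "wp W ?upd (J (Suc k)) s2 T3"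
      proof (cases "L ?v \<subseteq> M")
        case False
        then have "J (Suc k) s2 T4" if "T3 \<le> T4 + 5" for T4
          using r0 r2 T3' that unfolding J_def take by auto
        moreover have "regs s2 16 = 1" using K ch(1) False by (simp add: K_def)
        ultimately show ?thesis using r2 T3'(1) by auto
      next
        case True
        have 16: "regs s2 16 = 0" using K ch(1) True by (simp add: K_def)
        show ?thesis
        proof (cases "card (L ?v) < card (L r0)")
          case less: True
          then have "J (Suc k) (set_reg 14 x s2) T4" if "T3 \<le> T4 + 5" for x T4
            using r0 r2 T3' that unfolding J_def take by auto
          then show ?thesis using r2 T3'(1) 16 less by auto
        next
          case ge: False
          then have "J (Suc k) (s2\<lparr>regs := (regs s2)(14 := x, 17 := card (L ?v), 3 := ?v)\<rparr>) T4"
            if "T3 \<le> T4 + 5" for x T4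
            using r0(5) True Qk(1) r2 T3' that unfolding J_def take
            by (auto intro: le_trans)
          then show ?thesis using r2 T3'(1) 16 ge by (auto simp: fun_upd_twist)
        qed
      qed
    qed (use r in \<open>auto simp: K_def\<close>)
    moreover have "20 \<le> T'" using T' by simp
    ultimately show "wp W ?c (J (Suc k)) s' T'"
      using k r ch(3) Qk(2) W by (auto simp: fun_upd_twist)
  next
    fix s' T' T'' assume agr: "agree (for_range 5 18 ?c) ?s s'" and "J (length Q) s' T'" "T' + e \<le> T''"
    then show "P s' T''"
      using Q(2) by (intro exit[of s' "regs s' 3"]) (auto simp: J_def M_def com_defs)
  next
    have "length Q \<le> n" using Q S_less by (intro length_queue) auto
    then show "cost [] + e + 2 * (length Q - 0) + 1 \<le> T1" using cost_Nil T T1 by simp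
    show "length Q \<le> W" using \<open>length Q \<le> n\<close> W by simp
    show "J k (set_reg 5 m s') T'" if "J k s' T'" for k m s' T'
      using that by (simp add: J_def)
  qed (use s in \<open>auto simp: inp_def walk_up_def\<close>)
  then show ?thesis
    unfolding choose_com_def using T by auto
qed

section \<open>Writing the labels\<close>

lemma wp_output:
  assumes S: "S = {..<n}" and s: "inp adj s" "tree L S (arrs s 6) (arrs s 7) (arrs s 8)" "regs s 3 = \<rho>"
    and T: "20 * (n + length (concat adj)) + 2 * n + 8 \<le> T"
    and exit: "\<And>s' T' xss. regs s' 0 = deg \<rho> \<Longrightarrow> length xss = n \<Longrightarrow> stores_lists (arrs s' 2) (arrs s' 3) xss \<Longrightarrow>
      (\<And>w. w < n \<Longrightarrow> distinct (xss ! w) \<and> set (xss ! w) = L w) \<Longrightarrow> P s' T'"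
  shows "wp W output_com P s T"
proof -
  let ?w = "walk_up (Store 3 4 13 ;; Add 4 4 1)"
  let ?c = "Store 2 5 4 ;; Copy 11 5 ;; Load 12 8 5 ;; ?w"
  let ?end = "Store 2 0 4 ;; Load 7 0 3 ;; Add 8 3 1 ;; Load 8 0 8 ;; Sub 0 8 7"
  define ch where "ch w = chain (arrs s 6) (arrs s 7) (card (L w)) w" for w
  define xss where "xss = map ch [0..<n]"
  have ch: "set (ch w) = L w" "distinct (ch w)" "arrs s 8 w = card (L w)" if "w < n" for w
    using tree_chain_S[OF s(2)] that S by (auto simp: ch_def)
  have xss: "length xss = n" "\<And>w. w < n \<Longrightarrow> xss ! w = ch w" by (auto simp: xss_def)
  \<comment> \<open>By \<open>L_deg\<close> the output is no longer than the adjacency lists, so its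
    offsets respect the word bound.\<close>
  have "length (concat xss) = (\<Sum>w<n. card (L w))"
    by (simp add: length_concat sum_list_sum_nth atLeast0LessThan xss ch_def)
  also have "\<dots> \<le> (\<Sum>w<n. deg w)" using S by (intro sum_mono L_deg) auto
  also have "\<dots> = length (concat adj)"
    by (simp add: length_concat sum_list_sum_nth atLeast0LessThan)
  finally have total: "length (concat xss) \<le> length (concat adj)" .
  have pre: "length (concat (take k xss)) \<le> length (concat xss)" for k
    by (metis append_take_drop_id concat_append le_add1 length_append)
  have snoc: "concat (take (Suc k) xss) = concat (take k xss) @ ch k" if "k < n" for k
    using that xss by (simp add: take_Suc_conv_app_nth)
  define J where "J k s' T' \<longleftrightarrow> regs s' 4 = length (concat (take k xss)) \<and>
    (\<forall>i<k. arrs s' 2 i = length (concat (take i xss))) \<and>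
    (\<forall>j<length (concat (take k xss)). arrs s' 3 j = concat (take k xss) ! j) \<and> cost (take k [0..<n]) \<le> T'"
    for k and s' :: state and T'
  let ?s = "s\<lparr>regs := (regs s)(4 := 0, 5 := 0)\<rparr>"
  have "wp W (for_range 5 0 ?c) (wp W ?end P) ?s T1" if T1: "T \<le> T1 + 2" for T1
  proof (rule wp_for_range[where J = J and ?k0.0 = 0 and N = n and ?T0.0 = "cost []" and e = 5])
    show "J 0 ?s (cost [])" by (simp add: J_def)
  next
    fix k s' T' assume agr: "agree (for_range 5 0 ?c) ?s s'" and k: "k < n" "regs s' 5 = k" and J: "J k s' T'"
    have same: "arrs s' 6 = arrs s 6" "arrs s' 7 = arrs s 7" "arrs s' 8 = arrs s 8"
      using agr by (auto simp: com_defs)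
    have inp: "inp adj s'" using agr s by (simp add: inp_def com_defs)
    then have r: "regs s' 1 = 1" "regs s' 2 = 0" by (auto simp: inp_def)
    have kS: "k \<in> S" using k S by simp
    have dle: "card (L k) \<le> deg k" using L_deg[OF kS] .
    have "20 * (deg k + 1) + cost (take (Suc k) [0..<n]) = cost (take k [0..<n])"
      using cost_take[of "[0..<n]" k] k by simp
    then have T': "20 * (deg k + 1) + cost (take (Suc k) [0..<n]) \<le> T'" using J by (simp add: J_def)
    let ?pre = "concat (take k xss)"
    let ?s1 = "s'\<lparr>arrs := (arrs s')(2 := (arrs s' 2)(k := length ?pre)), regs := (regs s')(11 := k, 12 := card (L k))\<rparr>"
    define K where "K xs s2 T2 \<longleftrightarrow> regs s2 4 = length ?pre + length xs \<and>
      (\<forall>i<Suc k. arrs s2 2 i = length (concat (take i xss))) \<and>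
      (\<forall>j<length ?pre + length xs. arrs s2 3 j = (?pre @ xs) ! j) \<and> 2 * (card (L k) - length xs) \<le> T2"
      for xs :: "nat list" and s2 :: state and T2
    have "wp W ?w (J (Suc k)) ?s1 T2" if T2: "T' \<le> T2 + 3" for T2
    proof (rule wp_walk_up[where v = k and k = "card (L k)" and par = "arrs s 6" and cls = "arrs s 7" and
          J = K and ?T0.0 = "2 * card (L k)" and e = "cost (take (Suc k) [0..<n])"])
      show "2 * card (L k) + cost (take (Suc k) [0..<n]) + 4 * card (L k) + 1 \<le> T2"
        using T2 dle T' by simp
      show "K [] ?s1 (2 * card (L k))" using J by (auto simp: K_def J_def less_Suc_eq)
    next
      fix xs i ys s2 T3 assume agr2: "agree ?w ?s1 s2" and split: "chain (arrs s 6) (arrs s 7) (card (L k)) k = xs @ i # ys"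
        and i: "regs s2 13 = i" and K: "K xs s2 T3"
      have len: "Suc (length xs) \<le> card (L k)" using arg_cong[OF split, of length] by simp
      then have T3: "2 \<le> T3" "2 * (card (L k) - Suc (length xs)) \<le> T3 - 2" using K by (auto simp: K_def)
      have r2: "regs s2 1 = 1" using agr2 r by (auto simp: com_defs)
      have "length ?pre + card (L k) \<le> length (concat xss)"
        using pre[of "Suc k"] snoc[OF k(1)] by (simp add: ch_def)
      then have "length ?pre + length xs + 1 \<le> W" using len total W by simp
      moreover have "K (xs @ [i]) (set_cell 3 (length ?pre + length xs) i s2
          \<lparr>regs := (regs s2)(4 := length ?pre + length xs + 1)\<rparr>) T4" if "T3 \<le> T4 + 2" for T4
        using K T3 that by (auto simp: K_def nth_append less_Suc_eq)
      ultimately show "wp W (Store 3 4 13 ;; Add 4 4 1) (K (xs @ [i])) s2 T3"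
        using i r2 T3(1) K by (auto simp: K_def[of xs])
    next
      show "K xs (set_reg x m s2) T2" if "x \<in> {11, 12, 13}" "K xs s2 T2" for xs x m s2 T2
        using that by (auto simp: K_def)
    next
      fix s2 T3 T4 assume "K (chain (arrs s 6) (arrs s 7) (card (L k)) k) s2 T3" "T3 + cost (take (Suc k) [0..<n]) \<le> T4"
      then show "J (Suc k) s2 T4" using snoc[OF k(1)] by (simp add: K_def J_def ch_def)
    qed (use r same in auto)
    moreover have "20 \<le> T'" using T' by simp
    ultimately show "wp W ?c (J (Suc k)) s' T'"
      using k r same ch(3) J by (auto simp: fun_upd_twist J_def[of k])
  next
    fix s' T' T'' assume agr: "agree (for_range 5 0 ?c) ?s s'" and J: "J n s' T'" and T'': "T' + 5 \<le> T''"
    have inp: "inp adj s'" using agr s by (simp add: inp_def com_defs)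
    then have r: "regs s' 1 = 1" "regs s' 0 = n" by (auto simp: inp_def)
    have r3: "regs s' 3 = \<rho>" using agr s by (simp add: com_defs)
    let ?s1 = "s'\<lparr>arrs := (arrs s')(2 := (arrs s' 2)(n := length (concat xss))),
      regs := (regs s')(7 := arrs s' 0 \<rho>, 8 := arrs s' 0 (\<rho> + 1), 0 := arrs s' 0 (\<rho> + 1) - arrs s' 0 \<rho>)\<rparr>"
    have off: "arrs s' 0 (\<rho> + 1) = arrs s' 0 \<rho> + deg \<rho>"
      using inp_off(1)[OF inp root(3), unfolded Suc_eq_plus1] .
    have "stores_lists (arrs ?s1 2) (arrs ?s1 3) xss"
      using J xss(1) by (auto simp: stores_lists_def J_def)
    then have "P ?s1 T2" for T2
      using xss ch off by (intro exit) auto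
    then show "wp W ?end P s' T''"
      using r r3 J T'' root(3) W xss(1) by (auto simp: fun_upd_twist J_def)
  next
    show "cost [] + 5 + 2 * (n - 0) + 1 \<le> T1" using cost_Nil T T1 by simp
    show "J k (set_reg 5 m s') T'" if "J k s' T'" for k m s' T'
      using that by (simp add: J_def)
  qed (use s W in \<open>auto simp: inp_def walk_up_def\<close>)
  then show ?thesis
    unfolding output_com_def using T by (auto simp: fun_upd_twist)
qed

end

section \<open>The whole program\<close>

text \<open>The test skips the empty graph, which has no vertex of minimum degree and for which the
  zero-filled state is already a correct output.\<close>

definition main_com :: com where
  "main_com = Const 1 1 ;; IfLess 2 0
     (min_degree_com ;; label_com ;; init_gates_com ;; gates_com ;; count_com ;; choose_com ;;
      label_com ;; output_com)
     Skip"

text \<open>The factor 250 is spent on the eight stages as 10, 60, 5, 25, 25, 25, 60 and 40.\<close>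

lemma (in daisy) wp_main:
  assumes W: "2 * n + 2 \<le> W" "length (concat adj) \<le> W" and n: "0 < n"
    and T: "250 * (n + length (concat adj) + 1) + 2 \<le> T"
    and exit: "\<And>s T r L xss. labelling adj r {..<n} L \<Longrightarrow> regs s 0 = deg r \<Longrightarrow> length xss = n \<Longrightarrow>
      stores_lists (arrs s 2) (arrs s 3) xss \<Longrightarrow>
      (\<And>w. w < n \<Longrightarrow> distinct (xss ! w) \<and> set (xss ! w) = L w) \<Longrightarrow> P s T"
  shows "wp W main_com P (input_state adj) T"
proof -
  interpret G: adj_graph adj W
  proof
    show "w < n" if "u < n" "w \<in> set (adj ! u)" for u w using nbr_less that .
    show "u \<in> set (adj ! w)" if u: "u < n" "w \<in> set (adj ! u)" for u w
    proof -
      have w: "w < n" using nbr_less u .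
      obtain i where "\<phi> w = sym_diff (\<phi> u) {i}" using nbrs[OF u(1)] u(2) by blast
      then have "\<phi> u = sym_diff (\<phi> w) {i}" by blast
      then show ?thesis using nbrs[OF w] u(1) by blast
    qed
  qed (use distinct_adj W in auto)
  let ?B = "n + length (concat adj) + 1"
  let ?s = "set_reg 1 1 (input_state adj)"
  have "wp W (min_degree_com ;; label_com ;; init_gates_com ;; gates_com ;; count_com ;; choose_com ;;
      label_com ;; output_com) P ?s T0" if T0: "T \<le> T0 + 2" for T0
  proof (rule wp_Seq[THEN iffD2], rule G.wp_min_degree[where e = "240 * ?B"])
    show "inp adj ?s" by (simp add: inp_def input_state_def stores_lists_def)
    show "9 * n + 4 + 240 * ?B \<le> T0" using T T0 by simp
    fix s1 T1 v assume agr1: "agree min_degree_com ?s s1" and v: "regs s1 3 = v" "v < n" "\<And>u. u < n \<Longrightarrow> deg v \<le> deg u"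
      and T1: "240 * ?B \<le> T1"
    have inp1: "inp adj s1" using agr1 by (simp add: com_defs inp_def input_state_def stores_lists_def)
    have z1: "\<And>i. arrs s1 10 i = 0" "\<And>i. arrs s1 11 i = 0" "\<And>i. arrs s1 12 i = 0"
      using agr1 by (auto simp: com_defs input_state_def)
    note F = dspan_min_degree[OF v(2,3)]
    interpret L1: label adj W v "dspan v" "lab v"
      by unfold_locales (rule F(1))
    obtain g lev where g: "gating adj (dspan v) g lev" "\<And>w. w < n \<Longrightarrow> lab v (g w) = lab v w"
      using F(3) by blast
    then have gS: "\<And>w. w < n \<Longrightarrow> g w \<in> dspan v" by (simp add: gating_def)
    show "wp W (label_com ;; init_gates_com ;; gates_com ;; count_com ;; choose_com ;; label_com ;; output_com) P s1 T1"
    proof (rule wp_Seq[THEN iffD2], rule L1.wp_label[where e = "180 * ?B", OF inp1 v(1)])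
      show "60 * ?B + 180 * ?B \<le> T1" using T1 by simp
      fix s2 T2 Q assume agr2: "agree label_com s1 s2" and Q: "distinct Q" "set Q = dspan v" "L1.stored Q s2"
        and T2: "180 * ?B \<le> T2"
      have inp2: "inp adj s2" using inp1 agr2 by (simp add: com_defs inp_def)
      have z2: "\<And>i. arrs s2 10 i = 0" "\<And>i. arrs s2 11 i = 0" "\<And>i. arrs s2 12 i = 0" "regs s2 3 = v"
        using z1 v(1) agr2 by (auto simp: com_defs)
      have Q2: "regs s2 4 = length Q" "\<forall>i<length Q. arrs s2 4 i = Q ! i"
          "tree (lab v) (dspan v) (arrs s2 6) (arrs s2 7) (arrs s2 8)"
        using Q by (auto simp: L1.stored_def)
      show "wp W (init_gates_com ;; gates_com ;; count_com ;; choose_com ;; label_com ;; output_com) P s2 T2"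
      proof (rule wp_Seq[THEN iffD2], rule L1.wp_init_gates[where e = "175 * ?B", OF inp2 Q(1) _ Q2(1,2) z2(1)])
        show "set Q \<subseteq> {..<n}" using Q(2) by (auto simp: dspan_def)
        show "5 * n + 3 + 175 * ?B \<le> T2" using T2 by simp
        fix s3 T3 assume agr3: "agree init_gates_com s2 s3" and 3: "regs s3 18 = length Q"
          "\<And>w. arrs s3 10 w = (if w \<in> set Q then w + 1 else 0)" and T3: "175 * ?B \<le> T3"
        have inp3: "inp adj s3" using inp2 agr3 by (simp add: com_defs inp_def)
        have z3: "\<And>i. arrs s3 11 i = 0" "\<And>i. arrs s3 12 i = 0" "regs s3 3 = v" "regs s3 4 = length Q"
          "\<forall>i<length Q. arrs s3 4 i = Q ! i" "tree (lab v) (dspan v) (arrs s3 6) (arrs s3 7) (arrs s3 8)"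
          using z2 Q2 agr3 by (auto simp: com_defs)
        show "wp W (gates_com ;; count_com ;; choose_com ;; label_com ;; output_com) P s3 T3"
        proof (rule wp_Seq[THEN iffD2], rule L1.wp_gates[where e = "150 * ?B", OF g(1) inp3 Q(1,2) z3(4,5) 3(2) z3(1)])
          show "20 * (n + length (concat adj)) + 2 + 150 * ?B \<le> T3" using T3 by simp
          fix s4 T4 assume agr4: "agree gates_com s3 s4" and 4: "\<forall>i<length Q. arrs s4 4 i = Q ! i"
            "\<And>x. arrs s4 11 (x + 1) = card {w. w < n \<and> g w = x}" and T4: "150 * ?B \<le> T4"
          have inp4: "inp adj s4" using inp3 agr4 by (simp add: com_defs inp_def)
          have z4: "\<And>i. arrs s4 12 i = 0" "regs s4 3 = v" "regs s4 18 = length Q"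
            "tree (lab v) (dspan v) (arrs s4 6) (arrs s4 7) (arrs s4 8)"
            using z3 3(1) agr4 by (auto simp: com_defs)
          show "wp W (count_com ;; choose_com ;; label_com ;; output_com) P s4 T4"
          proof (rule wp_Seq[THEN iffD2], rule L1.wp_count[where e = "125 * ?B", OF inp4 z4(4,3) Q(1,2) 4(1) gS 4(2) z4(1)])
            show "20 * (n + length (concat adj)) + 2 * n + 2 + 125 * ?B \<le> T4" using T4 by simp
            fix s5 T5 assume agr5: "agree count_com s4 s5"
              and "\<And>i. arrs s5 12 i = card {w. w < n \<and> i \<in> lab v (g w)}" and T5: "125 * ?B \<le> T5"
            \<comment> \<open>A gate has the label of its vertex, so counting through gates counts
              all vertices of the graph.\<close>
            then have N: "arrs s5 12 i = card {w. w < n \<and> i \<in> lab v w}" for i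
              using g(2) by (metis (mono_tags, lifting) Collect_cong)
            have inp5: "inp adj s5" using inp4 agr5 by (simp add: com_defs inp_def)
            have z5: "regs s5 3 = v" "regs s5 18 = length Q" "\<forall>i<length Q. arrs s5 4 i = Q ! i"
              "tree (lab v) (dspan v) (arrs s5 6) (arrs s5 7) (arrs s5 8)"
              using z4 4(1) agr5 by (auto simp: com_defs)
            have Nn: "arrs s5 12 i \<le> n" for i
              unfolding N using card_mono[of "{..<n}" "{w. w < n \<and> i \<in> lab v w}"] by auto
            show "wp W (choose_com ;; label_com ;; output_com) P s5 T5"
            proof (rule wp_Seq[THEN iffD2], rule L1.wp_choose[where e = "100 * ?B", OF inp5 z5(4,2,1) Q(1,2) z5(3) Nn])
              show "20 * (n + length (concat adj)) + 2 * n + 3 + 100 * ?B \<le> T5" using T5 by simp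
              fix s6 T6 r assume agr6: "agree choose_com s5 s6" and r3: "regs s6 3 = r" and r: "r \<in> dspan v"
                "lab v r \<subseteq> {i. n < 2 * arrs s5 12 i}"
                and max: "\<And>w. w \<in> dspan v \<Longrightarrow> lab v w \<subseteq> {i. n < 2 * arrs s5 12 i} \<Longrightarrow> card (lab v w) \<le> card (lab v r)"
                and T6: "100 * ?B \<le> T6"
              have inp6: "inp adj s6" using inp5 agr6 by (simp add: com_defs inp_def)
              let ?M = "{k. k < deg v \<and> n < 2 * card {w. w < n \<and> k \<in> lab v w}}"
              have sub: "lab v r \<subseteq> ?M" using r L1.L_sub by (auto simp: N)
              \<comment> \<open>Every set of coordinates is a label in the cube, so
                \<open>?M\<close> itself occurs; a largest label inside \<open>?M\<close> is
                therefore \<open>?M\<close>.\<close>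
              obtain w where w: "w \<in> dspan v" "lab v w = ?M" using F(2)[of ?M] by auto
              then have "card ?M \<le> card (lab v r)" using max[OF w(1)] by (auto simp: N)
              then have "lab v r = ?M" using sub by (intro card_seteq) auto
              then have common: "common i" if "i \<in> \<phi> r" for i
                using median[OF v(2,3) r(1)] that by blast
              have rn: "r < n" using r(1) by (simp add: dspan_def)
              note lab_r = labelling_common[OF rn common]
              interpret L2: label adj W r "{..<n}" "lab r"
                by unfold_locales (rule lab_r)
              show "wp W (label_com ;; output_com) P s6 T6"
              proof (rule wp_Seq[THEN iffD2], rule L2.wp_label[where e = "40 * ?B", OF inp6 r3])
                show "60 * ?B + 40 * ?B \<le> T6" using T6 by simp
                fix s7 T7 Q' assume agr7: "agree label_com s6 s7" and Q': "distinct Q'" "set Q' = {..<n}" "L2.stored Q' s7"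
                  and T7: "40 * ?B \<le> T7"
                have inp7: "inp adj s7" and r7: "regs s7 3 = r"
                  using inp6 r3 agr7 by (auto simp: com_defs inp_def)
                have "tree (lab r) {..<n} (arrs s7 6) (arrs s7 7) (arrs s7 8)"
                  using Q' by (simp add: L2.stored_def)
                then show "wp W output_com P s7 T7"
                  by (rule L2.wp_output[OF refl inp7 _ r7]) (use T7 exit[OF lab_r] in auto)
              qed
            qed
          qed
        qed
      qed
    qed
  qed (use n in simp)
  then show ?thesis
    unfolding main_com_def using n W T by (auto simp: input_state_def)
qed

section \<open>Proper embeddings\<close>

definition supp :: "bool list \<Rightarrow> nat set" where
  "supp w = {i. i < length w \<and> w ! i}"

definition bits :: "nat \<Rightarrow> nat set \<Rightarrow> bool list" where
  "bits h A = map (\<lambda>i. i \<in> A) [0..<h]"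

lemma bits_in_words: "bits h A \<in> words h"
  by (simp add: bits_def words_def)

lemma supp_bits: "A \<subseteq> {..<h} \<Longrightarrow> supp (bits h A) = A"
  by (auto simp: supp_def bits_def)

lemma supp_inj: "u \<in> words h \<Longrightarrow> v \<in> words h \<Longrightarrow> supp u = supp v \<Longrightarrow> u = v"
  by (intro nth_equalityI) (auto simp: supp_def words_def)

lemma supp_subset: "u \<in> words h \<Longrightarrow> supp u \<subseteq> {..<h}"
  by (auto simp: supp_def words_def)

lemma hamming_supp:
  assumes "u \<in> words h" "v \<in> words h"
  shows "hamming u v = card (sym_diff (supp u) (supp v))"
proof -
  have "{i. i < length u \<and> u ! i \<noteq> v ! i} = sym_diff (supp u) (supp v)"
    using assms by (auto simp: supp_def words_def)
  then show ?thesis by (simp add: hamming_def)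
qed

lemma word_le_supp:
  "u \<in> words h \<Longrightarrow> v \<in> words h \<Longrightarrow> word_le u v \<longleftrightarrow> supp u \<subseteq> supp v"
  by (auto simp: word_le_def list_all2_conv_all_nth supp_def words_def)

lemma card_sym_diff_eq_1: "card (sym_diff A B) = 1 \<longleftrightarrow> (\<exists>i. B = sym_diff A {i})"
proof
  assume "card (sym_diff A B) = 1"
  then obtain i where i: "sym_diff A B = {i}" by (rule card_1_singletonE)
  have "B = sym_diff A (sym_diff A B)" by blast
  then show "\<exists>i. B = sym_diff A {i}" unfolding i by blast
next
  assume "\<exists>i. B = sym_diff A {i}"
  then obtain i where "B = sym_diff A {i}" ..
  then have "sym_diff A B = {i}" by blast
  then show "card (sym_diff A B) = 1" by simp
qed

lemma verts_daisy_cube: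
  "verts (daisy_cube h X) = {v \<in> words h. \<exists>x\<in>X. word_le v x}"
  by (auto simp: daisy_cube_def induced_subgraph_def hypercube_def)

lemma edges_daisy_cube:
  assumes "a \<in> verts (daisy_cube h X)" "b \<in> verts (daisy_cube h X)"
  shows "{a, b} \<in> edges (daisy_cube h X) \<longleftrightarrow> (\<exists>i. supp b = sym_diff (supp a) {i})"
proof -
  have w: "a \<in> words h" "b \<in> words h" using assms by (auto simp: verts_daisy_cube)
  have "{a, b} \<in> edges (daisy_cube h X) \<longleftrightarrow> hamming a b = 1 \<or> hamming b a = 1"
    using assms w by (auto simp: verts_daisy_cube daisy_cube_def induced_subgraph_def hypercube_def doubleton_eq_iff)
  also have "\<dots> \<longleftrightarrow> card (sym_diff (supp a) (supp b)) = 1"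
    using w by (simp add: hamming_supp Un_commute)
  finally show ?thesis by (simp add: card_sym_diff_eq_1)
qed

text \<open>The supports of the words form the downset: a subset of the support of a vertex lies
  below the same word of \<open>X\<close>.\<close>

lemma daisy_cube_adjacency:
  assumes G: "is_daisy_cube G" and adj: "adjacency_lists G adj"
  obtains \<phi> where "daisy adj \<phi>"
proof -
  obtain h X f where X: "X \<subseteq> words h" and f: "bij_betw f (verts G) (verts (daisy_cube h X))"
    and e: "\<And>u v. u \<in> verts G \<Longrightarrow> v \<in> verts G \<Longrightarrow> {u, v} \<in> edges G \<longleftrightarrow> {f u, f v} \<in> edges (daisy_cube h X)"
    using G unfolding is_daisy_cube_def is_daisy_cube_of_order_def isomorphic_def by blast
  have V: "verts G = {..<length adj}" using adj by (simp add: adjacency_lists_def)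
  have fV: "f u \<in> verts (daisy_cube h X)" "f u \<in> words h" if "u < length adj" for u
    using f V that by (auto simp: bij_betw_def verts_daisy_cube)
  have "daisy adj (\<lambda>u. supp (f u))"
  proof
    fix u assume u: "u < length adj"
    show "distinct (adj ! u)" using adj u by (simp add: adjacency_lists_def)
    show "finite (supp (f u))" by (simp add: supp_def)
    show "set (adj ! u) = {w. w < length adj \<and> (\<exists>i. supp (f w) = sym_diff (supp (f u)) {i})}"
      using adj u e V fV by (auto simp: adjacency_lists_def edges_daisy_cube)
    fix A assume A: "A \<subseteq> supp (f u)"
    then have Ah: "A \<subseteq> {..<h}" using supp_subset[OF fV(2)[OF u]] by blast
    obtain x where x: "x \<in> X" "word_le (f u) x" using fV(1)[OF u] by (auto simp: verts_daisy_cube)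
    then have "supp (f u) \<subseteq> supp x" using X fV(2)[OF u] word_le_supp by blast
    then have "word_le (bits h A) x"
      using A Ah X x bits_in_words by (subst word_le_supp[of _ h]) (auto simp: supp_bits)
    then have "bits h A \<in> verts (daisy_cube h X)"
      using x bits_in_words by (auto simp: verts_daisy_cube)
    then have "bits h A \<in> f ` {..<length adj}" using f V by (simp add: bij_betw_def)
    then obtain w where "w < length adj" "f w = bits h A" by auto
    then show "\<exists>w<length adj. supp (f w) = A" using Ah supp_bits by auto
  next
    show "inj_on (\<lambda>u. supp (f u)) {..<length adj}"
      using f V fV supp_inj unfolding bij_betw_def inj_on_def by (metis lessThan_iff)
  qed
  then show ?thesis by (rule that)
qed

lemma card_sym_diff_le: "finite A \<Longrightarrow> finite B \<Longrightarrow> finite C \<Longrightarrow>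
    card (sym_diff A C) \<le> card (sym_diff A B) + card (sym_diff B C)"
  by (rule order_trans[OF card_mono card_Un_le]) auto

text \<open>Labels of a labelling of all vertices are closed under deletion, so the daisy cube
  generated by their words contains no further word. The same deletions give paths as short as the
  Hamming distance, and no walk is shorter since an edge toggles one coordinate.\<close>

lemma labelling_proper_embedding:
  assumes G: "adjacency_lists G adj" and lab: "labelling adj r {..<length adj} L"
    and h: "h = length (adj ! r)" and \<alpha>: "\<And>v. v < length adj \<Longrightarrow> \<alpha> v = bits h (L v)"
  shows "proper_embedding G h \<alpha>"
proof -
  let ?n = "length adj"
  have V: "verts G = {..<?n}" using G by (simp add: adjacency_lists_def)
  have L_inj: "\<And>u w. u < ?n \<Longrightarrow> w < ?n \<Longrightarrow> L u = L w \<Longrightarrow> u = w"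
    and L_sub: "\<And>u. u < ?n \<Longrightarrow> L u \<subseteq> {..<h}"
    and L_edge: "\<And>u w. u < ?n \<Longrightarrow> w < ?n \<Longrightarrow> w \<in> set (adj ! u) \<longleftrightarrow> (\<exists>i. L w = sym_diff (L u) {i})"
    using lab h unfolding labelling_def by (auto dest: inj_onD)
  have "\<forall>u\<in>{..<?n}. \<forall>i\<in>L u. \<exists>w\<in>{..<?n}. L w = L u - {i}"
    using lab by (simp add: labelling_def)
  then have L_pred: "\<exists>w<?n. L w = L u - {i}" if "u < ?n" "i \<in> L u" for u i
    using that by (metis lessThan_iff)
  have edge: "{u, w} \<in> edges G \<longleftrightarrow> (\<exists>i. L w = sym_diff (L u) {i})" if "u < ?n" "w < ?n" for u w
    using G that L_edge by (auto simp: adjacency_lists_def)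
  have fin: "finite (L u)" if "u < ?n" for u using L_sub[OF that] finite_subset by blast
  have down: "\<exists>w<?n. L w = L u - A" if "u < ?n" "A \<subseteq> L u" for u A
  proof -
    have "finite A" using that fin finite_subset by blast
    then show ?thesis using that(2)
    proof (induction A)
      case empty
      then show ?case using that by auto
    next
      case (insert a A)
      then obtain w where w: "w < ?n" "L w = L u - A" by auto
      then have "a \<in> L w" using insert by blast
      then obtain w' where "w' < ?n" "L w' = L w - {a}" using L_pred w by blast
      moreover have "L w - {a} = L u - insert a A" using w by blast
      ultimately show ?case by auto
    qed
  qed
  have supp_\<alpha>: "supp (\<alpha> u) = L u" "\<alpha> u \<in> words h" if "u < ?n" for u
    using that L_sub by (auto simp: \<alpha> supp_bits bits_in_words)
  have verts: "verts (daisy_cube h (\<alpha> ` verts G)) = \<alpha> ` verts G"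
  proof (intro equalityI subsetI)
    fix x assume "x \<in> verts (daisy_cube h (\<alpha> ` verts G))"
    then obtain u where x: "x \<in> words h" and u: "u < ?n" "word_le x (\<alpha> u)"
      using V by (auto simp: verts_daisy_cube)
    then have "supp x \<subseteq> L u" using word_le_supp[OF x supp_\<alpha>(2)] supp_\<alpha>(1) by blast
    then obtain w where "w < ?n" "L w = supp x"
      using down[OF u(1), of "L u - supp x"] by (auto simp: double_diff)
    then have "x = \<alpha> w" using supp_inj[OF x] supp_\<alpha> by metis
    then show "x \<in> \<alpha> ` verts G" using V \<open>w < ?n\<close> by blast
  next
    fix x assume "x \<in> \<alpha> ` verts G"
    then show "x \<in> verts (daisy_cube h (\<alpha> ` verts G))"
      using V supp_\<alpha>(2) word_le_supp[of x h x] by (auto simp: verts_daisy_cube)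
  qed
  have "inj_on \<alpha> (verts G)"
    unfolding V by (intro inj_onI L_inj) (auto dest: arg_cong[of _ _ supp] simp: supp_\<alpha>)
  then have "bij_betw \<alpha> (verts G) (verts (daisy_cube h (\<alpha> ` verts G)))"
    by (simp add: verts bij_betw_def)
  moreover have "{u, v} \<in> edges G \<longleftrightarrow> {\<alpha> u, \<alpha> v} \<in> edges (daisy_cube h (\<alpha> ` verts G))"
    if "u \<in> verts G" "v \<in> verts G" for u v
  proof -
    have "\<alpha> u \<in> verts (daisy_cube h (\<alpha> ` verts G))" "\<alpha> v \<in> verts (daisy_cube h (\<alpha> ` verts G))"
      using that by (auto simp: verts)
    from edges_daisy_cube[OF this] show ?thesis
      using that V edge[of u v] supp_\<alpha>(1) by simp
  qed
  ultimately have iso: "isomorphic G (daisy_cube h (\<alpha> ` verts G))"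
    unfolding isomorphic_def by blast
  have words: "\<alpha> ` verts G \<subseteq> words h" using V supp_\<alpha> by auto
  \<comment> \<open>Only deletions are known to stay in the graph. While \<open>L u\<close> has an
    element outside \<open>L v\<close>, it is deleted at the start of the path; afterwards elements
    of \<open>L v\<close> are deleted at its end.\<close>
  have path: "\<exists>p. walk G p \<and> hd p = u \<and> last p = v \<and> length p = Suc (card (sym_diff (L u) (L v)))"
    if "u < ?n" "v < ?n" for u v
    using that
  proof (induction "card (sym_diff (L u) (L v))" arbitrary: u v)
    case 0
    then have "sym_diff (L u) (L v) = {}" using fin by simp
    then have "L u = L v" by blast
    then have "u = v" using 0 L_inj by blast
    then show ?case using 0 V by (intro exI[of _ "[u]"]) (simp add: walk_def)
  next
    case (Suc d)
    show ?case
    proof (cases "L u \<subseteq> L v")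
      case False
      then obtain i where i: "i \<in> L u" "i \<notin> L v" by blast
      obtain w where w: "w < ?n" "L w = L u - {i}" using L_pred Suc.prems(1) i(1) by blast
      have sd: "sym_diff (L u) (L v) = insert i (sym_diff (L w) (L v))" using w i by blast
      have "i \<notin> sym_diff (L w) (L v)" "finite (sym_diff (L w) (L v))" using w i fin Suc.prems by auto
      then have d: "card (sym_diff (L u) (L v)) = Suc (card (sym_diff (L w) (L v)))"
        unfolding sd by simp
      obtain p where p: "walk G p" "hd p = w" "last p = v" "length p = Suc (card (sym_diff (L w) (L v)))"
        using Suc.hyps(1)[of w v] Suc.hyps(2) Suc.prems w(1) d by auto
      have "L w = sym_diff (L u) {i}" using w i by blast
      then have "{u, w} \<in> edges G" using edge Suc.prems w by blast
      then have "walk G (u # p)"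
        using p Suc.prems V by (cases p) (auto simp: walk_def)
      then show ?thesis using p d by (intro exI[of _ "u # p"]) (auto simp: walk_def)
    next
      case True
      have "sym_diff (L u) (L v) \<noteq> {}" using Suc.hyps(2) by (metis card.empty nat.distinct(1))
      then obtain i where i: "i \<in> L v" "i \<notin> L u" using True by blast
      obtain w where w: "w < ?n" "L w = L v - {i}" using L_pred Suc.prems(2) i(1) by blast
      have sd: "sym_diff (L u) (L v) = insert i (sym_diff (L u) (L w))" using w i by blast
      have "i \<notin> sym_diff (L u) (L w)" "finite (sym_diff (L u) (L w))" using w i fin Suc.prems by auto
      then have d: "card (sym_diff (L u) (L v)) = Suc (card (sym_diff (L u) (L w)))"
        unfolding sd by simp
      obtain p where p: "walk G p" "hd p = u" "last p = w" "length p = Suc (card (sym_diff (L u) (L w)))"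
        using Suc.hyps(1)[of u w] Suc.hyps(2) Suc.prems w(1) d by auto
      have "L v = sym_diff (L w) {i}" using w i by blast
      then have "{w, v} \<in> edges G" using edge Suc.prems w by blast
      then have "walk G (p @ [v])"
        using p Suc.prems V by (auto simp: walk_def successively_append_iff)
      then show ?thesis using p d by (intro exI[of _ "p @ [v]"]) (auto simp: walk_def)
    qed
  qed
  have lower: "card (sym_diff (L (hd p)) (L (last p))) \<le> length p - 1" if "walk G p" for p
    using that
  proof (induction p rule: induct_list012)
    case (3 x y zs)
    then have w: "walk G (y # zs)" and e: "{x, y} \<in> edges G" "x < ?n" "y < ?n"
        and sub: "set (y # zs) \<subseteq> {..<?n}"
      using V by (auto simp: walk_def)
    have "last (y # zs) < ?n" using sub last_in_set[of "y # zs"] by blast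
    have "card (sym_diff (L x) (L y)) = 1"
      using edge[OF e(2,3)] e(1) card_sym_diff_eq_1[of "L x" "L y"] by blast
    moreover have "card (sym_diff (L x) (L (last (y # zs)))) \<le>
        card (sym_diff (L x) (L y)) + card (sym_diff (L y) (L (last (y # zs))))"
      using e \<open>last (y # zs) < ?n\<close> by (intro card_sym_diff_le fin)
    ultimately show ?case using "3.IH"(2)[OF w] by simp
  qed (auto simp: walk_def)
  have "enat (hamming (\<alpha> u) (\<alpha> v)) = graph_dist G u v" if uv: "u \<in> verts G" "v \<in> verts G" for u v
  proof -
    have un: "u < ?n" "v < ?n" using uv V by auto
    have ham: "hamming (\<alpha> u) (\<alpha> v) = card (sym_diff (L u) (L v))"
      using hamming_supp[OF supp_\<alpha>(2) supp_\<alpha>(2)] supp_\<alpha>(1) un by metis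
    obtain p where p: "walk G p" "hd p = u" "last p = v" "length p = Suc (card (sym_diff (L u) (L v)))"
      using path un by blast
    show ?thesis
      unfolding graph_dist_def ham
    proof (rule antisym)
      show "enat (card (sym_diff (L u) (L v))) \<le>
          (INF p\<in>{p. walk G p \<and> hd p = u \<and> last p = v}. enat (length p - 1))"
        using lower by (intro INF_greatest) auto
      show "(INF p\<in>{p. walk G p \<and> hd p = u \<and> last p = v}. enat (length p - 1)) \<le>
          enat (card (sym_diff (L u) (L v)))"
        using p by (intro INF_lower2[of p]) auto
    qed
  qed
  then have "isometric_embedding G h \<alpha>"
    using words by (simp add: isometric_embedding_def)
  moreover have "is_daisy_cube_of_order h G"
    unfolding is_daisy_cube_of_order_def using iso words by blast
  ultimately show ?thesis using iso by (simp add: proper_embedding_def)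
qed

section \<open>The size of the input\<close>

text \<open>List entries are ordered pairs of adjacent vertices, and an edge has at most two
  orientations.\<close>

lemma length_adjacency_lists:
  assumes "simple_graph G" and adj: "adjacency_lists G adj"
  shows "length (concat adj) \<le> 2 * card (edges G)"
proof -
  let ?n = "length adj"
  have "edges G \<subseteq> Pow (verts G)" "finite (verts G)"
    using assms(1) by (auto simp: simple_graph_def)
  then have fin: "finite (edges G)" using finite_subset by blast
  have two: "card {(u, w). {u, w} = e} \<le> 2 \<and> finite {(u, w). {u, w} = e}" if e: "e \<in> edges G" for e
  proof -
    have "e \<in> {{u, v} | u v. u \<in> verts G \<and> v \<in> verts G \<and> u \<noteq> v}"
      using e assms(1) unfolding simple_graph_def by blast
    then obtain a b where "e = {a, b}" by auto
    then have sub: "{(u, w). {u, w} = e} \<subseteq> {(a, b), (b, a)}" by (auto simp: doubleton_eq_iff)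
    have "card {(a, b), (b, a)} \<le> 2" using card_length[of "[(a, b), (b, a)]"] by (simp add: numeral_2_eq_2)
    with sub show ?thesis using card_mono[OF _ sub] finite_subset[OF sub] by simp
  qed
  have "length (concat adj) = (\<Sum>u<?n. length (adj ! u))"
    by (simp add: length_concat sum_list_sum_nth atLeast0LessThan)
  also have "\<dots> = (\<Sum>u<?n. card (set (adj ! u)))"
    using adj by (intro sum.cong refl distinct_card[symmetric]) (simp add: adjacency_lists_def)
  also have "\<dots> = card (SIGMA u:{..<?n}. set (adj ! u))"
    by (rule card_SigmaI[symmetric]) auto
  also have "\<dots> \<le> card (\<Union>e\<in>edges G. {(u, w). {u, w} = e})"
    using two adj fin by (intro card_mono) (auto simp: adjacency_lists_def)
  also have "\<dots> \<le> (\<Sum>e\<in>edges G. card {(u, w). {u, w} = e})"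
    using fin by (rule card_UN_le)
  also have "\<dots> \<le> (\<Sum>e\<in>edges G. 2)" using two by (intro sum_mono) auto
  finally show ?thesis by simp
qed

text \<open>Only one vertex can carry the empty set, and every other one has a deletion as
  neighbour. So time linear in vertices and list entries is linear in the edges alone.\<close>

lemma (in daisy) size_le: "n \<le> length (concat adj) + 1"
proof -
  let ?A = "{u. u < n \<and> \<phi> u \<noteq> {}}" and ?B = "{u. u < n \<and> \<phi> u = {}}"
  have deg: "1 \<le> deg u" if u: "u < n" "\<phi> u \<noteq> {}" for u
  proof -
    obtain i where i: "i \<in> \<phi> u" using u by blast
    then obtain w where "w < n" "\<phi> w = \<phi> u - {i}" using down[OF u(1), of "\<phi> u - {i}"] by blast
    moreover have "\<phi> u - {i} = sym_diff (\<phi> u) {i}" using i by blast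
    ultimately have "w \<in> set (adj ! u)" using nbrs[OF u(1)] by auto
    then show ?thesis by (cases "adj ! u") auto
  qed
  have "card ?B \<le> 1"
    by (simp add: card_le_Suc0_iff_eq One_nat_def) (metis inj')
  moreover have AB: "?A \<union> ?B = {..<n}" by auto
  have "n \<le> card ?A + card ?B" using card_Un_le[of ?A ?B] unfolding AB by simp
  moreover have "card ?A = (\<Sum>u\<in>?A. 1)" by simp
  moreover have "(\<Sum>u\<in>?A. 1) \<le> (\<Sum>u<n. deg u)"
    using deg by (intro order_trans[OF sum_mono sum_mono2]) auto
  moreover have "(\<Sum>u<n. deg u) = length (concat adj)"
    by (simp add: length_concat sum_list_sum_nth atLeast0LessThan)
  ultimately show ?thesis by linarith
qed

theorem theorem4:
  shows "\<exists>(prog :: com) (k :: nat). \<forall>(G :: nat graph) (adj :: nat list list).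
     simple_graph G \<and> is_daisy_cube G \<and> adjacency_lists G adj \<longrightarrow>
     (\<exists>t s h \<alpha>.
        exec (k * (card (verts G) + card (edges G) + 1) ^ k) prog (input_state adj) t s \<and>
        t \<le> k * (card (edges G) + 1) \<and>
        outputs_embedding s G h \<alpha> \<and>
        proper_embedding G h \<alpha>)"
\<comment> \<open>With \<open>m\<close> edges the lists have at most \<open>2 * m\<close> entries
  and \<open>n \<le> 2 * m + 1\<close>, so the bound of \<open>wp_main\<close> is at most
  \<open>1000 * m + 502\<close>. The same number is a convenient factor and exponent for the word
  bound, which only has to dominate a linear function.\<close>
proof (rule exI[of _ main_com], rule exI[of _ 1100], intro allI impI)
  fix G :: "nat graph" and adj :: "nat list list"
  assume "simple_graph G \<and> is_daisy_cube G \<and> adjacency_lists G adj"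
  then have G: "simple_graph G" "is_daisy_cube G" "adjacency_lists G adj" by auto
  obtain \<phi> where "daisy adj \<phi>" using daisy_cube_adjacency[OF G(2,3)] .
  then interpret daisy adj \<phi> .
  let ?m = "card (edges G)" and ?k = "1100 :: nat"
  have V: "verts G = {..<n}" using G(3) by (simp add: adjacency_lists_def)
  have len: "length (concat adj) \<le> 2 * ?m" using length_adjacency_lists[OF G(1,3)] .
  let ?W = "?k * (card (verts G) + ?m + 1) ^ ?k"
  have "n + ?m + 1 \<le> (n + ?m + 1) ^ ?k" by (rule self_le_power) auto
  then have W: "?k * (n + ?m + 1) \<le> ?W" unfolding V by simp
  define P where "P s T \<longleftrightarrow> (\<exists>h \<alpha>. outputs_embedding s G h \<alpha> \<and> proper_embedding G h \<alpha>)"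
    for s :: state and T :: nat
  have "wp ?W main_com P (input_state adj) (?k * (?m + 1))"
  proof (cases "n = 0")
    case True
    let ?s = "set_reg 1 1 (input_state adj)"
    have E: "verts G = {}" using V True by simp
    have "outputs_embedding ?s G 0 (\<lambda>_. [])"
      using True E by (auto simp: outputs_embedding_def input_state_def stores_lists_def)
    moreover have "isomorphic G (daisy_cube 0 {})"
      by (auto simp: isomorphic_def E verts_daisy_cube bij_betw_def)
    then have "proper_embedding G 0 (\<lambda>_. [])"
      by (auto simp: proper_embedding_def is_daisy_cube_of_order_def isometric_embedding_def E)
    ultimately have "P ?s T" for T unfolding P_def by blast
    then show ?thesis
      using True W unfolding main_com_def by (auto simp: input_state_def)
  next
    case False
    show ?thesis
    proof (rule wp_main)
      show "0 < n" using False by simp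
      show "2 * n + 2 \<le> ?W" "length (concat adj) \<le> ?W" using W len by auto
      show "250 * (n + length (concat adj) + 1) + 2 \<le> ?k * (?m + 1)"
        using size_le len by simp
      fix s :: state and T r L xss assume lab: "labelling adj r {..<n} L" and r0: "regs s 0 = deg r"
        and xss: "length xss = n" "stores_lists (arrs s 2) (arrs s 3) xss"
          "\<And>w. w < n \<Longrightarrow> distinct (xss ! w) \<and> set (xss ! w) = L w"
      let ?\<alpha> = "\<lambda>v. word_of (deg r) (xss ! v)"
      have "L w \<subseteq> {..<deg r}" if "w < n" for w
        using lab that by (simp add: labelling_def)
      then have "distinct (xss ! w) \<and> set (xss ! w) \<subseteq> {..<deg r}" if "w < length xss" for w
        using xss(1) xss(3)[of w] that by simp
      then have "\<forall>xs\<in>set xss. distinct xs \<and> set xs \<subseteq> {..<deg r}"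
        by (metis in_set_conv_nth)
      then have "outputs_embedding s G (deg r) ?\<alpha>"
        unfolding outputs_embedding_def using r0 xss V by auto
      moreover have "proper_embedding G (deg r) ?\<alpha>"
        using xss by (intro labelling_proper_embedding[OF G(3) lab refl]) (simp add: word_of_def bits_def)
      ultimately show "P s T" unfolding P_def by blast
    qed
  qed
  then show "\<exists>t s h \<alpha>. exec ?W main_com (input_state adj) t s \<and> t \<le> ?k * (?m + 1) \<and>
      outputs_embedding s G h \<alpha> \<and> proper_embedding G h \<alpha>"
    unfolding wp_def P_def by blast
qed

end
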